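(* Let $x_1,\dots,x_\ell\in\mathbb{R}$ be distinct. A bounded Jacobi matrix $J$ with parameters $a_n>0$, $b_n\in\mathbb{R}$ ($n=1,2,\dots$) has $$\sigma_{\mathrm{ess}}(J)=\{x_1,\dots,x_\ell\}$$ if and only if the following three conditions hold: (i) $\displaystyle\lim_{n\to\infty}a_na_{n+1}\cdots a_{n+\ell-1}=0$. (ii) If $1\le k\le\ell$ and $n_j\to\infty$ is a sequence such that $$a_{n_j}\to0,\qquad a_{n_j+k}\to0,$$ $$a_{n_j+m}\to\tilde a_m\ne0\quad(m=1,2,\dots,k-1),\qquad b_{n_j+m}\to\tilde b_m\quad(m=1,2,\dots,k),$$ then the finite $k\times k$ tridiagonal matrix $$\tilde J=\begin{pmatrix}\tilde b_1&\tilde a_1&&&\\ \tilde a_1&\tilde b_2&\tilde a_2&&\\ &\ddots&\ddots&\ddots&\\ &&\ddots&\ddots&\tilde a_{k-1}\\ &&&\tilde a_{k-1}&\tilde b_k\end{pmatrix}$$ has spectrum a $k$-element subset of $\{x_1,\dots,x_\ell\}$. (iii) Each $x_j$ occurs as an eigenvalue of at least one limit matrix $\tilde J$ of the form described in (ii).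
   Context: The Jacobi matrix $J$ is the tridiagonal selfadjoint operator on $\ell^2(\{1,2,\dots\})$ with $J_{n,n}=b_n$, $J_{n,n+1}=J_{n+1,n}=a_n$; bounded means $\sup_n(|a_n|+|b_n|)<\infty$. $\sigma_{\mathrm{ess}}$ denotes essential spectrum. *)

theory Defs
  imports
    "HOL-Analysis.Analysis"
    "Jordan_Normal_Form.Spectral_Radius"
begin

section \<open>The complex Hilbert space of square-summable sequences on the positive integers\<close>

text \<open>Sequences are total functions on the naturals; those on \<open>{1, 2, \<dots>}\<close> are represented
  by the ones with value \<open>0\<close> at index \<open>0\<close>.\<close>

typedef ell2 = "{u :: nat \<Rightarrow> complex. u 0 = 0 \<and> summable (\<lambda>n. (cmod (u n))\<^sup>2)}"
  by (intro exI[of _ "\<lambda>_. 0"]) simp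

setup_lifting type_definition_ell2

lemma square_summable_add:
  fixes u v :: "nat \<Rightarrow> complex"
  assumes "summable (\<lambda>n. (cmod (u n))\<^sup>2)" "summable (\<lambda>n. (cmod (v n))\<^sup>2)"
  shows "summable (\<lambda>n. (cmod (u n + v n))\<^sup>2)"
proof (rule summable_comparison_test')
  show "summable (\<lambda>n. 2 * (cmod (u n))\<^sup>2 + 2 * (cmod (v n))\<^sup>2)"
    by (intro summable_add summable_mult assms)
  fix n
  have "(cmod (u n + v n))\<^sup>2 \<le> (cmod (u n) + cmod (v n))\<^sup>2"
    by (simp add: norm_triangle_ineq power_mono)
  also have "\<dots> \<le> 2 * (cmod (u n))\<^sup>2 + 2 * (cmod (v n))\<^sup>2"
    using sum_squares_bound[of "cmod (u n)" "cmod (v n)"] by (simp add: power2_sum)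
  finally show "norm ((cmod (u n + v n))\<^sup>2) \<le> 2 * (cmod (u n))\<^sup>2 + 2 * (cmod (v n))\<^sup>2"
    by simp
qed

lemma square_summable_mult:
  fixes u :: "nat \<Rightarrow> complex"
  assumes "summable (\<lambda>n. (cmod (u n))\<^sup>2)"
  shows "summable (\<lambda>n. (cmod (c * u n))\<^sup>2)"
  using summable_mult[OF assms, of "(cmod c)\<^sup>2"] by (simp add: norm_mult power_mult_distrib)

lemma summable_cnj_mult:
  fixes u v :: "nat \<Rightarrow> complex"
  assumes "summable (\<lambda>n. (cmod (u n))\<^sup>2)" "summable (\<lambda>n. (cmod (v n))\<^sup>2)"
  shows "summable (\<lambda>n. cnj (u n) * v n)"
proof (rule summable_comparison_test')
  show "summable (\<lambda>n. (cmod (u n))\<^sup>2 + (cmod (v n))\<^sup>2)"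
    by (intro summable_add assms)
  fix n
  have "2 * (cmod (u n) * cmod (v n)) \<le> (cmod (u n))\<^sup>2 + (cmod (v n))\<^sup>2"
    using sum_squares_bound[of "cmod (u n)" "cmod (v n)"] by simp
  moreover have "0 \<le> cmod (u n) * cmod (v n)" by simp
  ultimately have "cmod (u n) * cmod (v n) \<le> (cmod (u n))\<^sup>2 + (cmod (v n))\<^sup>2"
    by linarith
  then show "norm (cnj (u n) * v n) \<le> (cmod (u n))\<^sup>2 + (cmod (v n))\<^sup>2"
    by (simp add: norm_mult)
qed

lift_definition scaleC :: "complex \<Rightarrow> ell2 \<Rightarrow> ell2" (infixr \<open>*\<^sub>C\<close> 75)
  is "\<lambda>c u n. c * u n"
  by (simp add: square_summable_mult)

lift_definition cinner :: "ell2 \<Rightarrow> ell2 \<Rightarrow> complex"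
  is "\<lambda>u v. \<Sum>n. cnj (u n) * v n" .

text \<open>The library only has real inner product spaces. The complex inner product enters through
  its real part, which induces the same norm.\<close>

instantiation ell2 :: real_inner
begin

lift_definition zero_ell2 :: ell2 is "\<lambda>_. 0" by simp
lift_definition plus_ell2 :: "ell2 \<Rightarrow> ell2 \<Rightarrow> ell2" is "\<lambda>u v n. u n + v n"
  by (simp add: square_summable_add)
lift_definition uminus_ell2 :: "ell2 \<Rightarrow> ell2" is "\<lambda>u n. - u n" by simp
definition minus_ell2 :: "ell2 \<Rightarrow> ell2 \<Rightarrow> ell2" where "minus_ell2 u v = u + - v"
definition scaleR_ell2 :: "real \<Rightarrow> ell2 \<Rightarrow> ell2" where
  "scaleR_ell2 r u = complex_of_real r *\<^sub>C u"
definition inner_ell2 :: "ell2 \<Rightarrow> ell2 \<Rightarrow> real" where "inner_ell2 u v = Re (cinner u v)"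
definition norm_ell2 :: "ell2 \<Rightarrow> real" where "norm_ell2 u = sqrt (inner u u)"
definition dist_ell2 :: "ell2 \<Rightarrow> ell2 \<Rightarrow> real" where "dist_ell2 u v = norm (u - v)"
definition sgn_ell2 :: "ell2 \<Rightarrow> ell2" where "sgn_ell2 u = inverse (norm u) *\<^sub>R u"
definition uniformity_ell2 :: "(ell2 \<times> ell2) filter" where
  "uniformity_ell2 = (INF e\<in>{0<..}. principal {(u, v). dist u v < e})"
definition open_ell2 :: "ell2 set \<Rightarrow> bool" where
  "open_ell2 U = (\<forall>x\<in>U. eventually (\<lambda>(x', y). x' = x \<longrightarrow> y \<in> U) uniformity)"

instance
proof
  fix u v w :: ell2 and r s :: real and U :: "ell2 set"
  show "u + v + w = u + (v + w)" by transfer (simp add: add.assoc)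
  show "u + v = v + u" by transfer (simp add: add.commute)
  show "0 + u = u" by transfer simp
  show "- u + u = 0" by transfer simp
  show "u - v = u + - v" by (fact minus_ell2_def)
  show "r *\<^sub>R (u + v) = r *\<^sub>R u + r *\<^sub>R v"
    unfolding scaleR_ell2_def by transfer (simp add: distrib_left)
  show "(r + s) *\<^sub>R u = r *\<^sub>R u + s *\<^sub>R u"
    unfolding scaleR_ell2_def by transfer (simp add: distrib_right)
  show "r *\<^sub>R s *\<^sub>R u = (r * s) *\<^sub>R u"
    unfolding scaleR_ell2_def by transfer (simp add: mult.assoc)
  show "1 *\<^sub>R u = u"
    unfolding scaleR_ell2_def by transfer simp
  show "sgn u = inverse (norm u) *\<^sub>R u" by (fact sgn_ell2_def)
  show "dist u v = norm (u - v)" by (fact dist_ell2_def)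
  show "uniformity = (INF e\<in>{0<..}. principal {(u :: ell2, v). dist u v < e})"
    by (fact uniformity_ell2_def)
  show "open U = (\<forall>x\<in>U. \<forall>\<^sub>F (x', y) in uniformity. x' = x \<longrightarrow> y \<in> U)"
    by (fact open_ell2_def)
  show "inner u v = inner v u"
    unfolding inner_ell2_def
  proof transfer
    fix u v :: "nat \<Rightarrow> complex"
    assume uv: "u 0 = 0 \<and> summable (\<lambda>n. (cmod (u n))\<^sup>2)" "v 0 = 0 \<and> summable (\<lambda>n. (cmod (v n))\<^sup>2)"
    then have "summable (\<lambda>n. cnj (u n) * v n)" "summable (\<lambda>n. cnj (v n) * u n)"
      by (auto intro: summable_cnj_mult)
    then show "Re (\<Sum>n. cnj (u n) * v n) = Re (\<Sum>n. cnj (v n) * u n)"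
      by (simp add: Re_suminf mult.commute)
  qed
  show "inner (u + v) w = inner u w + inner v w"
    unfolding inner_ell2_def
  proof transfer
    fix u v w :: "nat \<Rightarrow> complex"
    assume "u 0 = 0 \<and> summable (\<lambda>n. (cmod (u n))\<^sup>2)" "v 0 = 0 \<and> summable (\<lambda>n. (cmod (v n))\<^sup>2)"
      "w 0 = 0 \<and> summable (\<lambda>n. (cmod (w n))\<^sup>2)"
    then have "summable (\<lambda>n. cnj (u n) * w n)" "summable (\<lambda>n. cnj (v n) * w n)"
      by (auto intro: summable_cnj_mult)
    then show "Re (\<Sum>n. cnj (u n + v n) * w n)
        = Re (\<Sum>n. cnj (u n) * w n) + Re (\<Sum>n. cnj (v n) * w n)"
      by (simp add: distrib_right suminf_add[symmetric])
  qed
  show "inner (r *\<^sub>R u) v = r * inner u v"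
    unfolding inner_ell2_def scaleR_ell2_def
  proof transfer
    fix r :: real and u v :: "nat \<Rightarrow> complex"
    assume "u 0 = 0 \<and> summable (\<lambda>n. (cmod (u n))\<^sup>2)" "v 0 = 0 \<and> summable (\<lambda>n. (cmod (v n))\<^sup>2)"
    then have "summable (\<lambda>n. cnj (u n) * v n)"
      by (auto intro: summable_cnj_mult)
    then show "Re (\<Sum>n. cnj (complex_of_real r * u n) * v n) = r * Re (\<Sum>n. cnj (u n) * v n)"
      by (simp add: mult.assoc suminf_mult)
  qed
  have *: "cnj z * z = complex_of_real ((cmod z)\<^sup>2)" for z
    by (metis complex_norm_square mult.commute)
  have sq: "inner u u = (\<Sum>n. (cmod (Rep_ell2 u n))\<^sup>2)"
    and summ: "summable (\<lambda>n. (cmod (Rep_ell2 u n))\<^sup>2)"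
  proof -
    show s: "summable (\<lambda>n. (cmod (Rep_ell2 u n))\<^sup>2)" using Rep_ell2[of u] by simp
    have "inner u u = Re (\<Sum>n. complex_of_real ((cmod (Rep_ell2 u n))\<^sup>2))"
      unfolding inner_ell2_def cinner.rep_eq * ..
    also have "\<dots> = (\<Sum>n. (cmod (Rep_ell2 u n))\<^sup>2)"
      by (subst suminf_of_real[OF s, symmetric]) simp
    finally show "inner u u = (\<Sum>n. (cmod (Rep_ell2 u n))\<^sup>2)" .
  qed
  show "0 \<le> inner u u" unfolding sq by (rule suminf_nonneg[OF summ]) simp
  show "(inner u u = 0) = (u = 0)"
    unfolding sq
    by (subst suminf_eq_zero_iff[OF summ])
       (auto simp: Rep_ell2_inject[symmetric] zero_ell2.rep_eq fun_eq_iff)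
  show "norm u = sqrt (inner u u)" by (fact norm_ell2_def)
qed

end

global_interpretation complex_ell2: vector_space scaleC
proof
  fix c d :: complex and u v :: ell2
  show "c *\<^sub>C (u + v) = c *\<^sub>C u + c *\<^sub>C v" by transfer (simp add: distrib_left)
  show "(c + d) *\<^sub>C u = c *\<^sub>C u + d *\<^sub>C u" by transfer (simp add: distrib_right)
  show "c *\<^sub>C d *\<^sub>C u = (c * d) *\<^sub>C u" by transfer (simp add: mult.assoc)
  show "1 *\<^sub>C u = u" by transfer simp
qed


section \<open>Spectrum and essential spectrum\<close>

definition bounded_clinear :: "(ell2 \<Rightarrow> ell2) \<Rightarrow> bool" where
  "bounded_clinear T \<longleftrightarrow> bounded_linear T \<and> (\<forall>c u. T (c *\<^sub>C u) = c *\<^sub>C T u)"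

definition op_spectrum :: "(ell2 \<Rightarrow> ell2) \<Rightarrow> complex set" where
  "op_spectrum T = {z. \<not> (\<exists>R. bounded_clinear R \<and>
     (\<forall>u. R (T u - z *\<^sub>C u) = u) \<and> (\<forall>u. T (R u) - z *\<^sub>C R u = u))}"

definition eigenspace :: "(ell2 \<Rightarrow> ell2) \<Rightarrow> complex \<Rightarrow> ell2 set" where
  "eigenspace T z = {u. T u = z *\<^sub>C u}"

text \<open>For a selfadjoint operator the discrete spectrum consists of the isolated points of the
  spectrum that are eigenvalues of finite multiplicity, and the essential spectrum is the rest of
  the spectrum. (For operators that are not normal, several inequivalent notions are in use and
  geometric multiplicity is not the right one.)\<close>

definition discrete_spectrum :: "(ell2 \<Rightarrow> ell2) \<Rightarrow> complex set" where
  "discrete_spectrum T = {z. z isolated_in op_spectrum T \<and> eigenspace T z \<noteq> {0} \<and>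
     (\<exists>B. finite B \<and> eigenspace T z = complex_ell2.span B)}"

definition essential_spectrum :: "(ell2 \<Rightarrow> ell2) \<Rightarrow> complex set" where
  "essential_spectrum T = op_spectrum T - discrete_spectrum T"


section \<open>Jacobi matrices\<close>

definition bounded_parameters :: "(nat \<Rightarrow> real) \<Rightarrow> (nat \<Rightarrow> real) \<Rightarrow> bool" where
  "bounded_parameters a b \<longleftrightarrow> bdd_above ((\<lambda>n. \<bar>a n\<bar> + \<bar>b n\<bar>) ` {1..})"

text \<open>The parameters are indexed from \<open>1\<close>; \<open>a 0\<close> and \<open>b 0\<close> are irrelevant. The first row needs
  no separate treatment, since elements of the Hilbert space vanish at \<open>0\<close>.\<close>

definition jacobi_seq :: "(nat \<Rightarrow> real) \<Rightarrow> (nat \<Rightarrow> real) \<Rightarrow> (nat \<Rightarrow> complex) \<Rightarrow> nat \<Rightarrow> complex" where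
  "jacobi_seq a b u n = (if n = 0 then 0 else
     complex_of_real (a (n - 1)) * u (n - 1) + complex_of_real (b n) * u n
       + complex_of_real (a n) * u (n + 1))"

text \<open>Meaningful for bounded parameters only, see \<open>Rep_jacobi\<close> below.\<close>

definition jacobi :: "(nat \<Rightarrow> real) \<Rightarrow> (nat \<Rightarrow> real) \<Rightarrow> ell2 \<Rightarrow> ell2" where
  "jacobi a b u = Abs_ell2 (jacobi_seq a b (Rep_ell2 u))"

lemma square_summable_bounded_mult:
  fixes u :: "nat \<Rightarrow> complex"
  assumes "summable (\<lambda>n. (cmod (u n))\<^sup>2)" and "\<And>n. \<bar>c n\<bar> \<le> C"
  shows "summable (\<lambda>n. (cmod (complex_of_real (c n) * u n))\<^sup>2)"
proof (rule summable_comparison_test')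
  show "summable (\<lambda>n. C\<^sup>2 * (cmod (u n))\<^sup>2)" by (intro summable_mult assms)
  fix n
  have "(c n)\<^sup>2 \<le> C\<^sup>2" using power_mono[OF assms(2)[of n], of 2] by simp
  then show "norm ((cmod (complex_of_real (c n) * u n))\<^sup>2) \<le> C\<^sup>2 * (cmod (u n))\<^sup>2"
    by (simp add: norm_mult power_mult_distrib mult_right_mono)
qed

lemma Rep_jacobi:
  assumes "bounded_parameters a b"
  shows "Rep_ell2 (jacobi a b u) = jacobi_seq a b (Rep_ell2 u)"
proof -
  from assms obtain C where C: "\<And>n. n \<ge> 1 \<Longrightarrow> \<bar>a n\<bar> + \<bar>b n\<bar> \<le> C"
    unfolding bounded_parameters_def bdd_above_def by fastforce
  define D where "D = max C (\<bar>a 0\<bar> + \<bar>b 0\<bar>)"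
  have D: "\<bar>a n\<bar> + \<bar>b n\<bar> \<le> D" for n
    using C[of n] by (cases n) (auto simp: D_def)
  have aD: "\<bar>a n\<bar> \<le> D" and bD: "\<bar>b n\<bar> \<le> D" for n
    using D[of n] by auto
  define w where "w = Rep_ell2 u"
  have w: "summable (\<lambda>n. (cmod (w n))\<^sup>2)" using Rep_ell2[of u] by (simp add: w_def)
  have w_up: "summable (\<lambda>n. (cmod (w (n + k)))\<^sup>2)" for k
    using summable_iff_shift[of "\<lambda>n. (cmod (w n))\<^sup>2" k] w by simp
  have "summable (\<lambda>n. (cmod (complex_of_real (a n) * w n + complex_of_real (b (n+1)) * w (n+1)
      + complex_of_real (a (n+1)) * w (n+2)))\<^sup>2)"
    using aD bD
    by (intro square_summable_add square_summable_bounded_mult[where C = D] w w_up) auto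
  then have "summable (\<lambda>n. (cmod (jacobi_seq a b w (Suc n)))\<^sup>2)"
    by (simp add: jacobi_seq_def)
  then have "summable (\<lambda>n. (cmod (jacobi_seq a b w n))\<^sup>2)"
    by (subst (asm) summable_Suc_iff)
  moreover have "jacobi_seq a b w 0 = 0" by (simp add: jacobi_seq_def)
  ultimately show ?thesis
    unfolding jacobi_def w_def[symmetric] by (intro Abs_ell2_inverse) simp
qed

text \<open>The finite tridiagonal matrix with diagonal \<open>d 1, \<dots>, d k\<close> and off-diagonal
  \<open>c 1, \<dots>, c (k - 1)\<close>. Matrix indices in the library start at \<open>0\<close>.\<close>

definition tridiagonal :: "nat \<Rightarrow> (nat \<Rightarrow> real) \<Rightarrow> (nat \<Rightarrow> real) \<Rightarrow> complex mat" where
  "tridiagonal k c d = mat k k (\<lambda>(i, j).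
     if i = j then complex_of_real (d (i + 1))
     else if j = i + 1 then complex_of_real (c (i + 1))
     else if i = j + 1 then complex_of_real (c (j + 1))
     else 0)"

definition limit_matrix ::
    "(nat \<Rightarrow> real) \<Rightarrow> (nat \<Rightarrow> real) \<Rightarrow> nat \<Rightarrow> complex mat \<Rightarrow> bool" where
  "limit_matrix a b k M \<longleftrightarrow> (\<exists>n c d.
     (\<forall>j. 1 \<le> n j) \<and> filterlim n at_top sequentially \<and>
     (\<lambda>j. a (n j)) \<longlonglongrightarrow> 0 \<and> (\<lambda>j. a (n j + k)) \<longlonglongrightarrow> 0 \<and>
     (\<forall>m\<in>{1..<k}. (\<lambda>j. a (n j + m)) \<longlonglongrightarrow> c m \<and> c m \<noteq> 0) \<and>
     (\<forall>m\<in>{1..k}. (\<lambda>j. b (n j + m)) \<longlonglongrightarrow> d m) \<and>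
     M = tridiagonal k c d)"

end

theory Submission
  imports Defs
begin

text \<open>Call \<open>z\<close> singular for \<open>J\<close> if \<open>J - z\<close> is not bounded below on vectors supported far out.
  The eigenspaces of \<open>J\<close> are at most one-dimensional, and the essential spectrum is exactly the set
  of singular points; this needs no spectral theorem, only that \<open>J\<close> is symmetric.

  An eigenvector of a limit matrix, transplanted to the positions \<open>n\<^sub>j + 1, \<dots>, n\<^sub>j + k\<close>, is an
  approximate eigenvector of \<open>J\<close>, so its eigenvalue is singular. Conversely, under (i) every window
  of length \<open>l\<close> far out contains a small coupling. Cutting \<open>J\<close> at these couplings turns it, up to a
  small perturbation, into a direct sum of blocks of size at most \<open>l\<close>, and a block of minimal size
  carrying approximate eigenvectors converges to a limit matrix.

  If the singular points are among \<open>x\<^sub>1, \<dots>, x\<^sub>l\<close>, then \<open>p(J)\<close> for \<open>p(t) = (t - x\<^sub>1) \<cdots> (t - x\<^sub>l)\<close> is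
  small far out, and its entries \<open>a\<^sub>n \<cdots> a\<^sub>n\<^sub>+\<^sub>l\<^sub>-\<^sub>1\<close> tend to \<open>0\<close>, which is (i).\<close>

section \<open>The Hilbert space and Jacobi operators\<close>

text \<open>Two facts would usually come from functional calculus: near an isolated point
  \<open>z\<close> of the spectrum \<open>J - z\<close> is bounded below off its kernel, and far out
  \<open>p(J)\<close> is as small as \<open>p\<close> is on the singular points. Both are replaced
  by extremal arguments. The optimal constant of an inequality between quadratic forms is
  considered; vectors that nearly attain it nearly solve a polynomial equation in \<open>J\<close>,
  and this polynomial factors into shifts that are bounded below. A vector supported far out may
  meet infinitely many small couplings, so removing them one by one would accumulate errors. They
  are removed all at once: the error is governed by the largest removed coupling, and the resulting
  direct sum loses nothing by Pythagoras. The count in (ii) does not depend on \<open>J\<close>.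
  When the inner couplings do not vanish, the eigenvalues of a tridiagonal matrix are the zeros of a
  polynomial defined by a three-term recurrence, and Green's formula excludes multiple
  zeros.\<close>

lemma Rep_ell2_0 [simp]: "Rep_ell2 u 0 = 0"
  using Rep_ell2[of u] by simp

lemma Rep_ell2_summable: "summable (\<lambda>n. (cmod (Rep_ell2 u n))\<^sup>2)"
  using Rep_ell2[of u] by simp

lemma ell2_eqI: "(\<And>n. Rep_ell2 u n = Rep_ell2 v n) \<Longrightarrow> u = v"
  by (simp add: Rep_ell2_inject[symmetric] fun_eq_iff)

lemma Rep_ell2_minus: "Rep_ell2 (u - v) n = Rep_ell2 u n - Rep_ell2 v n"
  unfolding minus_ell2_def plus_ell2.rep_eq uminus_ell2.rep_eq by simp

lemma Rep_ell2_scaleR: "Rep_ell2 (r *\<^sub>R u) n = complex_of_real r * Rep_ell2 u n"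
  by (simp add: scaleR_ell2_def scaleC.rep_eq)

lemmas Rep_ell2_simps [simp] = Rep_ell2_minus Rep_ell2_scaleR scaleC.rep_eq plus_ell2.rep_eq
  uminus_ell2.rep_eq zero_ell2.rep_eq

lemma scaleC_of_real: "complex_of_real r *\<^sub>C u = r *\<^sub>R u"
  by (simp add: scaleR_ell2_def)

lemma scaleC_diff_right: "c *\<^sub>C (u - v) = c *\<^sub>C u - c *\<^sub>C v"
  by (rule ell2_eqI) (simp add: algebra_simps)

lemma scaleC_scaleR: "c *\<^sub>C (r *\<^sub>R u) = r *\<^sub>R (c *\<^sub>C u)"
  by (rule ell2_eqI) (simp add: algebra_simps)

lemma norm_ell2_square: "(norm u)\<^sup>2 = (\<Sum>n. (cmod (Rep_ell2 u n))\<^sup>2)"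
proof -
  have *: "cnj z * z = complex_of_real ((cmod z)\<^sup>2)" for z
    by (metis complex_norm_square mult.commute)
  have "(norm u)\<^sup>2 = Re (\<Sum>n. complex_of_real ((cmod (Rep_ell2 u n))\<^sup>2))"
    unfolding power2_norm_eq_inner inner_ell2_def cinner.rep_eq * ..
  also have "\<dots> = (\<Sum>n. (cmod (Rep_ell2 u n))\<^sup>2)"
    by (subst suminf_of_real[OF Rep_ell2_summable, symmetric]) simp
  finally show ?thesis .
qed

lemma norm_ell2_sums: "(\<lambda>n. (cmod (Rep_ell2 u n))\<^sup>2) sums (norm u)\<^sup>2"
  by (simp add: norm_ell2_square Rep_ell2_summable summable_sums)

lemma norm_ell2_finite:
  assumes "finite S" "\<And>n. n \<notin> S \<Longrightarrow> Rep_ell2 u n = 0"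
  shows "(norm u)\<^sup>2 = (\<Sum>n\<in>S. (cmod (Rep_ell2 u n))\<^sup>2)"
  unfolding norm_ell2_square by (rule suminf_finite) (use assms in auto)

lemma norm_ell2_partial_le:
  assumes "finite S"
  shows "(\<Sum>n\<in>S. (cmod (Rep_ell2 u n))\<^sup>2) \<le> (norm u)\<^sup>2"
  unfolding norm_ell2_square by (rule sum_le_suminf) (simp_all add: assms Rep_ell2_summable)

lemma cmod_Rep_ell2_le: "cmod (Rep_ell2 u n) \<le> norm u"
  using norm_ell2_partial_le[of "{n}" u] power2_le_imp_le[of "cmod (Rep_ell2 u n)" "norm u"] by simp

lemma norm_ell2_mono:
  assumes "\<And>n. cmod (Rep_ell2 u n) \<le> cmod (Rep_ell2 v n)"
  shows "norm u \<le> norm v"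
proof (rule power2_le_imp_le)
  show "(norm u)\<^sup>2 \<le> (norm v)\<^sup>2"
    unfolding norm_ell2_square
    by (rule suminf_le) (simp_all add: assms power_mono Rep_ell2_summable)
qed simp

lemma norm_scaleC: "norm (c *\<^sub>C u) = cmod c * norm u"
proof -
  have "(norm (c *\<^sub>C u))\<^sup>2 = (cmod c)\<^sup>2 * (norm u)\<^sup>2"
    unfolding norm_ell2_square
    by (simp add: norm_mult power_mult_distrib suminf_mult Rep_ell2_summable)
  then show ?thesis
    by (metis norm_ge_zero power2_eq_iff_nonneg power_mult_distrib zero_le_mult_iff)
qed

text \<open>Coordinates converge, and letting \<open>m\<close> tend to infinity in finite partial
  sums of the Cauchy estimate bounds the squared distance to the limit uniformly in the number of
  terms. Completeness feeds the fixed point theorem in \<open>coercive_surj\<close> and the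
  summation in \<open>near_kernel\<close>.\<close>

lemma ell2_Cauchy_convergent:
  fixes X :: "nat \<Rightarrow> ell2"
  assumes "Cauchy X"
  shows "convergent X"
proof -
  have "Cauchy (\<lambda>n. Rep_ell2 (X n) k)" for k
  proof (rule metric_CauchyI)
    fix e :: real assume "e > 0"
    then obtain M where "\<And>m n. m \<ge> M \<Longrightarrow> n \<ge> M \<Longrightarrow> dist (X m) (X n) < e"
      using metric_CauchyD[OF assms \<open>e > 0\<close>] by blast
    moreover have "dist (Rep_ell2 (X m) k) (Rep_ell2 (X n) k) \<le> dist (X m) (X n)" for m n
      using cmod_Rep_ell2_le[of "X m - X n" k] by (simp add: dist_norm)
    ultimately have "\<forall>m\<ge>M. \<forall>n\<ge>M. dist (Rep_ell2 (X m) k) (Rep_ell2 (X n) k) < e"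
      by (meson le_less_trans)
    then show "\<exists>M. \<forall>m\<ge>M. \<forall>n\<ge>M. dist (Rep_ell2 (X m) k) (Rep_ell2 (X n) k) < e" ..
  qed
  then have "\<exists>l. (\<lambda>n. Rep_ell2 (X n) k) \<longlonglongrightarrow> l" for k
    by (simp add: Cauchy_convergent_iff convergent_def)
  then obtain v where v: "\<And>k. (\<lambda>n. Rep_ell2 (X n) k) \<longlonglongrightarrow> v k"
    by metis
  have v0: "v 0 = 0"
    using v[of 0] by (simp add: LIMSEQ_const_iff)
  have part: "(\<Sum>k<K. (cmod (Rep_ell2 (X n) k - v k))\<^sup>2) \<le> e\<^sup>2"
    if M: "\<And>m n. m \<ge> M \<Longrightarrow> n \<ge> M \<Longrightarrow> dist (X m) (X n) < e" and n: "n \<ge> M" for M e n K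
  proof (rule tendsto_upperbound)
    show "((\<lambda>m. \<Sum>k<K. (cmod (Rep_ell2 (X n) k - Rep_ell2 (X m) k))\<^sup>2) \<longlongrightarrow>
        (\<Sum>k<K. (cmod (Rep_ell2 (X n) k - v k))\<^sup>2)) sequentially"
      by (intro tendsto_intros v)
    show "\<forall>\<^sub>F m in sequentially. (\<Sum>k<K. (cmod (Rep_ell2 (X n) k - Rep_ell2 (X m) k))\<^sup>2) \<le> e\<^sup>2"
      using eventually_ge_at_top[of M]
    proof eventually_elim
      case (elim m)
      have "(\<Sum>k<K. (cmod (Rep_ell2 (X n - X m) k))\<^sup>2) \<le> (norm (X n - X m))\<^sup>2"
        by (rule norm_ell2_partial_le) simp
      also have "\<dots> \<le> e\<^sup>2"
        using M[OF n elim] by (intro power_mono) (auto simp: dist_norm)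
      finally show ?case by simp
    qed
  qed simp
  have summ: "summable (\<lambda>k. (cmod (Rep_ell2 (X n) k - v k))\<^sup>2)"
    if "\<And>m n. m \<ge> M \<Longrightarrow> n \<ge> M \<Longrightarrow> dist (X m) (X n) < e" "n \<ge> M" for M e n
    by (rule bounded_imp_summable[where B = "e\<^sup>2"])
       (use part[OF that, where K = "Suc _"] in \<open>auto simp: lessThan_Suc_atMost\<close>)
  obtain M1 where M1: "\<And>m n. m \<ge> M1 \<Longrightarrow> n \<ge> M1 \<Longrightarrow> dist (X m) (X n) < 1"
    using metric_CauchyD[OF assms, of 1] by auto
  \<comment> \<open>The limit \<open>v\<close> is recovered as a member of the space minus a
    square-summable difference.\<close>
  have "summable (\<lambda>k. (cmod (Rep_ell2 (X M1) k + (- 1) * (Rep_ell2 (X M1) k - v k)))\<^sup>2)"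
    by (intro square_summable_add square_summable_mult Rep_ell2_summable summ[OF M1]) auto
  then have "summable (\<lambda>k. (cmod (v k))\<^sup>2)"
    by simp
  with v0 have Rv: "Rep_ell2 (Abs_ell2 v) = v"
    by (intro Abs_ell2_inverse) simp
  have "X \<longlonglongrightarrow> Abs_ell2 v"
  proof (rule metric_LIMSEQ_I)
    fix r :: real assume "r > 0"
    then obtain M where M: "\<And>m n. m \<ge> M \<Longrightarrow> n \<ge> M \<Longrightarrow> dist (X m) (X n) < r / 2"
      using metric_CauchyD[OF assms, of "r / 2"] \<open>r > 0\<close> by auto
    have "dist (X n) (Abs_ell2 v) < r" if "n \<ge> M" for n
    proof -
      have "(norm (X n - Abs_ell2 v))\<^sup>2 \<le> (r / 2)\<^sup>2"
        unfolding norm_ell2_square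
        by (rule suminf_le_const[OF Rep_ell2_summable])
           (use part[OF M that] in \<open>simp add: Rv\<close>)
      then have "norm (X n - Abs_ell2 v) \<le> r / 2"
        using \<open>r > 0\<close> power2_le_imp_le by fastforce
      then show ?thesis using \<open>r > 0\<close> by (simp add: dist_norm)
    qed
    then show "\<exists>M. \<forall>n\<ge>M. dist (X n) (Abs_ell2 v) < r" by blast
  qed
  then show ?thesis by (auto simp: convergent_def)
qed

instance ell2 :: banach
  by standard (rule ell2_Cauchy_convergent)

section \<open>Coordinate projections and finitely supported vectors\<close>

lift_definition restr :: "nat set \<Rightarrow> ell2 \<Rightarrow> ell2" is "\<lambda>S u n. if n \<in> S then u n else 0"
proof -
  fix S :: "nat set" and u :: "nat \<Rightarrow> complex"
  assume "u 0 = 0 \<and> summable (\<lambda>n. (cmod (u n))\<^sup>2)"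
  then show "(if 0 \<in> S then u 0 else 0) = 0 \<and> summable (\<lambda>n. (cmod (if n \<in> S then u n else 0))\<^sup>2)"
    by (auto intro: summable_comparison_test'[of "\<lambda>n. (cmod (u n))\<^sup>2"])
qed

declare restr.rep_eq [simp]

lemma restr_split: "restr S u + restr (- S) u = u"
  by (rule ell2_eqI) simp

lemma inner_eq_0_disjoint:
  assumes "\<And>n. Rep_ell2 u n = 0 \<or> Rep_ell2 v n = 0"
  shows "inner u v = 0"
proof -
  have "cnj (Rep_ell2 u n) * Rep_ell2 v n = 0" for n
    using assms[of n] by auto
  then have "(\<lambda>n. cnj (Rep_ell2 u n) * Rep_ell2 v n) = (\<lambda>n. 0)"
    by blast
  then show ?thesis
    unfolding inner_ell2_def cinner.rep_eq by simp
qed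

lemma norm_disjoint:
  assumes "\<And>n. Rep_ell2 u n = 0 \<or> Rep_ell2 v n = 0"
  shows "(norm (u + v))\<^sup>2 = (norm u)\<^sup>2 + (norm v)\<^sup>2"
  using inner_eq_0_disjoint[OF assms] by (simp add: power2_norm_eq_inner inner_add inner_commute)

lemma restr_lessThan_tendsto: "(\<lambda>M. restr {..<M} u) \<longlonglongrightarrow> u"
proof -
  have eq: "(norm (restr {..<M} u - u))\<^sup>2 = (norm u)\<^sup>2 - (\<Sum>n<M. (cmod (Rep_ell2 u n))\<^sup>2)" for M
  proof -
    have "(norm (restr {..<M} u + restr (- {..<M}) u))\<^sup>2
        = (norm (restr {..<M} u))\<^sup>2 + (norm (restr (- {..<M}) u))\<^sup>2"
      by (rule norm_disjoint) simp
    moreover have "(norm (restr {..<M} u))\<^sup>2 = (\<Sum>n<M. (cmod (Rep_ell2 u n))\<^sup>2)"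
      by (subst norm_ell2_finite[of "{..<M}"]) auto
    moreover have "restr {..<M} u - u = - restr (- {..<M}) u"
      by (rule ell2_eqI) simp
    ultimately show ?thesis using restr_split[of "{..<M}" u] by simp
  qed
  have "(\<lambda>M. (norm (restr {..<M} u - u))\<^sup>2) \<longlonglongrightarrow> (norm u)\<^sup>2 - (norm u)\<^sup>2"
    unfolding eq by (intro tendsto_diff tendsto_const norm_ell2_sums[unfolded sums_def])
  then have "(\<lambda>M. sqrt ((norm (restr {..<M} u - u))\<^sup>2)) \<longlonglongrightarrow> sqrt 0"
    by (intro tendsto_real_sqrt) simp
  then have "(\<lambda>M. norm (restr {..<M} u - u)) \<longlonglongrightarrow> 0"
    by simp
  then show ?thesis
    using LIM_zero_cancel tendsto_norm_zero_iff by blast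
qed

text \<open>The clause \<open>n \<noteq> 0\<close> keeps the sequence in the space for any
  \<open>S\<close> and \<open>f\<close>, since members vanish at \<open>0\<close>.\<close>

definition ell2_of :: "nat set \<Rightarrow> (nat \<Rightarrow> complex) \<Rightarrow> ell2" where
  "ell2_of S f = Abs_ell2 (\<lambda>n. if n \<in> S \<and> n \<noteq> 0 then f n else 0)"

lemma Rep_ell2_of:
  assumes "finite S"
  shows "Rep_ell2 (ell2_of S f) n = (if n \<in> S \<and> n \<noteq> 0 then f n else 0)"
proof -
  have "summable (\<lambda>n. (cmod (if n \<in> S \<and> n \<noteq> 0 then f n else 0))\<^sup>2)"
    by (rule summable_finite[OF assms]) auto
  then show ?thesis
    unfolding ell2_of_def by (subst Abs_ell2_inverse) auto
qed

section \<open>Boundedness and symmetry of Jacobi operators\<close>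

lemma jacobi_bound:
  assumes a: "\<And>n. 1 \<le> n \<Longrightarrow> \<bar>a n\<bar> \<le> A" and b: "\<And>n. 1 \<le> n \<Longrightarrow> \<bar>b n\<bar> \<le> A"
  shows "bounded_parameters a b" and "norm (jacobi a b u) \<le> 3 * A * norm u"
proof -
  show bp: "bounded_parameters a b"
    unfolding bounded_parameters_def bdd_above_def
    by (rule exI[of _ "2 * A"]) (use a b in \<open>fastforce\<close>)
  have A: "0 \<le> A" using a[of 1] by linarith
  define w where "w n = (cmod (Rep_ell2 u n))\<^sup>2" for n
  have w: "w sums (norm u)\<^sup>2"
    unfolding w_def by (rule norm_ell2_sums)
  have w0: "w 0 = 0" by (simp add: w_def)
  have wS: "(\<lambda>n. w (Suc n)) sums (norm u)\<^sup>2"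
    using w w0 by (simp add: sums_Suc_iff)
  have wSS: "summable (\<lambda>n. w (Suc (Suc n)))"
    using wS summable_Suc_iff[of "\<lambda>n. w (Suc n)"] by (simp add: sums_iff)
  have wSS': "(\<Sum>n. w (Suc (Suc n))) \<le> (norm u)\<^sup>2"
    using wS suminf_split_head[of "\<lambda>n. w (Suc n)"] by (simp add: sums_iff w_def)
  have ws: "summable w" "summable (\<lambda>n. w (Suc n))"
    using w wS by (auto simp: sums_iff)
  have bound: "(cmod (Rep_ell2 (jacobi a b u) (Suc n)))\<^sup>2 \<le> 3 * A\<^sup>2 * (w n + w (Suc n) + w (Suc (Suc n)))" for n
  proof -
    have *: "(p + q + r)\<^sup>2 \<le> 3 * (p\<^sup>2 + q\<^sup>2 + r\<^sup>2)" for p q r :: real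
      using sum_squares_bound[of p q] sum_squares_bound[of p r] sum_squares_bound[of q r]
      by (simp add: power2_eq_square algebra_simps)
    \<comment> \<open>For \<open>n = 0\<close> there is no bound on \<open>a 0\<close>, but the
      factor \<open>Rep_ell2 u 0\<close> vanishes.\<close>
    have 1: "cmod (complex_of_real (a n) * Rep_ell2 u n) \<le> A * cmod (Rep_ell2 u n)"
      using a[of n] by (cases n) (auto simp: norm_mult intro!: mult_right_mono)
    have 2: "cmod (complex_of_real (b (Suc n)) * Rep_ell2 u (Suc n)) \<le> A * cmod (Rep_ell2 u (Suc n))"
      using b[of "Suc n"] by (auto simp: norm_mult intro!: mult_right_mono)
    have 3: "cmod (complex_of_real (a (Suc n)) * Rep_ell2 u (Suc (Suc n))) \<le> A * cmod (Rep_ell2 u (Suc (Suc n)))"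
      using a[of "Suc n"] by (auto simp: norm_mult intro!: mult_right_mono)
    have "cmod (Rep_ell2 (jacobi a b u) (Suc n)) \<le>
        A * cmod (Rep_ell2 u n) + A * cmod (Rep_ell2 u (Suc n)) + A * cmod (Rep_ell2 u (Suc (Suc n)))"
      unfolding Rep_jacobi[OF bp] jacobi_seq_def using 1 2 3
      by (auto intro!: norm_triangle_le add_mono)
    then have "(cmod (Rep_ell2 (jacobi a b u) (Suc n)))\<^sup>2 \<le>
        (A * cmod (Rep_ell2 u n) + A * cmod (Rep_ell2 u (Suc n)) + A * cmod (Rep_ell2 u (Suc (Suc n))))\<^sup>2"
      by (intro power_mono) auto
    also have "\<dots> \<le> 3 * ((A * cmod (Rep_ell2 u n))\<^sup>2 + (A * cmod (Rep_ell2 u (Suc n)))\<^sup>2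
        + (A * cmod (Rep_ell2 u (Suc (Suc n))))\<^sup>2)"
      by (rule *)
    also have "\<dots> = 3 * A\<^sup>2 * (w n + w (Suc n) + w (Suc (Suc n)))"
      by (simp add: w_def power_mult_distrib algebra_simps)
    finally show ?thesis .
  qed
  have "(norm (jacobi a b u))\<^sup>2 = (\<Sum>n. (cmod (Rep_ell2 (jacobi a b u) (Suc n)))\<^sup>2)"
    using suminf_split_head[OF Rep_ell2_summable[of "jacobi a b u"]] norm_ell2_square[of "jacobi a b u"]
    by simp
  also have "\<dots> \<le> (\<Sum>n. 3 * A\<^sup>2 * (w n + w (Suc n) + w (Suc (Suc n))))"
    using ws wSS by (intro suminf_le bound summable_mult summable_add)
      (auto simp: summable_Suc_iff[of "\<lambda>n. (cmod (Rep_ell2 (jacobi a b u) n))\<^sup>2"] Rep_ell2_summable)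
  also have "\<dots> = 3 * A\<^sup>2 * (suminf w + (\<Sum>n. w (Suc n)) + (\<Sum>n. w (Suc (Suc n))))"
    using ws wSS by (simp add: suminf_mult suminf_add[symmetric] summable_add)
  also have "\<dots> \<le> 3 * A\<^sup>2 * ((norm u)\<^sup>2 + (norm u)\<^sup>2 + (norm u)\<^sup>2)"
    using w wS wSS' by (intro mult_left_mono add_mono) (auto simp: sums_iff)
  also have "\<dots> = (3 * A * norm u)\<^sup>2"
    by (simp add: power2_eq_square)
  finally show "norm (jacobi a b u) \<le> 3 * A * norm u"
    by (rule power2_le_imp_le) (simp add: A)
qed

lemma bounded_parametersE:
  assumes "bounded_parameters a b"
  obtains A where "A > 0" "\<And>n. 1 \<le> n \<Longrightarrow> \<bar>a n\<bar> \<le> A" "\<And>n. 1 \<le> n \<Longrightarrow> \<bar>b n\<bar> \<le> A"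
proof -
  from assms obtain C where C: "\<And>n. n \<ge> 1 \<Longrightarrow> \<bar>a n\<bar> + \<bar>b n\<bar> \<le> C"
    unfolding bounded_parameters_def bdd_above_def by fastforce
  show thesis
    by (rule that[of "max C 1"]) (use C in \<open>fastforce+\<close>)
qed

lemma bounded_clinear_jacobi:
  assumes "bounded_parameters a b"
  shows "bounded_clinear (jacobi a b)"
proof -
  obtain A where A: "A > 0" "\<And>n. 1 \<le> n \<Longrightarrow> \<bar>a n\<bar> \<le> A" "\<And>n. 1 \<le> n \<Longrightarrow> \<bar>b n\<bar> \<le> A"
    by (rule bounded_parametersE[OF assms]) blast
  have C: "jacobi a b (c *\<^sub>C u) = c *\<^sub>C jacobi a b u" for c u
    by (rule ell2_eqI) (simp add: Rep_jacobi[OF assms] jacobi_seq_def algebra_simps)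
  have "bounded_linear (jacobi a b)"
  proof (rule bounded_linear_intro)
    fix u v show "jacobi a b (u + v) = jacobi a b u + jacobi a b v"
      by (rule ell2_eqI) (simp add: Rep_jacobi[OF assms] jacobi_seq_def algebra_simps)
  next
    fix r u show "jacobi a b (r *\<^sub>R u) = r *\<^sub>R jacobi a b u"
      by (simp add: scaleR_ell2_def C)
  next
    fix u show "norm (jacobi a b u) \<le> norm u * (3 * A)"
      using jacobi_bound(2)[OF A(2,3)] by (simp add: mult.commute)
  qed
  with C show ?thesis by (simp add: bounded_clinear_def)
qed

text \<open>Summation by parts: the difference of the two summands is the increment of the discrete
  Wronskian \<open>D\<close>. Its boundary terms vanish, at \<open>0\<close> because vectors are
  \<open>0\<close> there, at infinity because coordinates tend to \<open>0\<close> while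
  \<open>a\<close> stays bounded.\<close>

lemma jacobi_symmetric:
  assumes bp: "bounded_parameters a b"
  shows "inner (jacobi a b u) v = inner u (jacobi a b v)"
proof -
  let ?u = "Rep_ell2 u" and ?v = "Rep_ell2 v"
  obtain A where A: "A > 0" "\<And>n. 1 \<le> n \<Longrightarrow> \<bar>a n\<bar> \<le> A" "\<And>n. 1 \<le> n \<Longrightarrow> \<bar>b n\<bar> \<le> A"
    by (rule bounded_parametersE[OF bp]) blast
  define D where "D n = complex_of_real (a n) * (cnj (?u (Suc n)) * ?v n - cnj (?u n) * ?v (Suc n))" for n
  have u0: "?u \<longlonglongrightarrow> 0" and v0: "?v \<longlonglongrightarrow> 0"
    using summable_LIMSEQ_zero[OF Rep_ell2_summable] by (simp_all add: tendsto_norm_zero_iff)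
  have "D \<longlonglongrightarrow> 0"
  proof (rule Lim_null_comparison)
    show "\<forall>\<^sub>F n in sequentially. norm (D n) \<le>
        A * (cmod (?u (Suc n)) * cmod (?v n) + cmod (?u n) * cmod (?v (Suc n)))"
      using eventually_ge_at_top[of 1]
    proof eventually_elim
      case (elim n)
      have "norm (D n) \<le> \<bar>a n\<bar> * (cmod (?u (Suc n)) * cmod (?v n) + cmod (?u n) * cmod (?v (Suc n)))"
        unfolding D_def norm_mult norm_of_real
        by (intro mult_left_mono) (auto intro!: norm_triangle_le_diff simp: norm_mult)
      also have "\<dots> \<le> A * (cmod (?u (Suc n)) * cmod (?v n) + cmod (?u n) * cmod (?v (Suc n)))"
        using A(2)[OF elim] by (intro mult_right_mono) auto
      finally show ?case .
    qed
    have "(\<lambda>n. A * (cmod (?u (Suc n)) * cmod (?v n) + cmod (?u n) * cmod (?v (Suc n))))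
        \<longlonglongrightarrow> A * (cmod 0 * cmod 0 + cmod 0 * cmod 0)"
      by (intro tendsto_intros u0 v0 LIMSEQ_Suc)
    then show "(\<lambda>n. A * (cmod (?u (Suc n)) * cmod (?v n) + cmod (?u n) * cmod (?v (Suc n)))) \<longlonglongrightarrow> 0"
      by simp
  qed
  then have "(\<lambda>n. D (Suc n) - D n) sums (0 - D 0)"
    by (rule telescope_sums)
  moreover have "D (Suc n) - D n = cnj (Rep_ell2 (jacobi a b u) (Suc n)) * ?v (Suc n)
      - cnj (?u (Suc n)) * Rep_ell2 (jacobi a b v) (Suc n)" for n
    by (simp add: D_def Rep_jacobi[OF bp] jacobi_seq_def algebra_simps)
  ultimately have "(\<lambda>n. cnj (Rep_ell2 (jacobi a b u) (Suc n)) * ?v (Suc n)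
      - cnj (?u (Suc n)) * Rep_ell2 (jacobi a b v) (Suc n)) sums 0"
    by (simp add: D_def)
  then have "(\<lambda>n. cnj (Rep_ell2 (jacobi a b u) n) * ?v n
      - cnj (?u n) * Rep_ell2 (jacobi a b v) n) sums 0"
    by (subst (asm) sums_Suc_iff) simp
  moreover have "summable (\<lambda>n. cnj (Rep_ell2 (jacobi a b u) n) * ?v n)"
    "summable (\<lambda>n. cnj (?u n) * Rep_ell2 (jacobi a b v) n)"
    by (intro summable_cnj_mult Rep_ell2_summable)+
  ultimately have "cinner (jacobi a b u) v = cinner u (jacobi a b v)"
    unfolding cinner.rep_eq by (simp add: sums_iff suminf_diff[symmetric])
  then show ?thesis by (simp add: inner_ell2_def)
qed

section \<open>Symmetric operators\<close>

lemma inner_scaleC_left: "inner (z *\<^sub>C u) v = inner u (cnj z *\<^sub>C v)"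
  unfolding inner_ell2_def cinner.rep_eq by (simp add: algebra_simps)

lemma inner_ii_left: "inner (\<i> *\<^sub>C u) v = - inner u (\<i> *\<^sub>C v)"
proof -
  have "cnj \<i> *\<^sub>C v = - (\<i> *\<^sub>C v)" by (rule ell2_eqI) simp
  then show ?thesis by (simp add: inner_scaleC_left)
qed

lemma norm_diff_scaleR_square:
  fixes u v :: "'a :: real_inner"
  shows "(norm (u - t *\<^sub>R v))\<^sup>2 = (norm u)\<^sup>2 - 2 * t * inner v u + t\<^sup>2 * (norm v)\<^sup>2"
  unfolding power2_norm_eq_inner
  by (simp add: inner_diff inner_commute power2_eq_square algebra_simps)

text \<open>Lax-Milgram by the Banach fixed point theorem: a solution of \<open>B u = v\<close> is a
  fixed point of the relaxation \<open>u - t *\<^sub>R (B u - v)\<close>, which contracts for a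
  suitable \<open>t\<close>.\<close>

lemma coercive_surj:
  fixes B :: "'a :: {real_inner, banach} \<Rightarrow> 'a"
  assumes "bounded_linear B" and c: "c > 0" and co: "\<And>u. c * (norm u)\<^sup>2 \<le> inner (B u) u"
  shows "\<exists>u. B u = v"
proof -
  interpret B: bounded_linear B by fact
  obtain K0 where K0: "\<And>u. norm (B u) \<le> norm u * K0"
    using B.pos_bounded by blast
  \<comment> \<open>Enlarging the bound to at least \<open>c\<close> makes
    \<open>1 - (c / K)\<^sup>2\<close> nonnegative, so its root \<open>q\<close> can serve as
    contraction factor.\<close>
  define K where "K = max K0 c"
  have K: "norm (B u) \<le> K * norm u" for u
    using K0[of u] mult_left_mono[of K0 K "norm u"] by (simp add: K_def mult.commute)
  have Kc: "c \<le> K" "0 < K" using c by (auto simp: K_def)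
  \<comment> \<open>The minimizer of \<open>1 - 2 * t * c + t\<^sup>2 * K\<^sup>2\<close>; the
    minimum is \<open>q\<^sup>2\<close>.\<close>
  define t where "t = c / K\<^sup>2"
  define q where "q = sqrt (1 - (c / K)\<^sup>2)"
  have cK: "0 < (c / K)\<^sup>2" "(c / K)\<^sup>2 \<le> 1"
    using c Kc by (auto simp: power_le_one)
  have q: "0 \<le> q" "q < 1" "q\<^sup>2 = 1 - (c / K)\<^sup>2"
    using cK by (auto simp: q_def)
  have contr: "norm (w - t *\<^sub>R B w) \<le> q * norm w" for w
  proof (rule power2_le_imp_le)
    have "(norm (w - t *\<^sub>R B w))\<^sup>2 = (norm w)\<^sup>2 - 2 * t * inner (B w) w + t\<^sup>2 * (norm (B w))\<^sup>2"
      by (rule norm_diff_scaleR_square)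
    also have "\<dots> \<le> (norm w)\<^sup>2 - 2 * t * (c * (norm w)\<^sup>2) + t\<^sup>2 * (K * norm w)\<^sup>2"
      using co[of w] c Kc K[of w]
      by (intro add_mono diff_mono mult_left_mono power_mono order_refl) (auto simp: t_def)
    also have "\<dots> = (q * norm w)\<^sup>2"
      unfolding power_mult_distrib q using Kc by (simp add: t_def power2_eq_square field_simps)
    finally show "(norm (w - t *\<^sub>R B w))\<^sup>2 \<le> (q * norm w)\<^sup>2" .
    show "0 \<le> q * norm w" using q by simp
  qed
  define g where "g u = u - t *\<^sub>R (B u - v)" for u
  have "dist (g x) (g y) \<le> q * dist x y" for x y
  proof -
    have "g x - g y = (x - y) - t *\<^sub>R B (x - y)"
      by (simp add: g_def B.diff algebra_simps)
    then show ?thesis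
      using contr[of "x - y"] by (simp add: dist_norm)
  qed
  then have "\<exists>!u. g u = u"
    using q by (intro banach_fix_type) auto
  then obtain u where "g u = u" by blast
  then have "B u = v" using c Kc by (simp add: g_def t_def)
  then show ?thesis ..
qed

section \<open>Symmetric operators: the spectrum as failure of a lower bound\<close>

locale symmetric_op =
  fixes T :: "ell2 \<Rightarrow> ell2"
  assumes bounded_clinear: "bounded_clinear T"
    and symmetric: "inner (T u) v = inner u (T v)"
begin

lemma bounded_linear: "bounded_linear T"
  using bounded_clinear by (simp add: bounded_clinear_def)

sublocale bounded_linear T
  by (fact bounded_linear)

lemma scaleC: "T (c *\<^sub>C u) = c *\<^sub>C T u"
  using bounded_clinear by (simp add: bounded_clinear_def)

lemma pos_boundE:
  obtains K where "K > 0" "\<And>u. norm (T u) \<le> K * norm u"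
  using pos_bounded by (metis mult.commute)

lemma symmetric_op_shift: "symmetric_op (\<lambda>u. T u - complex_of_real x *\<^sub>C u)"
proof
  have "bounded_linear (\<lambda>u. T u - x *\<^sub>R u)"
    by (intro bounded_linear_sub bounded_linear bounded_linear_scaleR_right)
  moreover have "T (c *\<^sub>C u) - x *\<^sub>R c *\<^sub>C u = c *\<^sub>C (T u - x *\<^sub>R u)" for c u
    by (rule ell2_eqI) (simp add: scaleC algebra_simps)
  ultimately show "bounded_clinear (\<lambda>u. T u - complex_of_real x *\<^sub>C u)"
    by (simp add: bounded_clinear_def scaleC_of_real)
  show "inner (T u - complex_of_real x *\<^sub>C u) v = inner u (T v - complex_of_real x *\<^sub>C v)" for u v
    by (simp add: scaleC_of_real inner_diff symmetric)
qed

text \<open>The cross term vanishes: \<open>T - Re z\<close> is symmetric and commutes with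
  multiplication by \<open>\<i>\<close>, which is skew for the real inner product. Hence nonreal
  points admit a lower bound, and \<open>T - z\<close> and \<open>T - cnj z\<close> have equal norms
  on every vector.\<close>

lemma norm_shift_square:
  "(norm (T u - z *\<^sub>C u))\<^sup>2 = (norm (T u - complex_of_real (Re z) *\<^sub>C u))\<^sup>2 + (Im z)\<^sup>2 * (norm u)\<^sup>2"
proof -
  interpret S: symmetric_op "\<lambda>u. T u - complex_of_real (Re z) *\<^sub>C u"
    by (rule symmetric_op_shift)
  define w where "w = T u - complex_of_real (Re z) *\<^sub>C u"
  have eq: "T u - z *\<^sub>C u = w - Im z *\<^sub>R (\<i> *\<^sub>C u)"
  proof (rule ell2_eqI)
    fix n
    have "z * x = complex_of_real (Re z) * x + complex_of_real (Im z) * (\<i> * x)" for x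
      by (simp add: complex_eq_iff algebra_simps)
    then show "Rep_ell2 (T u - z *\<^sub>C u) n = Rep_ell2 (w - Im z *\<^sub>R (\<i> *\<^sub>C u)) n"
      by (simp add: w_def)
  qed
  have "inner w (\<i> *\<^sub>C u) = inner u (\<i> *\<^sub>C w)"
    unfolding w_def S.symmetric S.scaleC ..
  also have "\<dots> = - inner w (\<i> *\<^sub>C u)"
    using inner_ii_left[of w u] by (simp add: inner_commute)
  finally have "inner w (\<i> *\<^sub>C u) = 0" by simp
  then have "(norm (w - Im z *\<^sub>R (\<i> *\<^sub>C u)))\<^sup>2 = (norm w)\<^sup>2 + (Im z)\<^sup>2 * (norm (\<i> *\<^sub>C u))\<^sup>2"
    unfolding norm_diff_scaleR_square by (simp add: inner_commute)
  then show ?thesis unfolding eq by (simp add: norm_scaleC w_def)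
qed

lemma norm_shift_Im: "\<bar>Im z\<bar> * norm u \<le> norm (T u - z *\<^sub>C u)"
  by (rule power2_le_imp_le) (simp_all add: norm_shift_square[of u z] power_mult_distrib)

definition below :: "complex \<Rightarrow> bool" where
  "below z \<longleftrightarrow> (\<exists>c>0. \<forall>u. c * norm u \<le> norm (T u - z *\<^sub>C u))"

text \<open>Solve the normal equation: \<open>S (cnj z)\<close> is the adjoint of
  \<open>S z\<close>, so their composition is coercive with constant \<open>c\<^sup>2\<close>, and
  some \<open>u\<close> satisfies \<open>S (cnj z) (S z u - v) = 0\<close>. By
  \<open>norm_shift_square\<close> also \<open>S (cnj z)\<close> is bounded below, hence
  \<open>S z u = v\<close>.\<close>

lemma shift_bij:
  assumes "below z"
  shows "\<exists>R. bounded_clinear R \<and> (\<forall>u. R (T u - z *\<^sub>C u) = u) \<and> (\<forall>u. T (R u) - z *\<^sub>C R u = u)"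
proof -
  define S where "S w u = T u - w *\<^sub>C u" for w u
  obtain c where c: "c > 0" "\<And>u. c * norm u \<le> norm (S z u)"
    using assms by (auto simp: below_def S_def)
  have S_diff: "S w (u - v) = S w u - S w v" for w u v
    by (simp add: S_def diff scaleC_diff_right)
  have S_adj: "inner (S w u) v = inner u (S (cnj w) v)" for w u v
    by (simp add: S_def inner_diff symmetric inner_scaleC_left)
  have S_scaleC: "S w (d *\<^sub>C u) = d *\<^sub>C S w u" for w d u
    by (rule ell2_eqI) (simp add: S_def scaleC algebra_simps)
  have S_add: "S w (u + v) = S w u + S w v" for w u v
    by (rule ell2_eqI) (simp add: S_def add algebra_simps)
  obtain K where K: "K > 0" "\<And>u. norm (T u) \<le> K * norm u"
    by (rule pos_boundE) blast
  have S_bl: "bounded_linear (S w)" for w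
  proof (rule bounded_linear_intro)
    show "S w (r *\<^sub>R u) = r *\<^sub>R S w u" for r u
      by (simp add: scaleR_ell2_def S_scaleC)
    show "norm (S w u) \<le> norm u * (K + cmod w)" for u
      unfolding S_def using K(2)[of u] norm_triangle_ineq4[of "T u" "w *\<^sub>C u"]
      by (simp add: norm_scaleC algebra_simps)
  qed (rule S_add)
  have inj: "u = v" if "S z u = S z v" for u v
    using c(2)[of "u - v"] c(1) that by (simp add: S_diff mult_le_0_iff)
  have surj: "\<exists>u. S z u = v" for v
  proof -
    have "\<exists>u. (S (cnj z) \<circ> S z) u = S (cnj z) v"
    proof (rule coercive_surj)
      show "bounded_linear (S (cnj z) \<circ> S z)"
        unfolding o_def by (rule bounded_linear_compose[OF S_bl S_bl])
      show "0 < c\<^sup>2" using c by simp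
      show "c\<^sup>2 * (norm u)\<^sup>2 \<le> inner ((S (cnj z) \<circ> S z) u) u" for u
        using power_mono[OF c(2)[of u], of 2] c(1)
        by (simp add: S_adj power2_norm_eq_inner power_mult_distrib)
    qed
    then obtain u where u: "S (cnj z) (S z u - v) = 0" by (auto simp: S_diff)
    have "c * norm w \<le> norm (S (cnj z) w)" for w
    proof (rule order_trans[OF c(2)])
      have "(norm (S z w))\<^sup>2 = (norm (S (cnj z) w))\<^sup>2"
        unfolding S_def norm_shift_square[of w z] norm_shift_square[of w "cnj z"] by simp
      then show "norm (S z w) \<le> norm (S (cnj z) w)" by simp
    qed
    from this[of "S z u - v"] c(1) u have "S z u - v = 0"
      by (simp add: mult_le_0_iff)
    then show ?thesis by auto
  qed
  then obtain R where R: "\<And>v. S z (R v) = v" by metis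
  have R': "R (S z u) = u" for u
    by (rule inj) (rule R)
  have "bounded_linear R"
  proof (rule bounded_linear_intro)
    show "R (u + v) = R u + R v" for u v
      by (rule inj) (simp add: R S_add)
    show "R (r *\<^sub>R u) = r *\<^sub>R R u" for r u
      by (rule inj) (simp add: R S_scaleC scaleR_ell2_def)
    show "norm (R u) \<le> norm u * (1 / c)" for u
      using c(2)[of "R u"] c(1) by (simp add: R field_simps)
  qed
  moreover have "R (d *\<^sub>C u) = d *\<^sub>C R u" for d u
    by (rule inj) (simp add: R S_scaleC)
  ultimately show ?thesis
    using R R' by (intro exI[of _ R]) (auto simp: bounded_clinear_def S_def)
qed

lemma spectrum_iff: "z \<in> op_spectrum T \<longleftrightarrow> \<not> below z"
proof -
  have "below z" if R: "bounded_clinear R" "\<And>u. R (T u - z *\<^sub>C u) = u" for R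
  proof -
    interpret R: bounded_linear R using R(1) by (simp add: bounded_clinear_def)
    obtain K where K: "K > 0" "\<And>u. norm (R u) \<le> norm u * K"
      using R.pos_bounded by blast
    have "1 / K * norm u \<le> norm (T u - z *\<^sub>C u)" for u
      using K(2)[of "T u - z *\<^sub>C u"] K(1) R(2)[of u] by (simp add: field_simps)
    then show ?thesis unfolding below_def using K(1) by (intro exI[of _ "1 / K"]) auto
  qed
  then show ?thesis
    unfolding op_spectrum_def using shift_bij[of z] by blast
qed

lemma below_nonreal: "Im z \<noteq> 0 \<Longrightarrow> below z"
  unfolding below_def using norm_shift_Im[of z] by (intro exI[of _ "\<bar>Im z\<bar>"]) auto

section \<open>A spectral gap around \<open>0\<close> and the distance to the kernel\<close>

lemma below_square_shift:
  assumes "below (complex_of_real r)" "below (complex_of_real (- r))"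
  shows "\<exists>c>0. \<forall>u. c * norm u \<le> norm (T (T u) - r\<^sup>2 *\<^sub>R u)"
proof -
  obtain c where c: "c > 0" "\<And>u. c * norm u \<le> norm (T u - r *\<^sub>R u)"
    using assms(1) by (auto simp: below_def scaleC_of_real)
  obtain d where d: "d > 0" "\<And>u. d * norm u \<le> norm (T u - (- r) *\<^sub>R u)"
    using assms(2) by (auto simp only: below_def scaleC_of_real)
  have "c * d * norm u \<le> norm (T (T u) - r\<^sup>2 *\<^sub>R u)" for u
  proof -
    have "c * (d * norm u) \<le> c * norm (T u - (- r) *\<^sub>R u)"
      using c d by (intro mult_left_mono) auto
    also have "\<dots> \<le> norm (T (T u - (- r) *\<^sub>R u) - r *\<^sub>R (T u - (- r) *\<^sub>R u))"
      by (rule c)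
    also have "T (T u - (- r) *\<^sub>R u) - r *\<^sub>R (T u - (- r) *\<^sub>R u) = T (T u) - r\<^sup>2 *\<^sub>R u"
      by (simp add: add scaleR power2_eq_square algebra_simps)
    finally show ?thesis by (simp add: mult.assoc)
  qed
  then show ?thesis using c d by (intro exI[of _ "c * d"]) auto
qed

text \<open>If \<open>t\<^sup>4 - d\<^sup>2 t\<^sup>2\<close> were negative somewhere as a form in the operator, its infimum
  \<open>-m\<close> would be attained approximately, although \<open>t\<^sup>4 - d\<^sup>2 t\<^sup>2 + m\<close> has all its roots in the
  spectral gap.\<close>

lemma gap_norm_le:
  assumes d: "d > 0"
    and gap: "\<And>r. r \<noteq> 0 \<Longrightarrow> \<bar>r\<bar> < d \<Longrightarrow> below (complex_of_real r)"
  shows "d * norm (T u) \<le> norm (T (T u))"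
proof (rule ccontr)
  assume contr: "\<not> ?thesis"
  define f where "f u = (norm (T (T u)))\<^sup>2 - d\<^sup>2 * (norm (T u))\<^sup>2" for u
  \<comment> \<open>\<open>Inf S\<close> is the negative of the infimum of \<open>f\<close> over
    unit vectors.\<close>
  define S where "S = {s. \<forall>u. 0 \<le> f u + s * (norm u)\<^sup>2}"
  define m where "m = Inf S"
  have "(norm (T (T u)))\<^sup>2 < (d * norm (T u))\<^sup>2"
    using contr d by (intro power_strict_mono) auto
  then have fu: "f u < 0" by (simp add: f_def power_mult_distrib)
  then have u: "u \<noteq> 0" by (auto simp: f_def)
  have lower: "s \<ge> - f u / (norm u)\<^sup>2" if "s \<in> S" for s
  proof -
    have "0 \<le> f u + s * (norm u)\<^sup>2" using that by (simp add: S_def)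
    then show ?thesis using u by (simp add: field_simps)
  qed
  have sq: "(norm (T (T v) - s *\<^sub>R v))\<^sup>2 = (norm (T (T v)))\<^sup>2 - 2 * s * (norm (T v))\<^sup>2 + s\<^sup>2 * (norm v)\<^sup>2" for v s
    unfolding norm_diff_scaleR_square by (simp add: power2_norm_eq_inner symmetric)
  \<comment> \<open>Completing the square. The bound \<open>d ^ 4 / 4\<close> later makes the
    discriminant \<open>d ^ 4 - 4 * m\<close> nonnegative.\<close>
  have upper: "d ^ 4 / 4 \<in> S"
    unfolding S_def
  proof (safe)
    fix v
    have "0 \<le> (norm (T (T v) - (d\<^sup>2 / 2) *\<^sub>R v))\<^sup>2" by simp
    also have "\<dots> = f v + d ^ 4 / 4 * (norm v)\<^sup>2"
      unfolding sq f_def by (simp add: power2_eq_square power4_eq_xxxx)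
    finally show "0 \<le> f v + d ^ 4 / 4 * (norm v)\<^sup>2" .
  qed
  have bdd: "bdd_below S" using lower by (auto simp: bdd_below_def)
  have "0 < - f u / (norm u)\<^sup>2" using fu u by (simp add: divide_neg_pos)
  also have "- f u / (norm u)\<^sup>2 \<le> m"
    unfolding m_def using lower upper by (intro cInf_greatest) auto
  finally have m0: "0 < m" .
  have m4: "m \<le> d ^ 4 / 4"
    unfolding m_def by (rule cInf_lower[OF upper bdd])
  have mS: "0 \<le> f v + m * (norm v)\<^sup>2" for v
  proof (rule field_le_epsilon)
    fix e :: real assume e: "e > 0"
    define e' where "e' = e / (1 + (norm v)\<^sup>2)"
    have pos: "1 + (norm v)\<^sup>2 > 0" by (simp add: add_pos_nonneg)
    have "e' > 0" using e pos by (simp add: e'_def)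
    then obtain s where s: "s \<in> S" "s < m + e'"
      unfolding m_def using cInf_lessD[of S "Inf S + e'"] upper by auto
    have "0 \<le> f v + s * (norm v)\<^sup>2" using s by (simp add: S_def)
    also have "\<dots> \<le> f v + (m + e') * (norm v)\<^sup>2"
      using s by (intro add_left_mono mult_right_mono) auto
    also have "\<dots> \<le> f v + m * (norm v)\<^sup>2 + e"
    proof -
      have "e' * (norm v)\<^sup>2 \<le> e' * (1 + (norm v)\<^sup>2)" using \<open>e' > 0\<close> by (intro mult_left_mono) auto
      also have "\<dots> = e" using pos by (simp add: e'_def)
      finally show ?thesis by (simp add: algebra_simps)
    qed
    finally show "0 \<le> f v + m * (norm v)\<^sup>2 + e" by simp
  qed
  define G where "G v = T (T (T (T v))) - d\<^sup>2 *\<^sub>R T (T v) + m *\<^sub>R v" for v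
  have G_diff: "G (v - w) = G v - G w" for v w
    by (simp add: G_def diff algebra_simps)
  have G_scaleR: "G (r *\<^sub>R v) = r *\<^sub>R G v" for r v
    by (simp add: G_def scaleR algebra_simps)
  have G_inner: "inner (G v) v = f v + m * (norm v)\<^sup>2" for v
    by (simp add: G_def f_def inner_diff inner_add symmetric power2_norm_eq_inner)
  have G_sym: "inner (G v) w = inner v (G w)" for v w
    by (simp add: G_def inner_diff inner_add symmetric)
  obtain K where K: "K > 0" "\<And>v. norm (G v) \<le> K * norm v"
  proof -
    have "bounded_linear G"
      unfolding G_def
      by (intro bounded_linear_add bounded_linear_sub bounded_linear_scaleR_right
        bounded_linear_compose[OF bounded_linear] bounded_linear_const_scaleR bounded_linear bounded_linear_ident)
    then show thesis using that bounded_linear.pos_bounded by (metis mult.commute)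
  qed
  \<comment> \<open>\<open>G\<close> is symmetric and nonnegative with norm at most
    \<open>K\<close>; nonnegativity at \<open>v - t *\<^sub>R G v\<close> yields this form of
    Cauchy-Schwarz, which makes \<open>G v\<close> small wherever its quadratic form is
    small.\<close>
  have G_norm: "(norm (G v))\<^sup>2 \<le> K * inner (G v) v" for v
  proof -
    define t where "t = 1 / K"
    have "0 \<le> inner (G (v - t *\<^sub>R G v)) (v - t *\<^sub>R G v)"
      unfolding G_inner by (rule mS)
    also have "\<dots> = inner (G v) v - 2 * t * (norm (G v))\<^sup>2 + t\<^sup>2 * inner (G (G v)) (G v)"
      unfolding power2_norm_eq_inner
      by (simp add: G_diff G_scaleR inner_diff power2_eq_square G_sym[of "G v" v] algebra_simps)
    also have "inner (G (G v)) (G v) \<le> K * (norm (G v))\<^sup>2"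
      using norm_cauchy_schwarz[of "G (G v)" "G v"] mult_right_mono[OF K(2)[of "G v"], of "norm (G v)"]
      by (simp add: power2_eq_square)
    finally have "0 \<le> inner (G v) v - 2 * t * (norm (G v))\<^sup>2 + t\<^sup>2 * (K * (norm (G v))\<^sup>2)"
      by (simp add: mult_left_mono)
    then show ?thesis using K(1) by (simp add: t_def power2_eq_square field_simps)
  qed
  \<comment> \<open>\<open>(d\<^sup>2 + h) / 2\<close> and \<open>(d\<^sup>2 - h) / 2\<close> are
    the roots of \<open>s\<^sup>2 - d\<^sup>2 * s + m\<close>. As \<open>m > 0\<close>, both lie
    strictly between \<open>0\<close> and \<open>d\<^sup>2\<close>, where \<open>T \<circ> T\<close>
    minus \<open>s\<close> is bounded below.\<close>
  define h where "h = sqrt (d ^ 4 - 4 * m)"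
  have h: "0 \<le> h" "h\<^sup>2 = d ^ 4 - 4 * m" using m4 by (auto simp: h_def)
  have "h\<^sup>2 < (d\<^sup>2)\<^sup>2" using h m0 by (simp flip: power_mult)
  then have hd: "h < d\<^sup>2" using power_less_imp_less_base by fastforce
  have low: "\<exists>c>0. \<forall>v. c * norm v \<le> norm (T (T v) - s *\<^sub>R v)" if s: "0 < s" "s < d\<^sup>2" for s
  proof -
    have "sqrt s < d" "sqrt s > 0"
      using s d real_less_lsqrt by auto
    then have "\<exists>c>0. \<forall>v. c * norm v \<le> norm (T (T v) - (sqrt s)\<^sup>2 *\<^sub>R v)"
      by (intro below_square_shift gap) auto
    then show ?thesis using s by simp
  qed
  obtain c1 where c1: "c1 > 0" "\<And>v. c1 * norm v \<le> norm (T (T v) - ((d\<^sup>2 + h) / 2) *\<^sub>R v)"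
    using low[of "(d\<^sup>2 + h) / 2"] h hd d by (auto simp: add_pos_nonneg)
  obtain c2 where c2: "c2 > 0" "\<And>v. c2 * norm v \<le> norm (T (T v) - ((d\<^sup>2 - h) / 2) *\<^sub>R v)"
    using low[of "(d\<^sup>2 - h) / 2"] h hd d by (auto simp: algebra_simps)
  have G_low: "c1 * c2 * norm v \<le> norm (G v)" for v
  proof -
    define w where "w = T (T v) - ((d\<^sup>2 - h) / 2) *\<^sub>R v"
    have "c1 * (c2 * norm v) \<le> c1 * norm w"
      unfolding w_def using c1 c2 by (intro mult_left_mono) auto
    also have "\<dots> \<le> norm (T (T w) - ((d\<^sup>2 + h) / 2) *\<^sub>R w)" by (rule c1)
    also have "T (T w) - ((d\<^sup>2 + h) / 2) *\<^sub>R w = G v"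
    proof -
      have m_eq: "((d\<^sup>2 + h) / 2) * ((d\<^sup>2 - h) / 2) = m"
        using h by (simp add: field_simps power2_eq_square power4_eq_xxxx)
      have "T (T w) - ((d\<^sup>2 + h) / 2) *\<^sub>R w = T (T (T (T v))) - (((d\<^sup>2 - h) / 2) + ((d\<^sup>2 + h) / 2)) *\<^sub>R T (T v)
          + (((d\<^sup>2 + h) / 2) * ((d\<^sup>2 - h) / 2)) *\<^sub>R v"
        unfolding w_def diff scaleR scaleR_diff_right scaleR_add_left by (simp add: algebra_simps)
      also have "((d\<^sup>2 - h) / 2) + ((d\<^sup>2 + h) / 2) = d\<^sup>2" by (simp add: field_simps)
      finally have "T (T w) - ((d\<^sup>2 + h) / 2) *\<^sub>R w
          = T (T (T (T v))) - d\<^sup>2 *\<^sub>R T (T v) + m *\<^sub>R v"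
        unfolding m_eq .
      then have "T (T w) - ((d\<^sup>2 + h) / 2) *\<^sub>R w = G v" unfolding G_def .
      then show ?thesis .
    qed
    finally show ?thesis by (simp add: mult.assoc)
  qed
  \<comment> \<open>\<open>K * e\<close> is half of \<open>(c1 * c2)\<^sup>2\<close>, so a vector
    with \<open>inner (G v) v\<close> below \<open>e * (norm v)\<^sup>2\<close> contradicts
    \<open>G_low\<close>.\<close>
  define e where "e = (c1 * c2)\<^sup>2 / (2 * K)"
  have e: "e > 0" using c1 c2 K by (simp add: e_def)
  have "m - e \<notin> S" using cInf_lower[OF _ bdd, of "m - e"] e by (auto simp: m_def)
  then obtain v where v: "f v + (m - e) * (norm v)\<^sup>2 < 0" by (auto simp: S_def not_le)
  have v0: "v \<noteq> 0" using v by (auto simp: f_def)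
  have "(c1 * c2 * norm v)\<^sup>2 \<le> (norm (G v))\<^sup>2"
    using G_low c1 c2 by (intro power_mono) auto
  also have "\<dots> \<le> K * inner (G v) v" by (rule G_norm)
  also have "\<dots> \<le> K * (e * (norm v)\<^sup>2)"
    unfolding G_inner using v K(1) by (intro mult_left_mono) (auto simp: algebra_simps)
  also have "\<dots> = (c1 * c2 * norm v)\<^sup>2 / 2"
    using K(1) by (simp add: e_def power_mult_distrib)
  finally show False using c1 c2 v0 by simp
qed

text \<open>The map \<open>M\<close> fixes the kernel of \<open>T\<close> and contracts its range,
  where \<open>gap\<close> bounds \<open>T\<close> from below. Iterating it from \<open>u\<close>,
  the increments decrease geometrically from a multiple of \<open>norm (T u)\<close>, and
  \<open>T\<close> tends to \<open>0\<close> along the iterates, so their limit lies in the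
  kernel.\<close>

lemma near_kernel:
  assumes d: "d > 0" and gap: "\<And>u. d * norm (T u) \<le> norm (T (T u))"
  shows "\<exists>C>0. \<forall>u. \<exists>w. T w = 0 \<and> norm (u - w) \<le> C * norm (T u)"
proof -
  obtain K0 where K0: "K0 > 0" "\<And>u. norm (T u) \<le> K0 * norm u"
    by (rule pos_boundE) blast
  define K where "K = max K0 d"
  have K: "norm (T u) \<le> K * norm u" for u
    using K0(2)[of u] mult_right_mono[of K0 K "norm u"] by (simp add: K_def)
  have Kd: "K > 0" "d \<le> K" using d by (auto simp: K_def)
  have KK: "norm (T (T u)) \<le> K\<^sup>2 * norm u" for u
    using order_trans[OF K[of "T u"] mult_left_mono[OF K[of u], of K]] Kd
    by (simp add: power2_eq_square mult.assoc)
  \<comment> \<open>The minimizer of \<open>1 - 2 * t * d\<^sup>2 + t\<^sup>2 * K ^ 4\<close>; the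
    minimum is \<open>q\<^sup>2\<close>, nonnegative because \<open>d \<le> K\<close>.\<close>
  define t where "t = d\<^sup>2 / K ^ 4"
  define M where "M u = u - t *\<^sub>R T (T u)" for u
  define q where "q = sqrt (1 - (d / K) ^ 4)"
  have dK: "0 < (d / K) ^ 4" "(d / K) ^ 4 \<le> 1"
    using d Kd by (auto simp: power_le_one)
  have q: "0 \<le> q" "q < 1" "q\<^sup>2 = 1 - (d / K) ^ 4"
    using dK by (auto simp: q_def)
  have t: "t > 0" using d Kd by (simp add: t_def)
  have contr: "norm (M (T u)) \<le> q * norm (T u)" for u
  proof (rule power2_le_imp_le)
    let ?v = "T u"
    have "(norm (M ?v))\<^sup>2 = (norm ?v)\<^sup>2 - 2 * t * (norm (T ?v))\<^sup>2 + t\<^sup>2 * (norm (T (T ?v)))\<^sup>2"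
      unfolding M_def norm_diff_scaleR_square by (simp add: power2_norm_eq_inner symmetric)
    also have "\<dots> \<le> (norm ?v)\<^sup>2 - 2 * t * (d * norm ?v)\<^sup>2 + t\<^sup>2 * (K\<^sup>2 * norm ?v)\<^sup>2"
      using gap[of u] KK[of ?v] d t
      by (intro add_mono diff_mono mult_left_mono power_mono order_refl) auto
    also have "\<dots> = (q * norm ?v)\<^sup>2"
      unfolding power_mult_distrib q using Kd
      by (simp add: t_def power2_eq_square power4_eq_xxxx field_simps)
    finally show "(norm (M ?v))\<^sup>2 \<le> (q * norm ?v)\<^sup>2" .
    show "0 \<le> q * norm ?v" using q by simp
  qed
  have TM: "T (M u) = M (T u)" for u
    by (simp add: M_def diff scaleR)
  define C where "C = t * K / (1 - q)"
  have C: "C > 0" using t Kd q by (simp add: C_def)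
  have "\<exists>w. T w = 0 \<and> norm (u - w) \<le> C * norm (T u)" for u
  proof -
    define W where "W n = (M ^^ n) u" for n
    define g where "g n = t *\<^sub>R T (T (W n))" for n
    have W_Suc: "W (Suc n) = W n - g n" for n
      by (simp add: W_def g_def M_def)
    have TW: "norm (T (W n)) \<le> q ^ n * norm (T u)" for n
    proof (induction n)
      case (Suc n)
      have "norm (T (W (Suc n))) \<le> q * norm (T (W n))"
        using contr[of "W n"] by (simp add: W_def TM)
      also have "\<dots> \<le> q * (q ^ n * norm (T u))"
        using Suc q by (intro mult_left_mono) auto
      finally show ?case by (simp add: mult.assoc)
    qed (simp add: W_def)
    have g: "norm (g n) \<le> t * K * norm (T u) * q ^ n" for n
    proof -
      have "norm (g n) \<le> t * (K * norm (T (W n)))"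
        unfolding g_def using t K[of "T (W n)"] by simp
      also have "\<dots> \<le> t * (K * (q ^ n * norm (T u)))"
        using t Kd TW[of n] by (intro mult_left_mono) auto
      finally show ?thesis by (simp add: algebra_simps)
    qed
    have geo: "(\<lambda>n. t * K * norm (T u) * q ^ n) sums (t * K * norm (T u) * (1 / (1 - q)))"
      using q by (intro sums_mult geometric_sums) auto
    have "summable (\<lambda>n. norm (g n))"
      by (rule summable_comparison_test'[OF sums_summable[OF geo]]) (use g in auto)
    then have sg: "summable g" by (rule summable_norm_cancel)
    have sum_g: "(\<Sum>k<n. g k) = u - W n" for n
      by (induction n) (auto simp: W_Suc, simp add: W_def)
    have Wlim: "W \<longlonglongrightarrow> u - suminf g"
    proof -
      have "(\<lambda>n. u - (\<Sum>k<n. g k)) \<longlonglongrightarrow> u - suminf g"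
        by (intro tendsto_diff tendsto_const summable_LIMSEQ sg)
      then show ?thesis by (simp add: sum_g)
    qed
    have "(\<lambda>n. T (W n)) \<longlonglongrightarrow> 0"
    proof (rule Lim_null_comparison)
      show "\<forall>\<^sub>F n in sequentially. norm (T (W n)) \<le> q ^ n * norm (T u)"
        using TW by simp
      show "(\<lambda>n. q ^ n * norm (T u)) \<longlonglongrightarrow> 0"
        using q by (intro tendsto_mult_left_zero LIMSEQ_power_zero) auto
    qed
    moreover have "(\<lambda>n. T (W n)) \<longlonglongrightarrow> T (u - suminf g)"
      by (rule tendsto[OF Wlim])
    ultimately have "T (u - suminf g) = 0"
      using LIMSEQ_unique by blast
    moreover have "norm (suminf g) \<le> t * K * norm (T u) * (1 / (1 - q))"
      using suminf_le[OF g \<open>summable (\<lambda>n. norm (g n))\<close> sums_summable[OF geo]] summable_norm[OF \<open>summable (\<lambda>n. norm (g n))\<close>]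
      by (simp add: sums_unique[OF geo, symmetric])
    ultimately show ?thesis
      by (intro exI[of _ "u - suminf g"]) (simp add: C_def)
  qed
  then show ?thesis using C by blast
qed

end

section \<open>The essential spectrum of a Jacobi operator\<close>

text \<open>Weyl's criterion with vectors vanishing on initial segments in place of weakly null
  sequences, so that vectors can be cut and moved by coordinates.\<close>

definition singular :: "(ell2 \<Rightarrow> ell2) \<Rightarrow> complex \<Rightarrow> bool" where
  "singular T z \<longleftrightarrow> (\<forall>e>0. \<forall>N. \<exists>u. u \<noteq> 0 \<and> (\<forall>n<N. Rep_ell2 u n = 0) \<and>
     norm (T u - z *\<^sub>C u) \<le> e * norm u)"

lemma singularE:
  assumes "singular T z" "e > 0"
  obtains u where "u \<noteq> 0" "\<And>n. n < N \<Longrightarrow> Rep_ell2 u n = 0" "norm (T u - z *\<^sub>C u) \<le> e * norm u"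
  using assms unfolding singular_def by blast

lemma (in symmetric_op) singular_imp_not_below:
  assumes "singular T z"
  shows "\<not> below z"
proof
  assume "below z"
  then obtain c where c: "c > 0" "\<And>u. c * norm u \<le> norm (T u - z *\<^sub>C u)"
    by (auto simp: below_def)
  have "c / 2 > 0" using c(1) by simp
  then obtain u where "u \<noteq> 0" "norm (T u - z *\<^sub>C u) \<le> c / 2 * norm u"
    using assms unfolding singular_def by meson
  then have "c * norm u \<le> c / 2 * norm u" using c(2)[of u] by linarith
  with \<open>u \<noteq> 0\<close> c(1) show False by simp
qed

text \<open>Only finitely many coordinates have to converge, so the subsequence is refined one
  coordinate at a time, without a diagonal argument. The value type is general because the
  construction of limit matrices uses triples of two parameters and one coordinate.\<close>

lemma convergent_coords_subseq:
  fixes f :: "nat \<Rightarrow> nat \<Rightarrow> 'a :: heine_borel"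
  assumes "finite S" "\<And>k. k \<in> S \<Longrightarrow> bounded (range (\<lambda>n. f n k))"
  shows "\<exists>r. strict_mono r \<and> (\<forall>k\<in>S. convergent (\<lambda>n. f (r n) k))"
  using assms
proof (induction rule: finite_induct)
  case empty
  show ?case by (rule exI[of _ id]) (auto simp: strict_mono_def)
next
  case (insert k S)
  then obtain r where r: "strict_mono r" "\<And>i. i \<in> S \<Longrightarrow> convergent (\<lambda>n. f (r n) i)"
    by auto
  have "bounded (range (\<lambda>n. f (r n) k))"
    by (rule bounded_subset[OF insert.prems[of k]]) auto
  then obtain l s where s: "strict_mono s" "((\<lambda>n. f (r n) k) \<circ> s) \<longlonglongrightarrow> l"
    using bounded_imp_convergent_subsequence by blast
  have "convergent (\<lambda>n. f (r (s n)) i)" if "i \<in> insert k S" for i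
  proof (cases "i = k")
    case True
    then show ?thesis using s(2) by (auto simp: convergent_def o_def)
  next
    case False
    then have "convergent ((\<lambda>n. f (r n) i) \<circ> s)"
      using r(2)[of i] that s(1) by (intro convergent_subseq_convergent) auto
    then show ?thesis by (simp add: o_def)
  qed
  moreover have "strict_mono (r \<circ> s)" using r(1) s(1) by (rule strict_mono_o)
  ultimately show ?case by (intro exI[of _ "\<lambda>n. r (s n)"]) (auto simp: o_def)
qed

lemma ell2_tendsto_0:
  assumes "finite S" "\<And>n k. k \<notin> S \<Longrightarrow> Rep_ell2 (X n) k = 0"
    and "\<And>k. k \<in> S \<Longrightarrow> (\<lambda>n. Rep_ell2 (X n) k) \<longlonglongrightarrow> 0"
  shows "X \<longlonglongrightarrow> 0"
proof -
  have "(\<lambda>n. \<Sum>k\<in>S. (cmod (Rep_ell2 (X n) k))\<^sup>2) \<longlonglongrightarrow> (\<Sum>k\<in>S. (cmod 0)\<^sup>2)"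
    by (intro tendsto_intros assms)
  then have "(\<lambda>n. (norm (X n))\<^sup>2) \<longlonglongrightarrow> 0"
    by (subst norm_ell2_finite[OF assms(1,2)]) auto
  then have "(\<lambda>n. sqrt ((norm (X n))\<^sup>2)) \<longlonglongrightarrow> sqrt 0"
    by (rule tendsto_real_sqrt)
  then show ?thesis by (simp add: tendsto_norm_zero_iff)
qed

lemma restr_convergent:
  assumes "finite S" "\<And>k. k \<in> S \<Longrightarrow> convergent (\<lambda>n. Rep_ell2 (X n) k)"
  shows "convergent (\<lambda>n. restr S (X n))"
proof -
  obtain l where l: "\<And>k. k \<in> S \<Longrightarrow> (\<lambda>n. Rep_ell2 (X n) k) \<longlonglongrightarrow> l k"
    using assms(2) unfolding convergent_def by metis
  have "(\<lambda>n. restr S (X n) - ell2_of S l) \<longlonglongrightarrow> 0"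
  proof (rule ell2_tendsto_0[OF assms(1)])
    show "(\<lambda>n. Rep_ell2 (restr S (X n) - ell2_of S l) k) \<longlonglongrightarrow> 0" if "k \<in> S" for k
      using l[OF that] that by (cases "k = 0") (auto simp: Rep_ell2_of[OF assms(1)] LIM_zero)
  qed (auto simp: Rep_ell2_of[OF assms(1)])
  then have "(\<lambda>n. restr S (X n)) \<longlonglongrightarrow> ell2_of S l"
    by (rule LIM_zero_cancel)
  then show ?thesis by (auto simp: convergent_def)
qed

locale jacobi_op =
  fixes a b :: "nat \<Rightarrow> real"
  assumes bounded_parameters: "bounded_parameters a b"
begin

abbreviation J :: "ell2 \<Rightarrow> ell2" where "J \<equiv> jacobi a b"

sublocale symmetric_op J
  by standard (simp_all add: bounded_clinear_jacobi jacobi_symmetric bounded_parameters)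

lemma Rep_J: "Rep_ell2 (J u) n = (if n = 0 then 0 else
   complex_of_real (a (n - 1)) * Rep_ell2 u (n - 1) + complex_of_real (b n) * Rep_ell2 u n
       + complex_of_real (a n) * Rep_ell2 u (n + 1))"
  by (simp add: Rep_jacobi[OF bounded_parameters] jacobi_seq_def)

text \<open>Split the vectors at an index \<open>N\<close> beyond which \<open>J - z\<close> is
  bounded below. The heads converge along a subsequence by compactness; then the images of the tails
  are Cauchy, and by the lower bound so are the tails.\<close>

lemma approx_kernel_subseq:
  assumes ns: "\<not> singular J z" and u: "\<And>n. norm (u n) = 1"
    and lim: "(\<lambda>n. J (u n) - z *\<^sub>C u n) \<longlonglongrightarrow> 0"
  obtains r w where "strict_mono r" "(u \<circ> r) \<longlonglongrightarrow> w" "J w = z *\<^sub>C w" "norm w = 1"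
proof -
  define A where "A v = J v - z *\<^sub>C v" for v
  obtain e N where e: "e > 0" and
    low: "\<And>v. v \<noteq> 0 \<Longrightarrow> (\<forall>n<N. Rep_ell2 v n = 0) \<Longrightarrow> e * norm v < norm (A v)"
    using ns unfolding singular_def A_def by (meson not_le)
  have low': "norm v \<le> norm (A v) / e" if "\<forall>n<N. Rep_ell2 v n = 0" for v
    using low[OF _ that] e by (cases "v = 0") (auto simp: field_simps less_imp_le)
  have A_diff: "A (v - w) = A v - A w" for v w
    by (simp add: A_def diff scaleC_diff_right)
  obtain K where K: "K > 0" "\<And>v. norm (J v) \<le> K * norm v"
    by (rule pos_boundE) blast
  have A_bl: "bounded_linear A"
  proof (rule bounded_linear_intro)
    show "A (v + w) = A v + A w" for v w
      by (rule ell2_eqI) (simp add: A_def add algebra_simps)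
    show "A (c *\<^sub>R v) = c *\<^sub>R A v" for c v
      by (rule ell2_eqI) (simp add: A_def scaleR algebra_simps)
    show "norm (A v) \<le> norm v * (K + cmod z)" for v
      unfolding A_def using K(2)[of v] norm_triangle_ineq4[of "J v" "z *\<^sub>C v"]
      by (simp add: norm_scaleC algebra_simps)
  qed
  have "bounded (range (\<lambda>n. Rep_ell2 (u n) k))" for k
    unfolding bounded_iff using cmod_Rep_ell2_le[of "u _" k] u by (intro exI[of _ 1]) auto
  then obtain r where r: "strict_mono r" "\<forall>k\<in>{..<N}. convergent (\<lambda>n. Rep_ell2 (u (r n)) k)"
    using convergent_coords_subseq[of "{..<N}" "\<lambda>n. Rep_ell2 (u n)"] by auto
  define p where "p n = restr {..<N} (u (r n))" for n
  define q where "q n = restr (- {..<N}) (u (r n))" for n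
  have pq: "u (r n) = p n + q n" for n
    by (simp only: p_def q_def restr_split)
  have p: "convergent p"
    unfolding p_def using r(2) by (intro restr_convergent) auto
  then obtain pl where pl: "p \<longlonglongrightarrow> pl" by (auto simp: convergent_def)
  have Ar: "(\<lambda>n. A (u (r n))) \<longlonglongrightarrow> 0"
    using LIMSEQ_subseq_LIMSEQ[OF lim r(1)] by (simp add: o_def A_def)
  have "(\<lambda>n. A (u (r n)) - A (p n)) \<longlonglongrightarrow> 0 - A pl"
    by (intro tendsto_diff Ar bounded_linear.tendsto[OF A_bl] pl)
  moreover have "A (q n) = A (u (r n)) - A (p n)" for n
    unfolding A_diff[symmetric] pq by simp
  ultimately have "Cauchy (\<lambda>n. A (q n))"
    by (simp add: LIMSEQ_imp_Cauchy)
  have "Cauchy q"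
  proof (rule metric_CauchyI)
    fix d :: real assume "d > 0"
    then obtain M where M: "\<And>m n. m \<ge> M \<Longrightarrow> n \<ge> M \<Longrightarrow> dist (A (q m)) (A (q n)) < d * e"
      using metric_CauchyD[OF \<open>Cauchy (\<lambda>n. A (q n))\<close>, of "d * e"] e by auto
    have "dist (q m) (q n) < d" if "m \<ge> M" "n \<ge> M" for m n
    proof -
      have "norm (q m - q n) \<le> norm (A (q m - q n)) / e"
        by (rule low') (simp add: q_def)
      also have "\<dots> < d"
        using M[OF that] e by (simp add: A_diff dist_norm field_simps)
      finally show ?thesis by (simp add: dist_norm)
    qed
    then show "\<exists>M. \<forall>m\<ge>M. \<forall>n\<ge>M. dist (q m) (q n) < d" by blast
  qed
  then obtain ql where ql: "q \<longlonglongrightarrow> ql"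
    using Cauchy_convergent convergent_def by blast
  have w: "(u \<circ> r) \<longlonglongrightarrow> pl + ql"
    using tendsto_add[OF pl ql] by (simp add: o_def pq)
  have "(\<lambda>n. A (u (r n))) \<longlonglongrightarrow> A (pl + ql)"
    using bounded_linear.tendsto[OF A_bl w] by (simp add: o_def)
  then have "A (pl + ql) = 0" using Ar LIMSEQ_unique by blast
  moreover have "norm (pl + ql) = 1"
    using tendsto_norm[OF w] u by (simp add: o_def LIMSEQ_const_iff)
  ultimately show thesis using that[OF r(1) w] by (simp add: A_def)
qed

lemma not_below_normalised:
  assumes "\<not> below z" "e > 0"
  shows "\<exists>u. norm u = 1 \<and> norm (J u - z *\<^sub>C u) < e"
proof -
  obtain u where u: "norm (J u - z *\<^sub>C u) < e * norm u"
    using assms unfolding below_def by (meson not_le)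
  then have u0: "u \<noteq> 0" by auto
  define w where "w = (1 / norm u) *\<^sub>R u"
  have "J w - z *\<^sub>C w = (1 / norm u) *\<^sub>R (J u - z *\<^sub>C u)"
    by (simp add: w_def scaleR scaleC_scaleR scaleR_diff_right)
  then have "norm (J w - z *\<^sub>C w) = norm (J u - z *\<^sub>C u) / norm u" by simp
  also have "\<dots> < e" using u u0 by (simp add: field_simps)
  finally show ?thesis using u0 by (intro exI[of _ w]) (simp add: w_def)
qed

end

section \<open>Simplicity of eigenvalues and the discrete spectrum\<close>

locale positive_jacobi_op = jacobi_op +
  assumes a_pos: "1 \<le> n \<Longrightarrow> 0 < a n"
begin

text \<open>As \<open>a n\<close> is nonzero, row \<open>n\<close> of the equation determines
  coordinate \<open>n + 1\<close> from the two preceding ones, and coordinate \<open>0\<close> is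
  always \<open>0\<close>.\<close>

lemma eigenvector_eq_0:
  assumes "J u = z *\<^sub>C u" "Rep_ell2 u 1 = 0"
  shows "u = 0"
proof -
  have "Rep_ell2 u n = 0 \<and> Rep_ell2 u (Suc n) = 0" for n
  proof (induction n)
    case (Suc n)
    have "Rep_ell2 (J u) (Suc n) = z * Rep_ell2 u (Suc n)" by (simp add: assms)
    then have "complex_of_real (a (Suc n)) * Rep_ell2 u (Suc (Suc n)) = 0"
      using Suc by (simp add: Rep_J)
    then show ?case using Suc a_pos[of "Suc n"] by simp
  qed (use assms in simp)
  then show ?thesis by (intro ell2_eqI) simp
qed

lemma eigenvector_unique:
  assumes "J u = z *\<^sub>C u" "J v = z *\<^sub>C v" "v \<noteq> 0"
  shows "Rep_ell2 v 1 \<noteq> 0" and "u = (Rep_ell2 u 1 / Rep_ell2 v 1) *\<^sub>C v"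
proof -
  show v1: "Rep_ell2 v 1 \<noteq> 0" using eigenvector_eq_0[OF assms(2)] assms(3) by blast
  have "u - (Rep_ell2 u 1 / Rep_ell2 v 1) *\<^sub>C v = 0"
  proof (rule eigenvector_eq_0)
    show "J (u - (Rep_ell2 u 1 / Rep_ell2 v 1) *\<^sub>C v) = z *\<^sub>C (u - (Rep_ell2 u 1 / Rep_ell2 v 1) *\<^sub>C v)"
      by (simp add: diff scaleC assms(1,2) scaleC_diff_right mult.commute)
    show "Rep_ell2 (u - (Rep_ell2 u 1 / Rep_ell2 v 1) *\<^sub>C v) 1 = 0" using v1 by simp
  qed
  then show "u = (Rep_ell2 u 1 / Rep_ell2 v 1) *\<^sub>C v" by simp
qed

text \<open>At an isolated point, \<open>near_kernel\<close> bounds the distance of \<open>u\<close>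
  to the eigenspace by the norm of \<open>J u - z *\<^sub>C u\<close>. The eigenspace is spanned by
  one vector with nonzero first coordinate. So if \<open>u\<close> vanishes at \<open>1\<close>, a
  nearby eigenvector \<open>w\<close> has small first coordinate and hence small norm, and
  \<open>u\<close> cannot be large either.\<close>

lemma singular_not_discrete:
  assumes sing: "singular J z"
  shows "z \<notin> discrete_spectrum J"
proof
  assume disc: "z \<in> discrete_spectrum J"
  obtain x where zr: "z = complex_of_real x"
    using singular_imp_not_below[OF sing] below_nonreal[of z] by (metis complex_is_Real_iff Reals_cases)
  obtain d where d: "d > 0" "\<And>y. y \<in> op_spectrum J \<Longrightarrow> dist z y < d \<Longrightarrow> y = z"
    using disc by (auto simp: discrete_spectrum_def isolated_in_dist_Ex_iff)
  have "J 0 = z *\<^sub>C 0" by (simp add: zero)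
  with disc obtain v where v: "J v = z *\<^sub>C v" "v \<noteq> 0"
    by (auto simp: discrete_spectrum_def eigenspace_def)
  interpret A: symmetric_op "\<lambda>u. J u - complex_of_real x *\<^sub>C u"
    by (rule symmetric_op_shift)
  have gap: "A.below (complex_of_real r)" if "r \<noteq> 0" "\<bar>r\<bar> < d" for r
  proof -
    have "complex_of_real (x + r) \<notin> op_spectrum J"
    proof
      assume *: "complex_of_real (x + r) \<in> op_spectrum J"
      have "dist z (complex_of_real (x + r)) < d"
        unfolding zr dist_norm of_real_diff[symmetric] norm_of_real using that by simp
      from d(2)[OF * this] have "complex_of_real (x + r) = complex_of_real x" using zr by simp
      then have "x + r = x" by (simp only: of_real_eq_iff)
      with that show False by simp
    qed
    then have "below (complex_of_real (x + r))" unfolding spectrum_iff by simp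
    moreover have "J u - complex_of_real x *\<^sub>C u - complex_of_real r *\<^sub>C u
        = J u - complex_of_real (x + r) *\<^sub>C u" for u
      by (rule ell2_eqI) (simp add: algebra_simps)
    ultimately show ?thesis by (simp only: below_def A.below_def)
  qed
  obtain C where C: "C > 0" "\<And>u. \<exists>w. J w - z *\<^sub>C w = 0 \<and> norm (u - w) \<le> C * norm (J u - z *\<^sub>C u)"
    using A.near_kernel[OF d(1) A.gap_norm_le[OF d(1) gap]] unfolding zr[symmetric] by blast
  define D where "D = norm v / cmod (Rep_ell2 v 1)"
  have D: "D \<ge> 0" by (simp add: D_def)
  define e where "e = 1 / (2 * C * (1 + D))"
  have e: "e > 0" using C D by (simp add: e_def)
  obtain u where u: "u \<noteq> 0" "\<And>n. n < 2 \<Longrightarrow> Rep_ell2 u n = 0" "norm (J u - z *\<^sub>C u) \<le> e * norm u"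
    using singularE[OF sing e] by blast
  obtain w where w: "J w - z *\<^sub>C w = 0" "norm (u - w) \<le> C * norm (J u - z *\<^sub>C u)"
    using C(2) by blast
  have "norm w = cmod (Rep_ell2 w 1) * D"
    using arg_cong[OF eigenvector_unique(2)[OF _ v, of w], of norm] w(1)
    by (simp add: norm_scaleC norm_divide D_def)
  moreover have "cmod (Rep_ell2 w 1) \<le> norm (u - w)"
    using cmod_Rep_ell2_le[of "u - w" 1] u(2)[of 1] by simp
  ultimately have "norm w \<le> norm (u - w) * D"
    using D by (simp add: mult_right_mono)
  then have "norm u \<le> (1 + D) * norm (u - w)"
    using norm_triangle_ineq[of w "u - w"] by (simp add: algebra_simps)
  also have "\<dots> \<le> (1 + D) * (C * (e * norm u))"
    using w(2) u(3) C(1) D by (intro mult_left_mono order_trans[OF w(2)]) auto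
  also have "\<dots> = norm u / 2"
  proof -
    have "(1 + D) * C * e = 1 / 2" using C(1) D by (simp add: e_def)
    then show ?thesis by (simp add: mult.assoc[symmetric])
  qed
  finally show False using u(1) by simp
qed

text \<open>Approximate eigenvectors subconverge to an eigenvector. Were the point not isolated,
  approximate eigenvectors at spectral points tending to \<open>z\<close> would also subconverge to
  a unit eigenvector \<open>w\<close>, although symmetry makes them nearly orthogonal to
  \<open>w\<close>.\<close>

lemma not_singular_discrete:
  assumes spec: "z \<in> op_spectrum J" and ns: "\<not> singular J z"
  shows "z \<in> discrete_spectrum J"
proof -
  have nb: "\<not> below z" using spec by (simp add: spectrum_iff)
  have "\<exists>u. norm u = 1 \<and> norm (J u - z *\<^sub>C u) < 1 / real (Suc n)" for n
    by (rule not_below_normalised[OF nb]) simp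
  then obtain u where u: "\<And>n. norm (u n) = 1" "\<And>n. norm (J (u n) - z *\<^sub>C u n) < 1 / real (Suc n)"
    by metis
  have "(\<lambda>n. J (u n) - z *\<^sub>C u n) \<longlonglongrightarrow> 0"
    by (rule Lim_null_comparison[OF always_eventually LIMSEQ_Suc[OF lim_1_over_n]])
      (use u(2) less_imp_le in blast)
  then obtain r w where "strict_mono r" "(u \<circ> r) \<longlonglongrightarrow> w" and w: "J w = z *\<^sub>C w" "norm w = 1"
    by (rule approx_kernel_subseq[OF ns u(1)])
  have w0: "w \<noteq> 0" using w(2) by auto
  have "eigenspace J z = complex_ell2.span {w}"
  proof -
    have "v \<in> range (\<lambda>k. k *\<^sub>C w)" if "J v = z *\<^sub>C v" for v
      using eigenvector_unique(2)[OF that w(1) w0] by (rule range_eqI)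
    moreover have "J (k *\<^sub>C w) = z *\<^sub>C (k *\<^sub>C w)" for k
      by (simp add: scaleC w(1) mult.commute)
    ultimately show ?thesis
      by (auto simp: eigenspace_def complex_ell2.span_singleton)
  qed
  moreover have "w \<in> eigenspace J z" using w(1) by (simp add: eigenspace_def)
  moreover have "z isolated_in op_spectrum J"
  proof (rule ccontr)
    assume "\<not> z isolated_in op_spectrum J"
    then have "\<exists>y\<in>op_spectrum J. dist z y < 1 / real (Suc n) \<and> y \<noteq> z" for n
      using spec by (auto simp: isolated_in_dist_Ex_iff)
    then obtain y where y: "\<And>n. y n \<in> op_spectrum J" "\<And>n. dist z (y n) < 1 / real (Suc n)" "\<And>n. y n \<noteq> z"
      by metis
    \<comment> \<open>The extra factor \<open>cmod (z - y n)\<close> in the error pays for the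
      division by the distance of the two spectral points in \<open>small\<close>.\<close>
    have "\<exists>u. norm u = 1 \<and> norm (J u - y n *\<^sub>C u) < cmod (z - y n) / real (Suc n)" for n
    proof (rule not_below_normalised)
      show "\<not> below (y n)" using y(1) by (simp add: spectrum_iff)
      have "0 < cmod (z - y n)" using y(3)[of n] by simp
      then show "0 < cmod (z - y n) / real (Suc n)" by simp
    qed
    then obtain u where u: "\<And>n. norm (u n) = 1"
        "\<And>n. norm (J (u n) - y n *\<^sub>C u n) < cmod (z - y n) / real (Suc n)"
      by metis
    have yz: "cmod (z - y n) < 1 / real (Suc n)" for n
      using y(2)[of n] by (simp add: dist_norm)
    have "(\<lambda>n. J (u n) - z *\<^sub>C u n) \<longlonglongrightarrow> 0"
    proof (rule Lim_null_comparison)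
      show "\<forall>\<^sub>F n in sequentially. norm (J (u n) - z *\<^sub>C u n) \<le> 2 * (1 / real (Suc n))"
      proof (rule always_eventually, rule allI)
        fix n
        have "J (u n) - z *\<^sub>C u n = (J (u n) - y n *\<^sub>C u n) - (z - y n) *\<^sub>C u n"
          by (rule ell2_eqI) (simp add: algebra_simps)
        then have "norm (J (u n) - z *\<^sub>C u n)
            \<le> norm (J (u n) - y n *\<^sub>C u n) + norm ((z - y n) *\<^sub>C u n)"
          by (simp only: norm_triangle_ineq4)
        also have "norm ((z - y n) *\<^sub>C u n) = cmod (z - y n)"
          by (simp add: norm_scaleC u(1))
        also have "norm (J (u n) - y n *\<^sub>C u n) \<le> cmod (z - y n) / 1"
          by (rule order_trans[OF less_imp_le[OF u(2)]]) (rule divide_left_mono, auto)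
        finally show "norm (J (u n) - z *\<^sub>C u n) \<le> 2 * (1 / real (Suc n))"
          using yz[of n] by simp
      qed
      show "(\<lambda>n. 2 * (1 / real (Suc n))) \<longlonglongrightarrow> 0"
        by (intro tendsto_mult_right_zero LIMSEQ_Suc[OF lim_1_over_n])
    qed
    then obtain r w where r: "strict_mono r" and lim: "(u \<circ> r) \<longlonglongrightarrow> w"
        and w: "J w = z *\<^sub>C w" "norm w = 1"
      by (rule approx_kernel_subseq[OF ns u(1)])
    have real: "v = complex_of_real (Re v)" if "v \<in> op_spectrum J" for v
      using that below_nonreal[of v] unfolding spectrum_iff complex_eq_iff by auto
    have small: "\<bar>inner w (u n)\<bar> \<le> 1 / real (Suc n)" for n
    proof -
      define s t where "s = Re z" and "t = Re (y n)"
      have st: "z = complex_of_real s" "y n = complex_of_real t"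
        unfolding s_def t_def by (rule real[OF spec], rule real[OF y(1)])
      have "inner w (J (u n) - y n *\<^sub>C u n) = (s - t) * inner w (u n)"
        using symmetric[of w "u n"] unfolding w st scaleC_of_real by (simp add: inner_diff algebra_simps)
      then have "\<bar>s - t\<bar> * \<bar>inner w (u n)\<bar> \<le> norm (J (u n) - y n *\<^sub>C u n)"
        using Cauchy_Schwarz_ineq2[of w "J (u n) - y n *\<^sub>C u n"] w(2) by (simp add: abs_mult)
      also have "\<dots> \<le> \<bar>s - t\<bar> / real (Suc n)"
        using u(2)[of n] unfolding st of_real_diff[symmetric] norm_of_real by simp
      finally have *: "\<bar>s - t\<bar> * \<bar>inner w (u n)\<bar> \<le> \<bar>s - t\<bar> * (1 / real (Suc n))" by simp
      have "\<bar>s - t\<bar> > 0" using y(3)[of n] st by auto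
      with * show ?thesis by (simp only: mult_le_cancel_left_pos)
    qed
    have "(\<lambda>n. inner w ((u \<circ> r) n)) \<longlonglongrightarrow> inner w w"
      by (intro tendsto_inner tendsto_const lim)
    moreover have "(\<lambda>n. inner w ((u \<circ> r) n)) \<longlonglongrightarrow> 0"
    proof (rule Lim_null_comparison)
      show "\<forall>\<^sub>F n in sequentially. norm (inner w ((u \<circ> r) n)) \<le> 1 / real (Suc (r n))"
        using small by simp
      show "(\<lambda>n. 1 / real (Suc (r n))) \<longlonglongrightarrow> 0"
        using LIMSEQ_subseq_LIMSEQ[OF LIMSEQ_Suc[OF lim_1_over_n] r] by (simp add: o_def)
    qed
    ultimately have "inner w w = 0" using LIMSEQ_unique by blast
    with w(2) show False by simp
  qed
  ultimately show ?thesis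
    using w0 unfolding discrete_spectrum_def by (intro CollectI conjI) (auto intro: exI[of _ "{w}"])
qed

lemma essential_spectrum_iff: "z \<in> essential_spectrum J \<longleftrightarrow> singular J z"
  using singular_not_discrete not_singular_discrete singular_imp_not_below
  by (auto simp: essential_spectrum_def spectrum_iff)

end

section \<open>Eigenvalues of limit matrices are singular\<close>

lemma tridiagonal_mult_sum:
  assumes "i < k" "w 0 = 0" "\<And>m. k < m \<Longrightarrow> w m = 0"
  shows "(\<Sum>j<k. tridiagonal k c d $$ (i, j) * w (Suc j)) = jacobi_seq c d w (Suc i)"
proof -
  have "(\<Sum>j<k. tridiagonal k c d $$ (i, j) * w (Suc j)) =
      (\<Sum>j<k. (if j = i then complex_of_real (d (i + 1)) * w (Suc i) else 0)
        + (if j = Suc i then complex_of_real (c (i + 1)) * w (Suc (Suc i)) else 0)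
        + (if Suc j = i then complex_of_real (c i) * w i else 0))"
    using assms(1) by (intro sum.cong) (auto simp: tridiagonal_def)
  also have "\<dots> = complex_of_real (d (i + 1)) * w (Suc i)
      + (if Suc i < k then complex_of_real (c (i + 1)) * w (Suc (Suc i)) else 0)
      + (\<Sum>j<k. if Suc j = i then complex_of_real (c i) * w i else 0)"
    using assms(1) by (simp add: sum.distrib)
  also have "(\<Sum>j<k. if Suc j = i then complex_of_real (c i) * w i else 0) = complex_of_real (c i) * w i"
    using assms(1,2) by (cases i) auto
  also have "(if Suc i < k then complex_of_real (c (i + 1)) * w (Suc (Suc i)) else 0)
      = complex_of_real (c (i + 1)) * w (Suc (Suc i))"
    using assms by auto
  finally show ?thesis by (simp add: jacobi_seq_def)
qed

text \<open>Vectors become sequences on the positions \<open>1\<close> to \<open>k\<close>, padded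
  with zeros. The padding supplies the missing neighbours of the first and last row, whatever the
  values of \<open>c 0\<close> and \<open>c k\<close>.\<close>

lemma eigenvalue_tridiagonal_iff:
  "eigenvalue (tridiagonal k c d) z \<longleftrightarrow>
    (\<exists>w. w 0 = 0 \<and> (\<forall>m>k. w m = 0) \<and> (\<exists>m. w m \<noteq> 0) \<and> (\<forall>m\<in>{1..k}. jacobi_seq c d w m = z * w m))"
  (is "?L \<longleftrightarrow> ?R")
proof
  have dim: "dim_row (tridiagonal k c d) = k" "dim_col (tridiagonal k c d) = k"
    by (simp_all add: tridiagonal_def)
  have mult: "(tridiagonal k c d *\<^sub>v v) $ i = (\<Sum>j<k. tridiagonal k c d $$ (i, j) * v $ j)"
    if "i < k" "dim_vec v = k" for v i
    using that by (simp add: dim scalar_prod_def atLeast0LessThan)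
  {
    assume ?L
    then obtain v where v: "dim_vec v = k" "v \<noteq> 0\<^sub>v k" "tridiagonal k c d *\<^sub>v v = z \<cdot>\<^sub>v v"
      unfolding eigenvalue_def eigenvector_def dim using carrier_vecD by blast
    define w where "w m = (if 1 \<le> m \<and> m \<le> k then v $ (m - 1) else 0)" for m
    have "jacobi_seq c d w m = z * w m" if "m \<in> {1..k}" for m
    proof -
      have m: "m - 1 < k" "Suc (m - 1) = m" using that by auto
      have "jacobi_seq c d w m = (\<Sum>j<k. tridiagonal k c d $$ (m - 1, j) * w (Suc j))"
        using tridiagonal_mult_sum[of "m - 1" k w c d] m by (simp add: w_def)
      also have "\<dots> = (tridiagonal k c d *\<^sub>v v) $ (m - 1)"
        using m v(1) by (subst mult) (auto simp: w_def intro!: sum.cong)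
      also have "\<dots> = z * w m" using that m v(1) by (simp add: v(3) w_def)
      finally show ?thesis .
    qed
    moreover have "\<exists>m. w m \<noteq> 0"
    proof (rule ccontr)
      assume "\<not> ?thesis"
      then have w_eq: "w m = 0" for m by blast
      have "v $ i = 0" if "i < k" for i
        using that w_eq[of "Suc i"] by (simp add: w_def)
      then have "v = 0\<^sub>v k" using v(1) by (intro eq_vecI) auto
      with v(2) show False ..
    qed
    ultimately show ?R by (intro exI[of _ w]) (auto simp: w_def)
  next
    assume ?R
    then obtain w m where w: "w 0 = 0" "\<And>m. k < m \<Longrightarrow> w m = 0" "w m \<noteq> 0"
        "\<And>m. m \<in> {1..k} \<Longrightarrow> jacobi_seq c d w m = z * w m"
      by blast
    define v where "v = vec k (\<lambda>i. w (Suc i))"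
    have "m \<noteq> 0" using w(1,3) by metis
    moreover have "\<not> k < m" using w(2)[of m] w(3) by blast
    ultimately have m: "1 \<le> m" "m \<le> k" by simp_all
    have "v \<noteq> 0\<^sub>v k"
    proof
      assume "v = 0\<^sub>v k"
      then have "v $ (m - 1) = 0" using m by simp
      then show False using m w(3) by (simp add: v_def)
    qed
    moreover have "tridiagonal k c d *\<^sub>v v = z \<cdot>\<^sub>v v"
    proof (rule eq_vecI)
      fix i assume "i < dim_vec (z \<cdot>\<^sub>v v)"
      then have i: "i < k" by (simp add: v_def)
      have "(tridiagonal k c d *\<^sub>v v) $ i = (\<Sum>j<k. tridiagonal k c d $$ (i, j) * w (Suc j))"
        using i by (subst mult) (auto simp: v_def)
      also have "\<dots> = jacobi_seq c d w (Suc i)" by (rule tridiagonal_mult_sum) (simp_all add: i w(1,2))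
      also have "\<dots> = z * w (Suc i)" using i by (intro w(4)) auto
      finally show "(tridiagonal k c d *\<^sub>v v) $ i = (z \<cdot>\<^sub>v v) $ i" using i by (simp add: v_def)
    qed (simp add: dim v_def)
    ultimately show ?L
      by (auto simp: eigenvalue_def eigenvector_def dim v_def intro!: exI[of _ v])
  }
qed

lemma norm_ell2_window:
  assumes "\<And>i. i < p \<or> p + K < i \<Longrightarrow> Rep_ell2 u i = 0"
  shows "(norm u)\<^sup>2 = (\<Sum>m\<le>K. (cmod (Rep_ell2 u (p + m)))\<^sup>2)"
proof -
  have "Rep_ell2 u i = 0" if "i \<notin> (+) p ` {..K}" for i
  proof -
    have "i < p \<or> p + K < i"
    proof (rule ccontr)
      assume "\<not> ?thesis"
      then have "i = p + (i - p)" "i - p \<le> K" by auto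
      with that show False by blast
    qed
    then show ?thesis by (rule assms)
  qed
  then have "(norm u)\<^sup>2 = (\<Sum>i\<in>(+) p ` {..K}. (cmod (Rep_ell2 u i))\<^sup>2)"
    by (intro norm_ell2_finite) auto
  then show ?thesis by (simp add: sum.reindex)
qed

context jacobi_op
begin

lemma limit_matrix_eigenvalue_singular:
  assumes lm: "limit_matrix a b k M" and ev: "eigenvalue M z"
  shows "singular J z"
proof -
  obtain n c0 d where n1: "\<And>j. 1 \<le> n j" and n: "filterlim n at_top sequentially"
    and a0: "(\<lambda>j. a (n j)) \<longlonglongrightarrow> 0" "(\<lambda>j. a (n j + k)) \<longlonglongrightarrow> 0"
    and am: "\<And>m. m \<in> {1..<k} \<Longrightarrow> (\<lambda>j. a (n j + m)) \<longlonglongrightarrow> c0 m"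
    and bm: "\<And>m. m \<in> {1..k} \<Longrightarrow> (\<lambda>j. b (n j + m)) \<longlonglongrightarrow> d m"
    and M: "M = tridiagonal k c0 d"
    using lm unfolding limit_matrix_def by blast
  obtain w m0 where w: "w 0 = 0" "\<And>m. k < m \<Longrightarrow> w m = 0" "w m0 \<noteq> 0"
      "\<And>m. m \<in> {1..k} \<Longrightarrow> jacobi_seq c0 d w m = z * w m"
    using ev unfolding M eigenvalue_tridiagonal_iff by blast
  \<comment> \<open>The limits \<open>c0\<close> are unspecified at \<open>0\<close> and
    \<open>k\<close>, where the couplings tend to \<open>0\<close>. With these values filled in, one
    convergence statement covers the whole block; \<open>eig\<close> is unaffected because
    \<open>w\<close> vanishes at \<open>0\<close> and \<open>k + 1\<close>.\<close>
  define c where "c m = (if 1 \<le> m \<and> m < k then c0 m else 0)" for m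
  have ac: "(\<lambda>j. a (n j + m)) \<longlonglongrightarrow> c m" if "m \<le> k" for m
  proof -
    have "m = 0 \<or> m = k \<or> m \<in> {1..<k}" using that by auto
    then consider "m = 0" | "m = k" | "m \<in> {1..<k}" by blast
    then show ?thesis
    proof cases
      case 3
      then show ?thesis using am[OF 3] by (simp add: c_def)
    qed (use a0 in \<open>simp_all add: c_def\<close>)
  qed
  have eig: "jacobi_seq c d w m = z * w m" if "m \<in> {1..k}" for m
  proof -
    have "complex_of_real (c0 (m - 1)) * w (m - 1) = complex_of_real (c (m - 1)) * w (m - 1)"
      using w(1) that by (cases "m = 1") (auto simp: c_def)
    moreover have "complex_of_real (c0 m) * w (m + 1) = complex_of_real (c m) * w (m + 1)"
      using w(2)[of "m + 1"] that by (cases "m = k") (auto simp: c_def)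
    ultimately show ?thesis
      using w(4)[OF that] that unfolding jacobi_seq_def by (simp only:)
  qed
  define u where "u j = ell2_of {n j..n j + k} (\<lambda>i. w (i - n j))" for j
  have u: "Rep_ell2 (u j) (n j + m) = w m" for j m
    using n1[of j] w(1) w(2)[of m] by (auto simp: u_def Rep_ell2_of)
  have u': "Rep_ell2 (u j) i = 0" if "i \<le> n j \<or> n j + k < i" for i j
    using that w(1) by (auto simp: u_def Rep_ell2_of)
  define W where "W = (\<Sum>m\<le>k. (cmod (w m))\<^sup>2)"
  have W: "W > 0"
    unfolding W_def using w(2)[of m0] w(3) by (intro sum_pos2[of _ m0]) (auto simp: not_less[symmetric])
  have nu: "(norm (u j))\<^sup>2 = W" for j
    unfolding W_def by (subst norm_ell2_window[of "n j" k]) (auto simp: u u')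
  define v where "v j = J (u j) - z *\<^sub>C u j" for j
  have v': "Rep_ell2 (v j) i = 0" if "i < n j \<or> n j + Suc k < i" for i j
  proof -
    have "i - 1 \<le> n j \<or> n j + k < i - 1" "i \<le> n j \<or> n j + k < i" "i + 1 \<le> n j \<or> n j + k < i + 1"
      using that by arith+
    from this[THEN u'] show ?thesis by (simp add: v_def Rep_J)
  qed
  \<comment> \<open>\<open>J\<close> spreads the support by one place on each side. The two outer
    entries are \<open>a (n j) * w 1\<close> and \<open>a (n j + k) * w k\<close>, which vanish in
    the limit with the end couplings.\<close>
  have v: "(\<lambda>j. Rep_ell2 (v j) (n j + m)) \<longlonglongrightarrow> 0" if m: "m \<le> Suc k" for m
  proof -
    consider "m = 0" | "m = Suc k" | "m \<in> {1..k}" using m by force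
    then show ?thesis
    proof cases
      case 1
      have "Rep_ell2 (v j) (n j + m) = complex_of_real (a (n j)) * w 1" for j
        using n1[of j] u[of j 1] by (simp add: v_def Rep_J u' 1)
      moreover have "(\<lambda>j. complex_of_real (a (n j)) * w 1) \<longlonglongrightarrow> complex_of_real 0 * w 1"
        by (intro tendsto_intros a0)
      ultimately show ?thesis by simp
    next
      case 2
      have "Rep_ell2 (v j) (n j + m) = complex_of_real (a (n j + k)) * w k" for j
        using n1[of j] by (simp add: v_def Rep_J u' 2 u)
      moreover have "(\<lambda>j. complex_of_real (a (n j + k)) * w k) \<longlonglongrightarrow> complex_of_real 0 * w k"
        by (intro tendsto_intros a0)
      ultimately show ?thesis by simp
    next
      case 3
      have "Rep_ell2 (v j) (n j + m) = complex_of_real (a (n j + (m - 1))) * w (m - 1)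
          + complex_of_real (b (n j + m)) * w m + complex_of_real (a (n j + m)) * w (m + 1) - z * w m" for j
        using 3 u[of j "m - 1"] u[of j m] u[of j "m + 1"] by (simp add: v_def Rep_J)
      moreover have "(\<lambda>j. complex_of_real (a (n j + (m - 1))) * w (m - 1)
          + complex_of_real (b (n j + m)) * w m + complex_of_real (a (n j + m)) * w (m + 1) - z * w m)
          \<longlonglongrightarrow> complex_of_real (c (m - 1)) * w (m - 1) + complex_of_real (d m) * w m
            + complex_of_real (c m) * w (m + 1) - z * w m"
        using 3 by (intro tendsto_intros ac bm) auto
      moreover have "complex_of_real (c (m - 1)) * w (m - 1) + complex_of_real (d m) * w m
            + complex_of_real (c m) * w (m + 1) - z * w m = 0"
        using eig[OF 3] 3 by (simp add: jacobi_seq_def)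
      ultimately show ?thesis by simp
    qed
  qed
  have "(\<lambda>j. \<Sum>m\<le>Suc k. (cmod (Rep_ell2 (v j) (n j + m)))\<^sup>2) \<longlonglongrightarrow> (\<Sum>m\<le>Suc k. (cmod 0)\<^sup>2)"
    by (intro tendsto_sum tendsto_power tendsto_norm v) auto
  moreover have "(norm (v j))\<^sup>2 = (\<Sum>m\<le>Suc k. (cmod (Rep_ell2 (v j) (n j + m)))\<^sup>2)" for j
    by (rule norm_ell2_window) (use v' in auto)
  ultimately have v0: "(\<lambda>j. (norm (v j))\<^sup>2) \<longlonglongrightarrow> 0" by simp
  show ?thesis
    unfolding singular_def
  proof (intro allI impI)
    fix e :: real and N assume e: "e > 0"
    have "\<forall>\<^sub>F j in sequentially. (norm (v j))\<^sup>2 < e\<^sup>2 * W"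
      by (rule order_tendstoD(2)[OF v0]) (use e W in simp)
    moreover have "\<forall>\<^sub>F j in sequentially. N \<le> n j"
      using n by (simp add: filterlim_at_top)
    ultimately have "\<forall>\<^sub>F j in sequentially. (norm (v j))\<^sup>2 < e\<^sup>2 * W \<and> N \<le> n j"
      by (rule eventually_conj)
    then obtain j where j: "(norm (v j))\<^sup>2 < e\<^sup>2 * W" "N \<le> n j"
      using eventually_happens' sequentially_bot by blast
    have "(norm (v j))\<^sup>2 \<le> (e * norm (u j))\<^sup>2"
      using j(1) by (simp add: power_mult_distrib nu)
    then have "norm (v j) \<le> e * norm (u j)"
      by (rule power2_le_imp_le) (use e in simp)
    moreover have "u j \<noteq> 0" using nu[of j] W by auto
    ultimately show "\<exists>u. u \<noteq> 0 \<and> (\<forall>n<N. Rep_ell2 u n = 0) \<and> norm (J u - z *\<^sub>C u) \<le> e * norm u"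
      using j(2) by (intro exI[of _ "u j"]) (auto simp: v_def u')
  qed
qed

end

section \<open>Localization of approximate eigenvectors\<close>

definition supported :: "nat set \<Rightarrow> ell2 \<Rightarrow> bool" where
  "supported S u \<longleftrightarrow> (\<forall>n. n \<notin> S \<longrightarrow> Rep_ell2 u n = 0)"

lemma supportedD: "supported S u \<Longrightarrow> n \<notin> S \<Longrightarrow> Rep_ell2 u n = 0"
  by (simp add: supported_def)

lemma supported_restr: "supported S u \<Longrightarrow> S \<inter> R \<subseteq> T \<Longrightarrow> supported T (restr R u)"
  by (auto simp: supported_def)

lemma supported_empty: "supported {} u \<Longrightarrow> u = 0"
  by (rule ell2_eqI) (simp add: supported_def)

section \<open>Removal of couplings\<close>

lemma jacobi_perturb:
  assumes bp: "bounded_parameters a b" "bounded_parameters a' b"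
    and close: "\<And>n. 1 \<le> n \<Longrightarrow> \<bar>a n - a' n\<bar> \<le> d"
  shows "norm (jacobi a b u - jacobi a' b u) \<le> 3 * d * norm u"
proof -
  have d: "0 \<le> d" using close[of 1] by linarith
  \<comment> \<open>The difference of the operators is itself a Jacobi operator with zero diagonal,
    so the error depends on the largest change only, however many couplings are changed.\<close>
  have "bounded_parameters (\<lambda>n. a n - a' n) (\<lambda>_. 0)"
    by (rule jacobi_bound(1)[OF close]) (use d in simp_all)
  then have "jacobi a b u - jacobi a' b u = jacobi (\<lambda>n. a n - a' n) (\<lambda>_. 0) u"
    by (intro ell2_eqI) (simp add: Rep_jacobi bp jacobi_seq_def algebra_simps)
  then show ?thesis
    using jacobi_bound(2)[of "\<lambda>n. a n - a' n" d "\<lambda>_. 0"] close d by simp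
qed

lemma (in jacobi_op) shift_perturb:
  assumes bp: "bounded_parameters a' b"
    and close: "\<And>n. 1 \<le> n \<Longrightarrow> \<bar>a n - a' n\<bar> \<le> d"
  shows "norm (J u - z *\<^sub>C u) \<le> norm (jacobi a' b u - z *\<^sub>C u) + 3 * d * norm u"
    and "norm (jacobi a' b u - z *\<^sub>C u) \<le> norm (J u - z *\<^sub>C u) + 3 * d * norm u"
proof -
  have *: "norm (J u - jacobi a' b u) \<le> 3 * d * norm u"
    by (rule jacobi_perturb[OF bounded_parameters bp close])
  show "norm (J u - z *\<^sub>C u) \<le> norm (jacobi a' b u - z *\<^sub>C u) + 3 * d * norm u"
    using norm_triangle_ineq[of "J u - jacobi a' b u" "jacobi a' b u - z *\<^sub>C u"] * by simp
  show "norm (jacobi a' b u - z *\<^sub>C u) \<le> norm (J u - z *\<^sub>C u) + 3 * d * norm u"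
    using norm_triangle_ineq4[of "J u - z *\<^sub>C u" "J u - jacobi a' b u"] * by simp
qed

text \<open>A vanishing coupling separates the rows up to \<open>r\<close> from the later ones, so
  the images of the two pieces have disjoint supports.\<close>

lemma (in jacobi_op) norm_shift_cut:
  assumes "a r = 0"
  shows "(norm (J u - z *\<^sub>C u))\<^sup>2 = (norm (J (restr {..r} u) - z *\<^sub>C restr {..r} u))\<^sup>2
    + (norm (J (restr {r<..} u) - z *\<^sub>C restr {r<..} u))\<^sup>2"
proof -
  define S where "S v = J v - z *\<^sub>C v" for v
  have u: "u = restr {..r} u + restr {r<..} u"
    by (rule ell2_eqI) auto
  have "S (v + w) = S v + S w" for v w
    by (rule ell2_eqI) (simp add: S_def add algebra_simps)
  then have "S u = S (restr {..r} u) + S (restr {r<..} u)"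
    by (subst u) simp
  moreover have "(norm (S (restr {..r} u) + S (restr {r<..} u)))\<^sup>2
      = (norm (S (restr {..r} u)))\<^sup>2 + (norm (S (restr {r<..} u)))\<^sup>2"
  proof (rule norm_disjoint)
    fix n
    show "Rep_ell2 (S (restr {..r} u)) n = 0 \<or> Rep_ell2 (S (restr {r<..} u)) n = 0"
    proof (cases "n \<le> r")
      case True
      then have "n - 1 \<le> r" by simp
      with True have "Rep_ell2 (S (restr {r<..} u)) n = 0"
        using assms by (cases "n = r") (simp_all add: S_def Rep_J)
      then show ?thesis ..
    next
      case False
      then have "\<not> n \<le> r" "\<not> n + 1 \<le> r" "n - 1 = r \<or> \<not> n - 1 \<le> r" by auto
      then have "Rep_ell2 (S (restr {..r} u)) n = 0"
        using assms by (auto simp: S_def Rep_J)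
      then show ?thesis ..
    qed
  qed
  ultimately show ?thesis by (simp add: S_def)
qed

lemma norm_restr_cut: "(norm u)\<^sup>2 = (norm (restr {..r} u))\<^sup>2 + (norm (restr {r<..} u))\<^sup>2"
proof -
  have "u = restr {..r} u + restr {r<..} u"
    by (rule ell2_eqI) auto
  then show ?thesis
    using norm_disjoint[of "restr {..r} u" "restr {r<..} u"] by simp
qed

text \<open>By Pythagoras the constant \<open>c\<close> survives the cut unchanged, so any number of
  cuts can follow one another without loss.\<close>

lemma (in jacobi_op) norm_shift_cut_lower:
  assumes "a r = 0" "c \<ge> 0"
    and "c * norm (restr {..r} u) \<le> norm (J (restr {..r} u) - z *\<^sub>C restr {..r} u)"
    and "c * norm (restr {r<..} u) \<le> norm (J (restr {r<..} u) - z *\<^sub>C restr {r<..} u)"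
  shows "c * norm u \<le> norm (J u - z *\<^sub>C u)"
proof (rule power2_le_imp_le)
  have "(c * norm u)\<^sup>2 = (c * norm (restr {..r} u))\<^sup>2 + (c * norm (restr {r<..} u))\<^sup>2"
    unfolding power_mult_distrib norm_restr_cut[of u r] by (simp add: distrib_left)
  also have "\<dots> \<le> (norm (J u - z *\<^sub>C u))\<^sup>2"
    unfolding norm_shift_cut[OF assms(1), of u] using assms(2-4)
    by (intro add_mono power_mono) auto
  finally show "(c * norm u)\<^sup>2 \<le> (norm (J u - z *\<^sub>C u))\<^sup>2" .
qed simp

section \<open>Blocks between small couplings\<close>

context positive_jacobi_op
begin

text \<open>One number \<open>e\<close> bounds both end couplings and the relative error, so the
  negation yields a number that is at once a threshold for couplings and a lower bound on
  blocks.\<close>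

definition localized :: "complex \<Rightarrow> nat \<Rightarrow> bool" where
  "localized z k \<longleftrightarrow> (\<forall>e>0. \<forall>N. \<exists>n w. N \<le> n \<and> 1 \<le> n \<and> a n \<le> e \<and> a (n + k) \<le> e \<and>
     w \<noteq> 0 \<and> supported {n<..n + k} w \<and> norm (J w - z *\<^sub>C w) \<le> e * norm w)"

text \<open>Shrinking \<open>e\<close> strengthens the premises and weakens the conclusion, so the
  constants for finitely many lengths combine by \<open>min\<close> and \<open>max\<close>.\<close>

lemma not_localized_uniform:
  assumes "finite S" "\<And>k. k \<in> S \<Longrightarrow> \<not> localized z k"
  shows "\<exists>e>0. \<exists>N\<ge>1. \<forall>k\<in>S. \<forall>n\<ge>N. \<forall>w. a n \<le> e \<longrightarrow> a (n + k) \<le> e \<longrightarrow>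
    supported {n<..n + k} w \<longrightarrow> e * norm w \<le> norm (J w - z *\<^sub>C w)"
  using assms
proof (induction rule: finite_induct)
  case empty
  show ?case by (rule exI[of _ 1]) auto
next
  case (insert k S)
  then obtain e1 N1 where e1: "e1 > 0" "N1 \<ge> 1"
    "\<And>k n w. k \<in> S \<Longrightarrow> n \<ge> N1 \<Longrightarrow> a n \<le> e1 \<Longrightarrow> a (n + k) \<le> e1 \<Longrightarrow> supported {n<..n + k} w \<Longrightarrow>
       e1 * norm w \<le> norm (J w - z *\<^sub>C w)"
    by (metis insertCI)
  from insert.prems[of k] obtain e2 N2 where e2: "e2 > 0"
    "\<And>n w. N2 \<le> n \<Longrightarrow> 1 \<le> n \<Longrightarrow> a n \<le> e2 \<Longrightarrow> a (n + k) \<le> e2 \<Longrightarrow> w \<noteq> 0 \<Longrightarrow> supported {n<..n + k} w \<Longrightarrow>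
       \<not> norm (J w - z *\<^sub>C w) \<le> e2 * norm w"
    unfolding localized_def by blast
  define e N where "e = min e1 e2" and "N = max N1 N2"
  have "e * norm w \<le> norm (J w - z *\<^sub>C w)"
    if "k' \<in> insert k S" "n \<ge> N" "a n \<le> e" "a (n + k') \<le> e" "supported {n<..n + k'} w" for k' n w
  proof (cases "w = 0")
    case False
    show ?thesis
    proof (cases "k' = k")
      case True
      then have "e2 * norm w \<le> norm (J w - z *\<^sub>C w)"
        using e2(2)[of n w] that e1(2) False by (simp add: e_def N_def)
      moreover have "e * norm w \<le> e2 * norm w" by (intro mult_right_mono) (auto simp: e_def)
      ultimately show ?thesis by linarith
    next
      case False
      then have "e1 * norm w \<le> norm (J w - z *\<^sub>C w)"
        using e1(3)[of k' n w] that by (simp add: e_def N_def)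
      moreover have "e * norm w \<le> e1 * norm w" by (intro mult_right_mono) (auto simp: e_def)
      ultimately show ?thesis by linarith
    qed
  qed simp
  moreover have "e > 0" "N \<ge> 1" using e1 e2 by (auto simp: e_def N_def)
  ultimately show ?case by blast
qed

lemma eventually_small_window:
  assumes prod: "(\<lambda>n. \<Prod>i<l. a (n + i)) \<longlonglongrightarrow> 0" and d: "d > 0"
  shows "\<exists>N. \<forall>n\<ge>N. \<exists>i<l. a (n + i) \<le> d"
proof -
  have "\<forall>\<^sub>F n in sequentially. (\<Prod>i<l. a (n + i)) < d ^ l"
    by (rule order_tendstoD(2)[OF prod]) (use d in simp)
  then obtain N where N: "\<And>n. n \<ge> N \<Longrightarrow> (\<Prod>i<l. a (n + i)) < d ^ l"
    unfolding eventually_sequentially by blast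
  have "\<exists>i<l. a (n + i) \<le> d" if "n \<ge> N" for n
  proof (rule ccontr)
    assume "\<not> ?thesis"
    then have "(\<Prod>i<l. d) \<le> (\<Prod>i<l. a (n + i))"
      using d by (intro prod_mono) (auto simp: not_le less_imp_le)
    with N[OF that] show False by simp
  qed
  then show ?thesis by blast
qed

text \<open>Otherwise one lower bound holds on all blocks of length at most \<open>l\<close> that
  lie far out between small couplings. Removing the small couplings leaves a direct sum of such
  blocks, which inherits the bound and contradicts \<open>sing\<close>.\<close>

lemma singular_imp_localized:
  assumes prod: "(\<lambda>n. \<Prod>i<l. a (n + i)) \<longlonglongrightarrow> 0" and sing: "singular J z"
  shows "\<exists>k\<in>{1..l}. localized z k"
proof (rule ccontr)
  assume "\<not> ?thesis"
  then obtain e N where e: "e > 0" and N: "N \<ge> 1" and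
    block: "\<And>k n w. k \<in> {1..l} \<Longrightarrow> n \<ge> N \<Longrightarrow> a n \<le> e \<Longrightarrow> a (n + k) \<le> e \<Longrightarrow>
      supported {n<..n + k} w \<Longrightarrow> e * norm w \<le> norm (J w - z *\<^sub>C w)"
    using not_localized_uniform[of "{1..l}" z] by (metis finite_atLeastAtMost)
  \<comment> \<open>Removing couplings up to \<open>d\<close> costs \<open>3 * d = e / 4\<close>. So
    \<open>e\<close> drops to \<open>3 / 4 * e\<close> on blocks, which in the end still exceeds
    \<open>e / 4 + 3 * d = e / 2\<close>.\<close>
  define d where "d = e / 12"
  have d: "d > 0" "d \<le> e" using e by (auto simp: d_def)
  obtain N1 where N1: "\<And>n. n \<ge> N1 \<Longrightarrow> \<exists>i<l. a (n + i) \<le> d"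
    using eventually_small_window[OF prod d(1)] by blast
  define N2 where "N2 = max N N1"
  define C where "C = {n. N \<le> n \<and> a n \<le> d}"
  define a' where "a' n = (if n \<in> C then 0 else a n)" for n
  have close: "\<bar>a n - a' n\<bar> \<le> d" if "1 \<le> n" for n
    using a_pos[OF that] d by (auto simp: a'_def C_def)
  obtain A where A: "\<And>n. 1 \<le> n \<Longrightarrow> \<bar>a n\<bar> \<le> A" "\<And>n. 1 \<le> n \<Longrightarrow> \<bar>b n\<bar> \<le> A"
    by (rule bounded_parametersE[OF bounded_parameters]) blast
  have bp': "bounded_parameters a' b"
  proof (rule jacobi_bound(1)[OF _ A(2)])
    show "\<bar>a' n\<bar> \<le> A" if "1 \<le> n" for n
      using A(1)[OF that] by (auto simp: a'_def)
  qed
  interpret J': jacobi_op a' b by standard (rule bp')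
  note perturb = shift_perturb[OF bp' close]
  have low: "3 / 4 * e * norm u \<le> norm (jacobi a' b u - z *\<^sub>C u)"
    if "p \<in> C" "q \<in> C" "N2 \<le> p" "p \<le> q" "supported {p<..q} u" for p q u
    using that
  proof (induction "q - p" arbitrary: p q u rule: less_induct)
    case less
    show ?case
    proof (cases "q - p \<le> l")
      case True
      show ?thesis
      proof (cases "p = q")
        case True
        then have "u = 0" using less.prems(5) by (intro supported_empty) simp
        then show ?thesis by (simp add: J'.zero)
      next
        case False
        have "e * norm u \<le> norm (J u - z *\<^sub>C u)"
          using block[of "q - p" p u] less.prems \<open>q - p \<le> l\<close> False d by (auto simp: C_def)
        then show ?thesis using perturb(1)[of u z] by (simp add: d_def algebra_simps)
      qed
    next
      case False
      \<comment> \<open>An interval longer than \<open>l\<close> contains a removed coupling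
        strictly inside, so both parts are shorter.\<close>
      have "N1 \<le> p + 1" using less.prems(3) by (simp add: N2_def)
      then obtain i where i: "i < l" "a (p + 1 + i) \<le> d" using N1 by blast
      define r where "r = p + 1 + i"
      have r: "p < r" "r < q" "r \<in> C"
        using i False less.prems(1) by (auto simp: r_def C_def)
      show ?thesis
      proof (rule J'.norm_shift_cut_lower[of r])
        show "a' r = 0" using r by (simp add: a'_def)
        show "3 / 4 * e * norm (restr {..r} u) \<le> norm (jacobi a' b (restr {..r} u) - z *\<^sub>C restr {..r} u)"
          using less.prems r by (intro less.hyps[of r p]) (auto intro: supported_restr)
        show "3 / 4 * e * norm (restr {r<..} u) \<le> norm (jacobi a' b (restr {r<..} u) - z *\<^sub>C restr {r<..} u)"
          using less.prems r by (intro less.hyps[of q r]) (auto intro: supported_restr)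
      qed (use e in simp)
    qed
  qed
  have "N1 \<le> N2" "N \<le> N2" by (auto simp: N2_def)
  then obtain i where i: "a (N2 + i) \<le> d" using N1 by blast
  define p where "p = N2 + i"
  have p: "p \<in> C" using i \<open>N \<le> N2\<close> by (simp add: C_def p_def)
  \<comment> \<open>The end \<open>m\<close> of the support need not be a removed coupling, so the
    interval is extended to one.\<close>
  have fin: "3 / 4 * e * norm u \<le> norm (jacobi a' b u - z *\<^sub>C u)" if "supported {p<..m} u" "p \<le> m" for u m
  proof -
    have "N1 \<le> m" using that(2) \<open>N1 \<le> N2\<close> by (simp add: p_def)
    then obtain i where i: "a (m + i) \<le> d" using N1 by blast
    show ?thesis
    proof (rule low[of p "m + i"])
      show "m + i \<in> C" using i that(2) \<open>N \<le> N2\<close> by (simp add: C_def p_def)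
      show "supported {p<..m + i} u" using that(1) by (auto simp: supported_def)
    qed (use p that(2) in \<open>auto simp: p_def\<close>)
  qed
  \<comment> \<open>The bound does not depend on the length of the support, so it passes from
    truncations to the limit.\<close>
  have all: "3 / 4 * e * norm u \<le> norm (jacobi a' b u - z *\<^sub>C u)" if "supported {p<..} u" for u
  proof (rule LIMSEQ_le)
    let ?u = "\<lambda>m. restr {..<m} u"
    have u: "?u \<longlonglongrightarrow> u" by (rule restr_lessThan_tendsto)
    show "(\<lambda>m. 3 / 4 * e * norm (?u m)) \<longlonglongrightarrow> 3 / 4 * e * norm u"
      by (intro tendsto_intros u)
    have "(\<lambda>m. z *\<^sub>C ?u m) \<longlonglongrightarrow> z *\<^sub>C u"
    proof (rule LIM_zero_cancel, rule Lim_null_comparison)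
      show "\<forall>\<^sub>F m in sequentially. norm (z *\<^sub>C ?u m - z *\<^sub>C u) \<le> cmod z * norm (?u m - u)"
        by (simp add: scaleC_diff_right[symmetric] norm_scaleC)
      show "(\<lambda>m. cmod z * norm (?u m - u)) \<longlonglongrightarrow> 0"
        by (intro tendsto_mult_right_zero tendsto_norm_zero LIM_zero u)
    qed
    then show "(\<lambda>m. norm (jacobi a' b (?u m) - z *\<^sub>C ?u m)) \<longlonglongrightarrow> norm (jacobi a' b u - z *\<^sub>C u)"
      by (intro tendsto_norm tendsto_diff J'.tendsto u)
    show "\<exists>M. \<forall>m\<ge>M. 3 / 4 * e * norm (?u m) \<le> norm (jacobi a' b (?u m) - z *\<^sub>C ?u m)"
    proof (intro exI[of _ p] allI impI)
      fix m assume "p \<le> m"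
      show "3 / 4 * e * norm (?u m) \<le> norm (jacobi a' b (?u m) - z *\<^sub>C ?u m)"
        by (rule fin[of m]) (use that \<open>p \<le> m\<close> in \<open>auto intro: supported_restr\<close>)
    qed
  qed
  have "e / 4 > 0" using e by simp
  then obtain u where u: "u \<noteq> 0" "\<forall>n<Suc p. Rep_ell2 u n = 0" "norm (J u - z *\<^sub>C u) \<le> e / 4 * norm u"
    using sing unfolding singular_def by meson
  have "3 / 4 * e * norm u \<le> norm (jacobi a' b u - z *\<^sub>C u)"
    by (rule all) (use u(2) in \<open>auto simp: supported_def\<close>)
  then have "3 / 4 * e * norm u \<le> e / 4 * norm u + 3 * d * norm u"
    using perturb(2)[of u z] u(3) by linarith
  then have "e * norm u \<le> 0" by (simp add: d_def algebra_simps)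
  with e u(1) show False by (simp add: mult_le_0_iff)
qed

end

section \<open>Blocks of minimal length\<close>

context positive_jacobi_op
begin

lemma not_localized_0: "\<not> localized z 0"
proof
  assume "localized z 0"
  from this[unfolded localized_def, rule_format, of 1 0] obtain n w
    where "w \<noteq> 0" "supported {n<..n + 0} w"
    by auto
  then show False using supported_empty[of w] by simp
qed

text \<open>Cutting a small coupling inside an approximate eigenvector leaves an approximate eigenvector
  on one of the two shorter blocks, so blocks of minimal length have no small inner coupling.\<close>

lemma coupling_lower_bound:
  assumes e: "e > 0" and n: "1 \<le> n" and m: "m \<in> {1..<k}" and w: "w \<noteq> 0" "supported {n<..n + k} w"
    and small: "norm (J w - z *\<^sub>C w) \<le> e / 3 * norm w"
    and block: "\<And>w. supported {n<..n + m} w \<Longrightarrow> a (n + m) \<le> e \<Longrightarrow> e * norm w \<le> norm (J w - z *\<^sub>C w)"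
      "\<And>w. supported {n + m<..n + k} w \<Longrightarrow> a (n + m) \<le> e \<Longrightarrow> e * norm w \<le> norm (J w - z *\<^sub>C w)"
  shows "e / 12 \<le> a (n + m)"
proof (rule ccontr)
  define r where "r = n + m"
  assume "\<not> ?thesis"
  then have ar: "a r < e / 12" by (simp add: r_def)
  define a' where "a' n = (if n = r then 0 else a n)" for n
  have close: "\<bar>a n - a' n\<bar> \<le> e / 12" if "1 \<le> n" for n
    using a_pos[OF that] ar e by (auto simp: a'_def)
  obtain A where A: "\<And>n. 1 \<le> n \<Longrightarrow> \<bar>a n\<bar> \<le> A" "\<And>n. 1 \<le> n \<Longrightarrow> \<bar>b n\<bar> \<le> A"
    by (rule bounded_parametersE[OF bounded_parameters]) blast
  have bp': "bounded_parameters a' b"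
  proof (rule jacobi_bound(1)[OF _ A(2)])
    show "\<bar>a' n\<bar> \<le> A" if "1 \<le> n" for n
      using A(1)[OF that] by (auto simp: a'_def)
  qed
  interpret J': jacobi_op a' b by standard (rule bp')
  note perturb = shift_perturb[OF bp' close]
  have "a (n + m) \<le> e" using ar e by (simp add: r_def)
  note block' = block[OF _ this, folded r_def]
  have part: "3 / 4 * e * norm v \<le> norm (jacobi a' b v - z *\<^sub>C v)"
    if "e * norm v \<le> norm (J v - z *\<^sub>C v)" for v
    using perturb(1)[of v z] that by (simp add: algebra_simps)
  have "3 / 4 * e * norm w \<le> norm (jacobi a' b w - z *\<^sub>C w)"
  proof (rule J'.norm_shift_cut_lower[of r])
    show "3 / 4 * e * norm (restr {..r} w) \<le> norm (jacobi a' b (restr {..r} w) - z *\<^sub>C restr {..r} w)"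
      by (rule part, rule block'(1), rule supported_restr[OF w(2)]) auto
    show "3 / 4 * e * norm (restr {r<..} w) \<le> norm (jacobi a' b (restr {r<..} w) - z *\<^sub>C restr {r<..} w)"
      by (rule part, rule block'(2), rule supported_restr[OF w(2)]) auto
  qed (use e in \<open>simp_all add: a'_def\<close>)
  \<comment> \<open>The right side is \<open>7 / 12 * e * norm w\<close>; the thresholds
    \<open>e / 3\<close> and \<open>e / 12\<close> keep it below the left side.\<close>
  then have "3 / 4 * e * norm w \<le> e / 3 * norm w + 3 * (e / 12) * norm w"
    using perturb(2)[of w z] small by linarith
  then have "e * norm w \<le> 0" by (simp add: algebra_simps)
  with e w(1) show False by (simp add: mult_le_0_iff)
qed

text \<open>Minimality gives one lower bound for all shorter blocks, and
  \<open>coupling_lower_bound\<close> then keeps the inner couplings away from \<open>0\<close>, as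
  a limit matrix requires. The length \<open>k\<close> is fixed, so unit vectors keep their norm
  under coordinatewise limits and the limit vector is nonzero.\<close>

lemma localized_minimal_limit_matrix:
  assumes loc: "localized z k" and minimal: "\<And>k'. k' < k \<Longrightarrow> \<not> localized z k'"
  shows "\<exists>M. limit_matrix a b k M \<and> eigenvalue M z"
proof -
  have k: "k \<ge> 1" using loc not_localized_0 by (cases k) auto
  obtain e N where e: "e > 0" and N: "N \<ge> 1" and
    block: "\<And>k' n w. k' < k \<Longrightarrow> n \<ge> N \<Longrightarrow> a n \<le> e \<Longrightarrow> a (n + k') \<le> e \<Longrightarrow>
      supported {n<..n + k'} w \<Longrightarrow> e * norm w \<le> norm (J w - z *\<^sub>C w)"
    using not_localized_uniform[of "{..<k}" z] minimal by (metis finite_lessThan lessThan_iff)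
  define d where "d j = e / 3 / real (Suc j)" for j
  have d: "d j > 0" "d j \<le> e / 3" for j using e by (auto simp: d_def field_simps)
  have "\<exists>n w. N + j \<le> n \<and> 1 \<le> n \<and> a n \<le> d j \<and> a (n + k) \<le> d j \<and>
     norm w = 1 \<and> supported {n<..n + k} w \<and> norm (J w - z *\<^sub>C w) \<le> d j" for j
  proof -
    obtain n w where nw: "N + j \<le> n" "1 \<le> n" "a n \<le> d j" "a (n + k) \<le> d j"
      and w: "w \<noteq> 0" "supported {n<..n + k} w" "norm (J w - z *\<^sub>C w) \<le> d j * norm w"
      using loc d(1)[of j] unfolding localized_def by meson
    define v where "v = (1 / norm w) *\<^sub>R w"
    have "J v - z *\<^sub>C v = (1 / norm w) *\<^sub>R (J w - z *\<^sub>C w)"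
      by (simp add: v_def scaleR scaleC_scaleR scaleR_diff_right)
    then have "norm (J v - z *\<^sub>C v) = norm (J w - z *\<^sub>C w) / norm w" by simp
    also have "\<dots> \<le> d j" using w(1,3) by (simp add: field_simps)
    finally have "norm (J v - z *\<^sub>C v) \<le> d j" .
    moreover have "norm v = 1" "supported {n<..n + k} v"
      using w by (auto simp: v_def supported_def)
    ultimately show ?thesis using nw by blast
  qed
  then obtain n w where n: "\<And>j. N + j \<le> n j" "\<And>j. 1 \<le> n j" and an: "\<And>j. a (n j) \<le> d j" "\<And>j. a (n j + k) \<le> d j"
    and w: "\<And>j. norm (w j) = 1" "\<And>j. supported {n j<..n j + k} (w j)" "\<And>j. norm (J (w j) - z *\<^sub>C w j) \<le> d j"
    by metis
  have coupling: "e / 12 \<le> a (n j + m)" if m: "m \<in> {1..<k}" for m j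
  proof (rule coupling_lower_bound[OF e n(2) m _ w(2)])
    show "w j \<noteq> 0" using w(1)[of j] by auto
    show "norm (J (w j) - z *\<^sub>C w j) \<le> e / 3 * norm (w j)"
      using w(1,3)[of j] d(2)[of j] by simp
    have ae: "a (n j) \<le> e" "a (n j + k) \<le> e" using an[of j] d(2)[of j] e by linarith+
    show "e * norm v \<le> norm (J v - z *\<^sub>C v)" if "supported {n j<..n j + m} v" "a (n j + m) \<le> e" for v
      using block[of m "n j" v] that m n(1)[of j] ae by simp
    show "e * norm v \<le> norm (J v - z *\<^sub>C v)" if "supported {n j + m<..n j + k} v" "a (n j + m) \<le> e" for v
      using block[of "k - m" "n j + m" v] that m n(1)[of j] ae by simp
  qed
  have d0: "d \<longlonglongrightarrow> 0"
    unfolding d_def using tendsto_mult_right_zero[OF LIMSEQ_Suc[OF lim_1_over_n], of "e / 3"] by simp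
  obtain A where A: "\<And>n. 1 \<le> n \<Longrightarrow> \<bar>a n\<bar> \<le> A" "\<And>n. 1 \<le> n \<Longrightarrow> \<bar>b n\<bar> \<le> A"
    by (rule bounded_parametersE[OF bounded_parameters]) blast
  \<comment> \<open>Both parameters and the coordinate are bundled, so that a single subsequence
    serves all three.\<close>
  have bdd: "bounded (range (\<lambda>j. (a (n j + m), b (n j + m), Rep_ell2 (w j) (n j + m))))" for m
    unfolding bounded_iff
  proof (intro exI ballI)
    fix y assume "y \<in> range (\<lambda>j. (a (n j + m), b (n j + m), Rep_ell2 (w j) (n j + m)))"
    then obtain j where y: "y = (a (n j + m), b (n j + m), Rep_ell2 (w j) (n j + m))" by blast
    have "norm y \<le> norm (a (n j + m)) + norm (b (n j + m), Rep_ell2 (w j) (n j + m))"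
      unfolding y by (rule norm_Pair_le)
    also have "norm (b (n j + m), Rep_ell2 (w j) (n j + m)) \<le> norm (b (n j + m)) + cmod (Rep_ell2 (w j) (n j + m))"
      by (rule norm_Pair_le)
    also have "cmod (Rep_ell2 (w j) (n j + m)) \<le> 1"
      using cmod_Rep_ell2_le[of "w j" "n j + m"] w(1)[of j] by simp
    finally show "norm y \<le> A + (A + 1)"
      using A[of "n j + m"] n(2)[of j] by simp
  qed
  obtain r where r: "strict_mono r" and
    conv: "\<forall>m\<in>{..Suc k}. convergent (\<lambda>j. (a (n (r j) + m), b (n (r j) + m), Rep_ell2 (w (r j)) (n (r j) + m)))"
    using convergent_coords_subseq[of "{..Suc k}" "\<lambda>j m. (a (n j + m), b (n j + m), Rep_ell2 (w j) (n j + m))"] bdd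
    by auto
  then have "\<forall>m\<in>{..Suc k}. \<exists>L. (\<lambda>j. (a (n (r j) + m), b (n (r j) + m), Rep_ell2 (w (r j)) (n (r j) + m))) \<longlonglongrightarrow> L"
    by (simp add: convergent_def)
  from bchoice[OF this] obtain L where L: "\<forall>m\<in>{..Suc k}.
      (\<lambda>j. (a (n (r j) + m), b (n (r j) + m), Rep_ell2 (w (r j)) (n (r j) + m))) \<longlonglongrightarrow> L m" ..
  \<comment> \<open>\<open>L\<close> is meaningful up to index \<open>Suc k\<close> only;
    \<open>W\<close> needs the value \<open>0\<close> beyond it to be an eigensequence in the sense
    of \<open>eigenvalue_tridiagonal_iff\<close>.\<close>
  define c B W where "c m = fst (L m)" and "B m = fst (snd (L m))"
    and "W m = (if m \<le> Suc k then snd (snd (L m)) else 0)" for m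
  define p where "p j = n (r j)" for j
  define v where "v j = w (r j)" for j
  have lim: "(\<lambda>j. a (p j + m)) \<longlonglongrightarrow> c m" "(\<lambda>j. b (p j + m)) \<longlonglongrightarrow> B m"
    "(\<lambda>j. Rep_ell2 (v j) (p j + m)) \<longlonglongrightarrow> W m" if "m \<le> Suc k" for m
  proof -
    from that have "m \<in> {..Suc k}" by simp
    note Lm = bspec[OF L this]
    show "(\<lambda>j. a (p j + m)) \<longlonglongrightarrow> c m" "(\<lambda>j. b (p j + m)) \<longlonglongrightarrow> B m"
      "(\<lambda>j. Rep_ell2 (v j) (p j + m)) \<longlonglongrightarrow> W m"
      using tendsto_fst[OF Lm] tendsto_fst[OF tendsto_snd[OF Lm]] tendsto_snd[OF tendsto_snd[OF Lm]] that
      unfolding c_def B_def W_def p_def v_def by simp_all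
  qed
  have dr: "(\<lambda>j. d (r j)) \<longlonglongrightarrow> 0"
    using LIMSEQ_subseq_LIMSEQ[OF d0 r] by (simp add: o_def)
  have p1: "1 \<le> p j" for j using n(2) by (simp add: p_def)
  have v_supp: "Rep_ell2 (v j) i = 0" if "i \<le> p j \<or> p j + k < i" for i j
    using supportedD[OF w(2)[of "r j"], of i] that by (auto simp: v_def p_def)
  have a0: "(\<lambda>j. a (p j)) \<longlonglongrightarrow> 0"
  proof (rule Lim_null_comparison[OF always_eventually dr], rule allI)
    show "norm (a (p j)) \<le> d (r j)" for j
      using an(1)[of "r j"] a_pos[OF p1[of j]] by (simp add: p_def)
  qed
  have ak: "(\<lambda>j. a (p j + k)) \<longlonglongrightarrow> 0"
  proof (rule Lim_null_comparison[OF always_eventually dr], rule allI)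
    show "norm (a (p j + k)) \<le> d (r j)" for j
      using an(2)[of "r j"] a_pos[of "p j + k"] p1[of j] by (simp add: p_def)
  qed
  have cm: "c m \<noteq> 0" if "m \<in> {1..<k}" for m
  proof -
    have "e / 12 \<le> c m"
    proof (rule LIMSEQ_le_const)
      show "(\<lambda>j. a (p j + m)) \<longlonglongrightarrow> c m" using that by (intro lim) auto
      show "\<exists>M. \<forall>j\<ge>M. e / 12 \<le> a (p j + m)" using coupling[OF that] by (simp add: p_def)
    qed
    then show ?thesis using e by auto
  qed
  have p_top: "filterlim p at_top sequentially"
  proof (rule filterlim_at_top_mono[OF filterlim_ident], rule always_eventually, rule allI)
    fix j
    show "j \<le> p j" using seq_suble[OF r, of j] n(1)[of "r j"] by (simp add: p_def)
  qed
  have W0: "W 0 = 0" "W (Suc k) = 0"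
    using lim(3)[of 0] lim(3)[of "Suc k"] by (simp_all add: v_supp LIMSEQ_const_iff)
  have Wk: "W m = 0" if "k < m" for m
    using that W0(2) by (cases "m = Suc k") (auto simp: W_def)
  have W_norm: "(\<Sum>m\<le>k. (cmod (W m))\<^sup>2) = 1"
  proof (rule LIMSEQ_unique)
    show "(\<lambda>j. \<Sum>m\<le>k. (cmod (Rep_ell2 (v j) (p j + m)))\<^sup>2) \<longlonglongrightarrow> (\<Sum>m\<le>k. (cmod (W m))\<^sup>2)"
      by (intro tendsto_sum tendsto_power tendsto_norm lim) auto
    have "(\<Sum>m\<le>k. (cmod (Rep_ell2 (v j) (p j + m)))\<^sup>2) = 1" for j
    proof -
      have "(norm (v j))\<^sup>2 = (\<Sum>m\<le>k. (cmod (Rep_ell2 (v j) (p j + m)))\<^sup>2)"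
        by (rule norm_ell2_window, rule v_supp) linarith
      then show ?thesis using w(1)[of "r j"] by (simp add: v_def)
    qed
    then show "(\<lambda>j. \<Sum>m\<le>k. (cmod (Rep_ell2 (v j) (p j + m)))\<^sup>2) \<longlonglongrightarrow> 1" by simp
  qed
  have W_nz: "\<exists>m. W m \<noteq> 0"
  proof (rule ccontr)
    assume "\<not> ?thesis"
    then have "W m = 0" for m by blast
    with W_norm show False by simp
  qed
  have eig: "jacobi_seq c B W m = z * W m" if m: "m \<in> {1..k}" for m
  proof -
    define f where "f j = complex_of_real (a (p j + (m - 1))) * Rep_ell2 (v j) (p j + (m - 1))
      + complex_of_real (b (p j + m)) * Rep_ell2 (v j) (p j + m)
      + complex_of_real (a (p j + m)) * Rep_ell2 (v j) (p j + (m + 1)) - z * Rep_ell2 (v j) (p j + m)" for j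
    have "f j = Rep_ell2 (J (v j) - z *\<^sub>C v j) (p j + m)" for j
      using m by (simp add: f_def Rep_J)
    then have "norm (f j) \<le> d (r j)" for j
      using cmod_Rep_ell2_le[of "J (v j) - z *\<^sub>C v j" "p j + m"] w(3)[of "r j"]
      unfolding v_def by (metis order_trans)
    then have "f \<longlonglongrightarrow> 0"
      by (intro Lim_null_comparison[OF always_eventually dr]) auto
    moreover have "f \<longlonglongrightarrow> complex_of_real (c (m - 1)) * W (m - 1) + complex_of_real (B m) * W m
        + complex_of_real (c m) * W (m + 1) - z * W m"
      unfolding f_def using m by (intro tendsto_intros lim) auto
    ultimately have "complex_of_real (c (m - 1)) * W (m - 1) + complex_of_real (B m) * W m
        + complex_of_real (c m) * W (m + 1) - z * W m = 0"
      using LIMSEQ_unique by blast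
    then show ?thesis using m by (simp add: jacobi_seq_def)
  qed
  have "eigenvalue (tridiagonal k c B) z"
    unfolding eigenvalue_tridiagonal_iff using W0 Wk W_nz eig by blast
  moreover have "limit_matrix a b k (tridiagonal k c B)"
    unfolding limit_matrix_def
    by (intro exI[of _ p] exI[of _ c] exI[of _ B] conjI allI ballI p1 p_top a0 ak lim cm refl) auto
  ultimately show ?thesis by blast
qed

lemma singular_imp_limit_eigenvalue:
  assumes prod: "(\<lambda>n. \<Prod>i<l. a (n + i)) \<longlonglongrightarrow> 0" and sing: "singular J z"
  shows "\<exists>k\<in>{1..l}. \<exists>M. limit_matrix a b k M \<and> eigenvalue M z"
proof -
  obtain k where k: "k \<in> {1..l}" "localized z k"
    using singular_imp_localized[OF prod sing] by blast
  define k0 where "k0 = (LEAST k. localized z k)"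
  have "localized z k0" "k0 \<le> k"
    unfolding k0_def by (rule LeastI[of "localized z", OF k(2)], rule Least_le[of "localized z", OF k(2)])
  moreover have "k0 \<noteq> 0" using \<open>localized z k0\<close> not_localized_0 by metis
  moreover have "\<exists>M. limit_matrix a b k0 M \<and> eigenvalue M z"
  proof (rule localized_minimal_limit_matrix[OF \<open>localized z k0\<close>])
    show "\<not> localized z k'" if "k' < k0" for k'
      using that unfolding k0_def by (rule not_less_Least)
  qed
  ultimately show ?thesis using k(1) by (intro bexI[of _ k0]) auto
qed

end

section \<open>Polynomials in a Jacobi operator\<close>

context jacobi_op
begin

text \<open>Horner's scheme for \<open>p(J)\<close> applied to \<open>u\<close>.\<close>

definition polyop :: "complex poly \<Rightarrow> ell2 \<Rightarrow> ell2" where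
  "polyop p u = fold_coeffs (\<lambda>c w. c *\<^sub>C u + J w) p 0"

lemma polyop_0 [simp]: "polyop 0 u = 0"
  by (simp add: polyop_def)

lemma polyop_pCons [simp]: "polyop (pCons c p) u = c *\<^sub>C u + J (polyop p u)"
proof (cases "p = 0 \<and> c = 0")
  case True
  have "0 *\<^sub>C u = 0" by (rule ell2_eqI) simp
  with True show ?thesis by (simp add: zero)
next
  case False
  then have "fold_coeffs (\<lambda>c w. c *\<^sub>C u + J w) (pCons c p) 0 = c *\<^sub>C u + J (fold_coeffs (\<lambda>c w. c *\<^sub>C u + J w) p 0)"
    by (cases "p = 0") (simp_all add: fold_coeffs_pCons_not_0_0_eq fold_coeffs_pCons_coeff_not_0_eq)
  then show ?thesis by (simp add: polyop_def)
qed

lemma polyop_add: "polyop (p + q) u = polyop p u + polyop q u"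
proof (induction p q rule: poly_induct2)
  case (pCons c p d q)
  have "(c + d) *\<^sub>C u = c *\<^sub>C u + d *\<^sub>C u" by (rule ell2_eqI) (simp add: algebra_simps)
  then show ?case by (simp add: pCons add)
qed simp

lemma polyop_smult: "polyop (Polynomial.smult c p) u = c *\<^sub>C polyop p u"
proof (induction p)
  case 0
  have "c *\<^sub>C 0 = 0" by (rule ell2_eqI) simp
  then show ?case by simp
next
  case (pCons d p)
  then show ?case by (intro ell2_eqI) (simp add: scaleC algebra_simps)
qed

lemma polyop_mult: "polyop (p * q) u = polyop p (polyop q u)"
proof (induction p)
  case (pCons c p)
  have "0 *\<^sub>C u = 0" by (rule ell2_eqI) simp
  then show ?case by (simp add: polyop_add polyop_smult pCons)
qed simp

lemma polyop_bounded: "\<exists>K. \<forall>u. norm (polyop p u) \<le> K * norm u"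
proof (induction p)
  case 0
  show ?case by (rule exI[of _ 0]) simp
next
  case (pCons c p)
  then obtain K where K: "\<And>u. norm (polyop p u) \<le> K * norm u" by blast
  obtain A where A: "A > 0" "\<And>u. norm (J u) \<le> A * norm u"
    by (rule pos_boundE) blast
  have "norm (polyop (pCons c p) u) \<le> (cmod c + A * K) * norm u" for u
  proof -
    have "norm (polyop (pCons c p) u) \<le> norm (c *\<^sub>C u) + norm (J (polyop p u))"
      unfolding polyop_pCons by (rule norm_triangle_ineq)
    also have "norm (J (polyop p u)) \<le> A * norm (polyop p u)" by (rule A)
    also have "A * norm (polyop p u) \<le> A * (K * norm u)"
      using A(1) K by (intro mult_left_mono) auto
    finally show ?thesis by (simp add: norm_scaleC algebra_simps)
  qed
  then show ?case by blast
qed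

lemma polyop_J: "polyop p (J u) = J (polyop p u)"
  by (induction p) (simp_all add: zero add scaleC)

lemma polyop_symmetric:
  assumes "\<And>i. coeff p i \<in> \<real>"
  shows "inner (polyop p u) v = inner u (polyop p v)"
  using assms
proof (induction p arbitrary: u v)
  case (pCons c p)
  have "c \<in> \<real>" using pCons.prems[of 0] by simp
  then have "inner (c *\<^sub>C u) v = inner u (c *\<^sub>C v)"
    by (simp add: inner_scaleC_left Reals_cnj_iff)
  moreover have "coeff p i \<in> \<real>" for i using pCons.prems[of "Suc i"] by simp
  then have "inner (J (polyop p u)) v = inner u (J (polyop p v))"
    using pCons.IH[of u "J v"] by (simp add: symmetric polyop_J)
  ultimately show ?case by (simp add: inner_add)
qed simp

text \<open>Each application of \<open>J\<close> extends the support downwards by at most one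
  place.\<close>

lemma polyop_vanish:
  assumes "degree p \<le> d" "\<And>n. n < N + d \<Longrightarrow> Rep_ell2 u n = 0" "n < N"
  shows "Rep_ell2 (polyop p u) n = 0"
  using assms
proof (induction p arbitrary: d N n)
  case (pCons c p)
  show ?case
  proof (cases "p = 0")
    case True
    then show ?thesis using pCons.prems by (simp add: zero)
  next
    case False
    then obtain d' where d': "d = Suc d'" "degree p \<le> d'"
      using pCons.prems(1) by (cases d) auto
    have "Rep_ell2 (polyop p u) m = 0" if "m < Suc N" for m
      by (rule pCons.IH[OF d'(2) _ that]) (use pCons.prems(2) d'(1) in simp)
    then show ?thesis using pCons.prems(2,3) by (simp add: Rep_J)
  qed
qed simp

text \<open>Over the complex numbers \<open>q\<close> splits into linear factors, and each is
  bounded below far out because its root is not singular. A linear factor may move the support down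
  by one place, hence \<open>Suc N\<close>.\<close>

lemma polyop_lower_bound:
  assumes "q \<noteq> 0" "\<And>z. poly q z = 0 \<Longrightarrow> \<not> singular J z"
  shows "\<exists>c>0. \<exists>N. \<forall>u. (\<forall>n<N. Rep_ell2 u n = 0) \<longrightarrow> c * norm u \<le> norm (polyop q u)"
  using assms
proof (induction "degree q" arbitrary: q)
  case 0
  then obtain c where c: "q = [:c:]" by (metis degree_eq_zeroE)
  with 0 have "c \<noteq> 0" by simp
  have "polyop q u = c *\<^sub>C u" for u by (simp add: c zero)
  then show ?case using \<open>c \<noteq> 0\<close> by (intro exI[of _ "cmod c"]) (auto simp: norm_scaleC)
next
  case (Suc m)
  obtain z where z: "poly q z = 0"
    using Suc.hyps(2) fundamental_theorem_of_algebra[of q] by (auto simp: constant_degree)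
  then obtain r where r: "q = [:- z, 1:] * r" by (auto simp: poly_eq_0_iff_dvd)
  have r0: "r \<noteq> 0" using Suc.prems(1) r by auto
  then have "degree q = Suc (degree r)" unfolding r by (subst degree_mult_eq) auto
  then have "m = degree r" using Suc.hyps(2) by simp
  moreover have "\<not> singular J w" if "poly r w = 0" for w
    using Suc.prems(2)[of w] that r by simp
  ultimately obtain c N where c: "c > 0"
      "\<And>u. (\<forall>n<N. Rep_ell2 u n = 0) \<Longrightarrow> c * norm u \<le> norm (polyop r u)"
    using Suc.hyps(1)[of r] r0 by blast
  from Suc.prems(2)[OF z] obtain e N' where e: "e > 0"
      "\<And>u. u \<noteq> 0 \<Longrightarrow> (\<forall>n<N'. Rep_ell2 u n = 0) \<Longrightarrow> \<not> norm (J u - z *\<^sub>C u) \<le> e * norm u"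
    unfolding singular_def by blast
  have "c * e * norm u \<le> norm (polyop q u)" if u: "\<forall>n<max N' (Suc N). Rep_ell2 u n = 0" for u
  proof -
    have "polyop [:- z, 1:] u = J u - z *\<^sub>C u"
      by (rule ell2_eqI) (simp add: zero Rep_J)
    moreover have "polyop q u = polyop r (polyop [:- z, 1:] u)"
      unfolding r mult.commute[of "[:- z, 1:]"] by (rule polyop_mult)
    ultimately have eq: "polyop q u = polyop r (J u - z *\<^sub>C u)" by simp
    have "e * norm u \<le> norm (J u - z *\<^sub>C u)"
      using e(2)[of u] u by (cases "u = 0") (auto simp: not_le less_imp_le)
    then have "c * (e * norm u) \<le> c * norm (J u - z *\<^sub>C u)"
      using c(1) by (intro mult_left_mono) auto
    also have "\<dots> \<le> norm (polyop q u)"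
      unfolding eq by (rule c(2)) (use u in \<open>simp add: Rep_J\<close>)
    finally show ?thesis by (simp add: mult.assoc)
  qed
  then show ?case using c(1) e(1) by (intro exI[of _ "c * e"] conjI exI[of _ "max N' (Suc N)"]) auto
qed

text \<open>Let \<open>m\<close> be the asymptotic norm of \<open>p(J)\<close> on vectors supported far out. Vectors that nearly
  attain it are nearly annihilated by \<open>p(J)\<^sup>2 - m\<^sup>2\<close>, so \<open>p\<^sup>2 = m\<^sup>2\<close> at some singular point.\<close>

lemma polyop_small_at_infinity:
  assumes real: "\<And>i. coeff p i \<in> \<real>" and deg: "degree p > 0"
    and roots: "\<And>z. singular J z \<Longrightarrow> poly p z = 0" and e: "e > 0"
  shows "\<exists>N. \<forall>u. (\<forall>n<N. Rep_ell2 u n = 0) \<longrightarrow> norm (polyop p u) \<le> e * norm u"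
proof -
  define S where "S = {s. 0 \<le> s \<and> (\<exists>N. \<forall>u. (\<forall>n<N. Rep_ell2 u n = 0) \<longrightarrow> norm (polyop p u) \<le> s * norm u)}"
  define m where "m = Inf S"
  obtain K where K: "\<And>u. norm (polyop p u) \<le> K * norm u" using polyop_bounded by blast
  have "norm (polyop p u) \<le> max K 0 * norm u" for u
    using K[of u] mult_right_mono[of K "max K 0" "norm u"] by simp
  then have "max K 0 \<in> S" by (auto simp: S_def)
  then have ne: "S \<noteq> {}" by blast
  have bdd: "bdd_below S" by (auto simp: S_def bdd_below_def)
  have m0: "0 \<le> m" unfolding m_def using ne by (intro cInf_greatest) (auto simp: S_def)
  have "m = 0"
  proof (rule ccontr)
    assume "m \<noteq> 0"
    with m0 have m: "m > 0" by simp
    \<comment> \<open>At a root of \<open>q\<close> the polynomial \<open>p\<close> takes the value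
      \<open>m\<close> or \<open>- m\<close>, hence not \<open>0\<close>, so the root is not
      singular.\<close>
    define q where "q = p * p - [:complex_of_real (m\<^sup>2):]"
    have "poly q z = 0 \<Longrightarrow> \<not> singular J z" for z
      using roots[of z] m by (auto simp: q_def)
    moreover have "q \<noteq> 0"
    proof
      assume "q = 0"
      then have "p * p = [:complex_of_real (m\<^sup>2):]" by (simp add: q_def)
      then have "degree (p * p) = 0" by (simp only: degree_pCons_0)
      moreover have "p \<noteq> 0" using deg by auto
      ultimately show False using deg by (simp add: degree_mult_eq)
    qed
    ultimately obtain c N0 where c: "c > 0"
        "\<And>u. (\<forall>n<N0. Rep_ell2 u n = 0) \<Longrightarrow> c * norm u \<le> norm (polyop q u)"
      using polyop_lower_bound[of q] by blast
    \<comment> \<open>The bound \<open>m / 4\<close> gives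
      \<open>(m + h)\<^sup>2 \<le> 2 * m\<^sup>2\<close> and \<open>0 \<le> m - h\<close>; the other
      one gives \<open>5 * m ^ 3 * h \<le> c\<^sup>2 / 2\<close>, half of the lower bound for
      \<open>polyop q\<close>.\<close>
    define h where "h = min (m / 4) (c\<^sup>2 / (10 * m ^ 3))"
    have h: "h > 0" "h \<le> m / 4" "h \<le> c\<^sup>2 / (10 * m ^ 3)" using m c(1) by (auto simp: h_def)
    obtain s where s: "s \<in> S" "s < m + h"
      using cInf_lessD[OF ne, of "m + h"] h(1) unfolding m_def by auto
    then obtain N1 where N1: "0 \<le> s" "\<And>u. (\<forall>n<N1. Rep_ell2 u n = 0) \<Longrightarrow> norm (polyop p u) \<le> s * norm u"
      unfolding S_def by blast
    \<comment> \<open>The margin \<open>degree p\<close> lets the bound \<open>s\<close> be used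
      twice, on \<open>u\<close> and on \<open>polyop p u\<close>.\<close>
    define N where "N = max N0 (N1 + degree p)"
    have "m - h \<notin> S" using cInf_lower[OF _ bdd, of "m - h"] h(1) unfolding m_def by auto
    moreover have mh: "0 \<le> m - h" using h(2) m by linarith
    ultimately obtain u where u: "\<forall>n<N. Rep_ell2 u n = 0" "\<not> norm (polyop p u) \<le> (m - h) * norm u"
      unfolding S_def by blast
    then have u0: "u \<noteq> 0" using polyop_vanish[of p "degree p"] K[of 0] by auto
    define g where "g = norm (polyop p u)"
    have g: "(m - h) * norm u \<le> g" using u(2) by (simp add: g_def)
    have "norm (polyop p (polyop p u)) \<le> s * g"
      unfolding g_def
    proof (rule N1(2), intro allI impI)
      show "Rep_ell2 (polyop p u) n = 0" if "n < N1" for n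
        by (rule polyop_vanish[OF order_refl _ that]) (use u(1) in \<open>simp add: N_def\<close>)
    qed
    also have "\<dots> \<le> (m + h) * g" using s(2) by (intro mult_right_mono) (auto simp: g_def)
    finally have Q2: "(norm (polyop p (polyop p u)))\<^sup>2 \<le> ((m + h) * g)\<^sup>2" by (intro power_mono) auto
    have eq: "polyop q u = polyop p (polyop p u) - m\<^sup>2 *\<^sub>R u"
    proof -
      have "polyop q u + m\<^sup>2 *\<^sub>R u = polyop p (polyop p u)"
        using polyop_add[of q "[:complex_of_real (m\<^sup>2):]" u]
        by (simp add: q_def zero polyop_mult scaleR_ell2_def)
      then show ?thesis by (simp add: algebra_simps)
    qed
    have "inner u (polyop p (polyop p u)) = g\<^sup>2"
      by (simp add: polyop_symmetric[OF real, symmetric] g_def power2_norm_eq_inner)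
    \<comment> \<open>The first term is at most \<open>((m + h) * g)\<^sup>2\<close>, while
      \<open>g\<close> is at least \<open>(m - h) * norm u\<close>. For \<open>h = 0\<close> all
      terms would cancel, so what remains is of order \<open>h\<close>.\<close>
    then have "(norm (polyop q u))\<^sup>2 = (norm (polyop p (polyop p u)))\<^sup>2 - 2 * m\<^sup>2 * g\<^sup>2 + m ^ 4 * (norm u)\<^sup>2"
      unfolding eq norm_diff_scaleR_square by (simp flip: power_mult)
    also have "\<dots> \<le> ((m + h) * g)\<^sup>2 - 2 * m\<^sup>2 * g\<^sup>2 + m ^ 4 * (norm u)\<^sup>2"
      using Q2 by simp
    also have "\<dots> = m ^ 4 * (norm u)\<^sup>2 - (2 * m\<^sup>2 - (m + h)\<^sup>2) * g\<^sup>2"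
      by (simp add: power2_eq_square algebra_simps)
    also have "\<dots> \<le> m ^ 4 * (norm u)\<^sup>2 - (2 * m\<^sup>2 - (m + h)\<^sup>2) * ((m - h) * norm u)\<^sup>2"
    proof -
      have "(m + h)\<^sup>2 \<le> (5 / 4 * m)\<^sup>2" using h m by (intro power_mono) auto
      also have "\<dots> \<le> 2 * m\<^sup>2" by (simp add: power2_eq_square)
      finally have "0 \<le> 2 * m\<^sup>2 - (m + h)\<^sup>2" by simp
      moreover have "((m - h) * norm u)\<^sup>2 \<le> g\<^sup>2" using g mh by (intro power_mono) auto
      ultimately show ?thesis by (simp add: mult_left_mono)
    qed
    also have "\<dots> = (4 * m ^ 3 * h - (2 * m * h)\<^sup>2 + h ^ 4) * (norm u)\<^sup>2"
      by (simp add: power2_eq_square power3_eq_cube power4_eq_xxxx algebra_simps)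
    also have "\<dots> \<le> (5 * m ^ 3 * h) * (norm u)\<^sup>2"
    proof (rule mult_right_mono)
      have "h ^ 3 \<le> m ^ 3" using h m by (intro power_mono) auto
      then have "h ^ 3 * h \<le> m ^ 3 * h" using h(1) by (intro mult_right_mono) auto
      then have "h ^ 4 \<le> m ^ 3 * h" by (simp add: power3_eq_cube power4_eq_xxxx mult.assoc)
      then show "4 * m ^ 3 * h - (2 * m * h)\<^sup>2 + h ^ 4 \<le> 5 * m ^ 3 * h"
        using zero_le_power2[of "2 * m * h"] by linarith
    qed simp
    also have "\<dots> \<le> c\<^sup>2 / 2 * (norm u)\<^sup>2"
      using h(3) m by (intro mult_right_mono) (auto simp: field_simps)
    finally have "(norm (polyop q u))\<^sup>2 \<le> c\<^sup>2 / 2 * (norm u)\<^sup>2" .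
    moreover have "(c * norm u)\<^sup>2 \<le> (norm (polyop q u))\<^sup>2"
      using c u(1) by (intro power_mono c(2)) (auto simp: N_def)
    ultimately have "c\<^sup>2 * (norm u)\<^sup>2 \<le> c\<^sup>2 / 2 * (norm u)\<^sup>2" by (simp add: power_mult_distrib)
    then show False using c(1) u0 by simp
  qed
  then obtain s where s: "s \<in> S" "s < e"
    using cInf_lessD[OF ne, of e] e unfolding m_def by auto
  then obtain N where N: "\<And>u. (\<forall>n<N. Rep_ell2 u n = 0) \<Longrightarrow> norm (polyop p u) \<le> s * norm u"
    unfolding S_def by blast
  have "norm (polyop p u) \<le> e * norm u" if "\<forall>n<N. Rep_ell2 u n = 0" for u
    using N[OF that] mult_right_mono[of s e "norm u"] s(2) by simp
  then show ?thesis by blast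
qed

text \<open>Within \<open>d\<close> steps, position \<open>n + d\<close> is reached from
  \<open>n\<close> only by going up every time, so only the coefficient of degree \<open>d\<close>
  contributes, along a single path.\<close>

lemma polyop_basis:
  assumes "1 \<le> n" "degree p \<le> d"
  shows "Rep_ell2 (polyop p (ell2_of {n} (\<lambda>_. 1))) (n + d) = coeff p d * complex_of_real (\<Prod>i<d. a (n + i))"
proof -
  let ?e = "ell2_of {n} (\<lambda>_. 1)"
  have e: "Rep_ell2 ?e m = (if m = n then 1 else 0)" for m
    using assms(1) by (auto simp: Rep_ell2_of)
  have "Rep_ell2 (polyop p ?e) (n + d) = coeff p d * complex_of_real (\<Prod>i<d. a (n + i)) \<and>
      (\<forall>m>n + d. Rep_ell2 (polyop p ?e) m = 0)"
    using assms(2)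
  proof (induction d arbitrary: p)
    case 0
    then obtain c where "p = [:c:]" by (metis degree_eq_zeroE le_zero_eq)
    then show ?case by (simp add: zero e)
  next
    case (Suc d)
    obtain c q where p: "p = pCons c q" by (rule pCons_cases)
    then have "degree q \<le> d" using Suc.prems by (cases "q = 0") auto
    then have q: "Rep_ell2 (polyop q ?e) (n + d) = coeff q d * complex_of_real (\<Prod>i<d. a (n + i))"
      "\<And>m. m > n + d \<Longrightarrow> Rep_ell2 (polyop q ?e) m = 0"
      using Suc.IH by blast+
    show ?case
      unfolding p using q by (auto simp: e Rep_J algebra_simps)
  qed
  then show ?thesis by blast
qed

lemma finite_singular_imp_product_tendsto_0:
  assumes l: "1 \<le> l" and fin: "\<And>z. singular J z \<Longrightarrow> z \<in> (\<lambda>i. complex_of_real (x i)) ` {1..l}"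
  shows "(\<lambda>n. \<Prod>i<l. a (n + i)) \<longlonglongrightarrow> 0"
proof -
  define p where "p = (\<Prod>i\<in>{1..l}. [:- complex_of_real (x i), 1:])"
  have deg: "degree p = l"
    unfolding p_def by (subst degree_prod_eq_sum_degree) auto
  have lead: "coeff p l = 1"
    using monic_prod[of "{1..l}" "\<lambda>i. [:- complex_of_real (x i), 1:]"] deg by (simp add: p_def)
  \<comment> \<open>Real coefficients make \<open>polyop p\<close> symmetric, which the extremal
    argument in \<open>polyop_small_at_infinity\<close> requires.\<close>
  have "coeff (\<Prod>i\<in>A. [:- complex_of_real (x i), 1:]) k \<in> \<real>" if "finite A" for A k
    using that
  proof (induction A arbitrary: k rule: finite_induct)
    case empty
    show ?case by (cases k) auto
  next
    case (insert i A)
    then show ?case by (cases k) auto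
  qed
  then have real: "coeff p k \<in> \<real>" for k by (simp add: p_def)
  have roots: "poly p z = 0" if "singular J z" for z
    using fin[OF that] by (auto simp: p_def poly_prod)
  have "degree p > 0" using deg l by simp
  note small = polyop_small_at_infinity[OF real this roots]
  show ?thesis
  proof (rule LIMSEQ_I)
    fix r :: real assume r: "r > 0"
    then obtain N where N: "\<And>u. (\<forall>n<N. Rep_ell2 u n = 0) \<Longrightarrow> norm (polyop p u) \<le> r / 2 * norm u"
      using small[of "r / 2"] by auto
    have "norm ((\<Prod>i<l. a (n + i)) - 0) < r" if "Suc N \<le> n" for n
    proof -
      let ?e = "ell2_of {n} (\<lambda>_. 1)"
      have "(norm ?e)\<^sup>2 = 1"
        using that by (subst norm_ell2_finite[of "{n}"]) (auto simp: Rep_ell2_of)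
      then have ne: "norm ?e = 1" using power2_eq_1_iff[of "norm ?e"] norm_ge_zero[of ?e] by linarith
      have "norm (polyop p ?e) \<le> r / 2 * norm ?e"
        by (rule N) (use that in \<open>auto simp: Rep_ell2_of\<close>)
      moreover have "cmod (Rep_ell2 (polyop p ?e) (n + l)) \<le> norm (polyop p ?e)"
        by (rule cmod_Rep_ell2_le)
      moreover have "Rep_ell2 (polyop p ?e) (n + l) = complex_of_real (\<Prod>i<l. a (n + i))"
        using polyop_basis[of n p l] that deg lead by simp
      ultimately have "\<bar>\<Prod>i<l. a (n + i)\<bar> \<le> r / 2"
        unfolding ne by (simp only: norm_of_real mult_1_right)
      then show ?thesis using r by simp
    qed
    then show "\<exists>M. \<forall>n\<ge>M. norm ((\<Prod>i<l. a (n + i)) - 0) < r" by blast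
  qed
qed

end

section \<open>Tridiagonal matrices have simple spectrum\<close>

text \<open>The orthogonal polynomials of the first kind, shifted: for nonvanishing
  \<open>c\<close>, index \<open>m + 1\<close> carries degree \<open>m\<close>, and the value
  \<open>0\<close> at index \<open>0\<close> is the boundary condition. At a fixed point they solve
  the eigenvalue recurrence with initial values \<open>0\<close> and \<open>1\<close>.\<close>

fun orth_poly :: "(nat \<Rightarrow> real) \<Rightarrow> (nat \<Rightarrow> real) \<Rightarrow> nat \<Rightarrow> complex poly" where
  "orth_poly c d 0 = 0"
| "orth_poly c d (Suc 0) = 1"
| "orth_poly c d (Suc (Suc m)) = Polynomial.smult (1 / complex_of_real (c (Suc m)))
     ([:- complex_of_real (d (Suc m)), 1:] * orth_poly c d (Suc m)
       - Polynomial.smult (complex_of_real (c m)) (orth_poly c d m))"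

lemma orth_poly_recurrence:
  assumes "c (Suc m) \<noteq> 0"
  shows "Polynomial.smult (complex_of_real (c m)) (orth_poly c d m)
    + Polynomial.smult (complex_of_real (d (Suc m))) (orth_poly c d (Suc m))
    + Polynomial.smult (complex_of_real (c (Suc m))) (orth_poly c d (Suc (Suc m)))
    = pCons 0 (orth_poly c d (Suc m))"
  using assms by simp

lemma jacobi_seq_orth_poly:
  assumes "1 \<le> m" "c m \<noteq> 0"
  shows "jacobi_seq c d (\<lambda>m. poly (orth_poly c d m) z) m = z * poly (orth_poly c d m) z"
proof -
  obtain i where i: "m = Suc i" using assms(1) by (cases m) auto
  have "poly (Polynomial.smult (complex_of_real (c i)) (orth_poly c d i)
    + Polynomial.smult (complex_of_real (d (Suc i))) (orth_poly c d (Suc i))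
    + Polynomial.smult (complex_of_real (c (Suc i))) (orth_poly c d (Suc (Suc i)))) z
    = poly (pCons 0 (orth_poly c d (Suc i))) z"
    by (subst orth_poly_recurrence) (use assms(2) i in simp_all)
  then show ?thesis unfolding i jacobi_seq_def by (simp del: orth_poly.simps)
qed

text \<open>Differentiating the recurrence in the spectral parameter produces the inhomogeneous
  term.\<close>

lemma jacobi_seq_pderiv_orth_poly:
  assumes "1 \<le> m" "c m \<noteq> 0"
  shows "jacobi_seq c d (\<lambda>m. poly (pderiv (orth_poly c d m)) z) m
    = z * poly (pderiv (orth_poly c d m)) z + poly (orth_poly c d m) z"
proof -
  obtain i where i: "m = Suc i" using assms(1) by (cases m) auto
  have "poly (pderiv (Polynomial.smult (complex_of_real (c i)) (orth_poly c d i)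
    + Polynomial.smult (complex_of_real (d (Suc i))) (orth_poly c d (Suc i))
    + Polynomial.smult (complex_of_real (c (Suc i))) (orth_poly c d (Suc (Suc i))))) z
    = poly (pderiv (pCons 0 (orth_poly c d (Suc i)))) z"
    by (subst orth_poly_recurrence) (use assms(2) i in simp_all)
  then show ?thesis unfolding i jacobi_seq_def
    by (simp add: pderiv_add pderiv_smult pderiv_pCons del: orth_poly.simps)
qed

lemma degree_orth_poly:
  assumes "\<And>m. c m \<noteq> 0"
  shows "degree (orth_poly c d (Suc m)) = m" and "orth_poly c d (Suc m) \<noteq> 0"
proof -
  have "degree (orth_poly c d (Suc m)) = m \<and> orth_poly c d (Suc m) \<noteq> 0
    \<and> degree (orth_poly c d m) \<le> m" for m
  proof (induction m)
    case (Suc m)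
    let ?p = "[:- complex_of_real (d (Suc m)), 1:] * orth_poly c d (Suc m)"
    let ?q = "Polynomial.smult (complex_of_real (c m)) (orth_poly c d m)"
    have "degree ?p = Suc m" using Suc by (subst degree_mult_eq) auto
    moreover have "degree ?q < Suc m" using Suc degree_smult_le[of _ "orth_poly c d m"] by (auto simp: less_Suc_eq_le)
    ultimately have "degree (?p - ?q) = Suc m"
      by (metis degree_add_eq_left degree_minus diff_conv_add_uminus)
    then have "degree (orth_poly c d (Suc (Suc m))) = Suc m"
      using assms[of "Suc m"] by (simp del: mult_pCons_left)
    moreover from this have "orth_poly c d (Suc (Suc m)) \<noteq> 0"
      by (metis degree_0 nat.distinct(1))
    ultimately show ?case using Suc by (simp del: orth_poly.simps)
  qed simp
  then show "degree (orth_poly c d (Suc m)) = m" "orth_poly c d (Suc m) \<noteq> 0" by blast+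
qed

text \<open>Green's formula; it yields both the reality (taking for \<open>q\<close> the conjugate of \<open>p\<close>) and the
  simplicity (taking for \<open>q\<close> the derivative) of the zeros of \<open>orth_poly\<close>.\<close>

lemma jacobi_seq_green:
  fixes p q r :: "nat \<Rightarrow> complex"
  assumes "p 0 = 0" "q 0 = 0"
    and "\<And>m. m \<in> {1..k} \<Longrightarrow> jacobi_seq c d p m = z * p m"
    and "\<And>m. m \<in> {1..k} \<Longrightarrow> jacobi_seq c d q m = y * q m + r m"
  shows "complex_of_real (c k) * (q (Suc k) * p k - q k * p (Suc k))
    = (\<Sum>m\<in>{1..k}. ((y - z) * q m + r m) * p m)"
  using assms(3,4)
proof (induction k)
  case 0
  then show ?case using assms(1,2) by simp
next
  case (Suc k)
  let ?a = "complex_of_real (c k)" and ?b = "complex_of_real (d (Suc k))"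
    and ?c = "complex_of_real (c (Suc k))"
  have p: "?c * p (Suc (Suc k)) = z * p (Suc k) - ?a * p k - ?b * p (Suc k)"
    and q: "?c * q (Suc (Suc k)) = y * q (Suc k) + r (Suc k) - ?a * q k - ?b * q (Suc k)"
    using Suc.prems(1)[of "Suc k"] Suc.prems(2)[of "Suc k"]
    by (simp_all add: jacobi_seq_def algebra_simps)
  have "?c * (q (Suc (Suc k)) * p (Suc k) - q (Suc k) * p (Suc (Suc k)))
      = (?c * q (Suc (Suc k))) * p (Suc k) - q (Suc k) * (?c * p (Suc (Suc k)))"
    by (simp add: algebra_simps)
  also have "\<dots> = ?a * (q (Suc k) * p k - q k * p (Suc k))
      + ((y - z) * q (Suc k) + r (Suc k)) * p (Suc k)"
    unfolding p q by (simp add: algebra_simps)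
  also have "?a * (q (Suc k) * p k - q k * p (Suc k)) = (\<Sum>m\<in>{1..k}. ((y - z) * q m + r m) * p m)"
    by (rule Suc.IH) (use Suc.prems in simp_all)
  finally show ?case by simp
qed

lemma cnj_jacobi_seq: "jacobi_seq c d (\<lambda>m. cnj (w m)) m = cnj (jacobi_seq c d w m)"
  by (simp add: jacobi_seq_def)

text \<open>A zero of both the polynomial and its derivative makes the left side of Green's formula
  vanish in both applications. The right sides are \<open>(cnj z - z) * S\<close> and
  \<open>S\<close>, where \<open>S\<close> is positive because the polynomial at index
  \<open>1\<close> is \<open>1\<close>. Reality of \<open>z\<close> comes first, since the
  conjugated sequence belongs to \<open>cnj z\<close>.\<close>

lemma rsquarefree_orth_poly:
  assumes c: "\<And>m. c m \<noteq> 0" and k: "1 \<le> k"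
  shows "rsquarefree (orth_poly c d (Suc k))"
  unfolding rsquarefree_roots
proof (intro allI notI, elim conjE)
  fix z
  let ?p = "\<lambda>m. poly (orth_poly c d m) z" and ?q = "\<lambda>m. poly (pderiv (orth_poly c d m)) z"
  assume p0: "?p (Suc k) = 0" and q0: "?q (Suc k) = 0"
  have p: "jacobi_seq c d ?p m = z * ?p m" if "1 \<le> m" for m
    by (rule jacobi_seq_orth_poly[OF that c])
  have q: "jacobi_seq c d ?q m = z * ?q m + ?p m" if "1 \<le> m" for m
    by (rule jacobi_seq_pderiv_orth_poly[OF that c])
  have pc: "jacobi_seq c d (\<lambda>m. cnj (?p m)) m = cnj z * cnj (?p m)" if "1 \<le> m" for m
    by (simp add: cnj_jacobi_seq p[OF that])
  define S where "S = (\<Sum>m\<in>{1..k}. cnj (?p m) * ?p m)"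
  have "S = complex_of_real (\<Sum>m\<in>{1..k}. (cmod (?p m))\<^sup>2)"
    unfolding S_def of_real_sum by (intro sum.cong refl) (simp only: complex_norm_square mult.commute)
  moreover have "0 < (\<Sum>m\<in>{1..k}. (cmod (?p m))\<^sup>2)"
    using k by (intro sum_pos2[of _ 1]) auto
  ultimately have S: "S \<noteq> 0" by (metis of_real_eq_0_iff less_irrefl)
  have "complex_of_real (c k) * (cnj (?p (Suc k)) * ?p k - cnj (?p k) * ?p (Suc k))
      = (\<Sum>m\<in>{1..k}. ((cnj z - z) * cnj (?p m) + 0) * ?p m)"
    by (rule jacobi_seq_green[where d = d]) (use p pc in simp_all)
  also have "\<dots> = (cnj z - z) * S"
    unfolding S_def sum_distrib_left by (intro sum.cong) (simp_all add: mult.assoc)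
  finally have z: "cnj z = z" using p0 S by simp
  have "complex_of_real (c k) * (?q (Suc k) * cnj (?p k) - ?q k * cnj (?p (Suc k)))
      = (\<Sum>m\<in>{1..k}. ((z - z) * ?q m + ?p m) * cnj (?p m))"
    by (rule jacobi_seq_green[where d = d]) (use pc q z in simp_all)
  also have "\<dots> = S" unfolding S_def by (intro sum.cong) (simp_all add: mult.commute)
  finally show False using p0 q0 S by simp
qed

text \<open>Shooting from the left end: the recurrence and \<open>w 0 = 0\<close> force
  \<open>w\<close> to be a multiple of the polynomial values, and the boundary condition at
  \<open>k + 1\<close> singles out the zeros.\<close>

lemma eigenvalue_tridiagonal_orth_poly:
  assumes c: "\<And>m. c m \<noteq> 0" and k: "1 \<le> k"
  shows "eigenvalue (tridiagonal k c d) z \<longleftrightarrow> poly (orth_poly c d (Suc k)) z = 0"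
proof
  let ?p = "\<lambda>m. poly (orth_poly c d m) z"
  have p: "jacobi_seq c d ?p m = z * ?p m" if "1 \<le> m" for m
    by (rule jacobi_seq_orth_poly[OF that c])
  {
    assume "eigenvalue (tridiagonal k c d) z"
    then obtain w m0 where w: "w 0 = 0" "\<And>m. k < m \<Longrightarrow> w m = 0" "w m0 \<noteq> 0"
      "\<And>m. m \<in> {1..k} \<Longrightarrow> jacobi_seq c d w m = z * w m"
      unfolding eigenvalue_tridiagonal_iff by blast
    have eq: "w m = w 1 * ?p m \<and> w (Suc m) = w 1 * ?p (Suc m)" if "m \<le> k" for m
      using that
    proof (induction m)
      case 0
      then show ?case using w(1) by simp
    next
      case (Suc m)
      let ?a = "complex_of_real (c m)" and ?b = "complex_of_real (d (Suc m))"
        and ?c = "complex_of_real (c (Suc m))"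
      have IH: "w m = w 1 * ?p m" "w (Suc m) = w 1 * ?p (Suc m)" using Suc by auto
      have "?c * w (Suc (Suc m)) = z * w (Suc m) - ?a * w m - ?b * w (Suc m)"
        using w(4)[of "Suc m"] Suc.prems by (simp add: jacobi_seq_def algebra_simps)
      also have "\<dots> = w 1 * (z * ?p (Suc m) - ?a * ?p m - ?b * ?p (Suc m))"
        unfolding IH by (simp add: algebra_simps)
      also have "z * ?p (Suc m) - ?a * ?p m - ?b * ?p (Suc m) = ?c * ?p (Suc (Suc m))"
        using p[of "Suc m"] by (simp add: jacobi_seq_def algebra_simps del: orth_poly.simps)
      finally have "?c * w (Suc (Suc m)) = ?c * (w 1 * ?p (Suc (Suc m)))"
        by (simp only: mult.left_commute)
      then have "w (Suc (Suc m)) = w 1 * ?p (Suc (Suc m))"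
        using c[of "Suc m"] by (simp only: mult_cancel_left of_real_eq_0_iff simp_thms)
      with IH show ?case by blast
    qed
    have "m0 \<le> k" using w(2)[of m0] w(3) by (meson not_le)
    then have "w 1 \<noteq> 0" using eq[of m0] w(3) by auto
    moreover have "w 1 * ?p (Suc k) = 0" using eq[of k] w(2)[of "Suc k"] by simp
    ultimately show "?p (Suc k) = 0" by simp
  next
    assume 0: "?p (Suc k) = 0"
    define w where "w m = (if m \<le> k then ?p m else 0)" for m
    have w_Suc: "w m = ?p m" if "m \<le> Suc k" for m
      using that 0 by (cases "m = Suc k") (auto simp: w_def)
    have "jacobi_seq c d w m = z * w m" if m: "m \<in> {1..k}" for m
    proof -
      have "m \<le> Suc k" "m - 1 \<le> Suc k" "m + 1 \<le> Suc k" using m by auto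
      from this[THEN w_Suc] show ?thesis
        using p[of m] m unfolding jacobi_seq_def by (simp only: atLeastAtMost_iff)
    qed
    moreover have "w 0 = 0" "w 1 \<noteq> 0" "\<forall>m>k. w m = 0"
      using k by (simp_all add: w_def)
    ultimately show "eigenvalue (tridiagonal k c d) z"
      unfolding eigenvalue_tridiagonal_iff by blast
  }
qed

lemma card_spectrum_tridiagonal:
  assumes k: "1 \<le> k" and c: "\<And>m. m \<in> {1..<k} \<Longrightarrow> c m \<noteq> 0"
  shows "card (spectrum (tridiagonal k c d)) = k"
proof -
  \<comment> \<open>\<open>orth_poly\<close> divides by further entries of \<open>c\<close>, in
    particular by \<open>c k\<close>; the matrix does not see them, so they may be set to
    \<open>1\<close>.\<close>
  define c' where "c' m = (if m \<in> {1..<k} then c m else 1)" for m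
  have c': "c' m \<noteq> 0" for m using c by (simp add: c'_def)
  have "tridiagonal k c d = tridiagonal k c' d"
    by (intro eq_matI) (auto simp: tridiagonal_def c'_def)
  then have "eigenvalue (tridiagonal k c d) z \<longleftrightarrow> poly (orth_poly c' d (Suc k)) z = 0" for z
    by (simp only: eigenvalue_tridiagonal_orth_poly[of c' k, OF c' k])
  then have spec: "spectrum (tridiagonal k c d) = {z. poly (orth_poly c' d (Suc k)) z = 0}"
    unfolding spectrum_def by blast
  let ?p = "orth_poly c' d (Suc k)"
  have p0: "?p \<noteq> 0" and deg: "degree ?p = k" by (rule degree_orth_poly[OF c'])+
  have "finite {z. poly ?p z = 0}" using p0 by (rule poly_roots_finite)
  \<comment> \<open>A polynomial without repeated roots is a constant times the product over its
    distinct zeros, so its degree counts them.\<close>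
  moreover have "?p = Polynomial.smult (lead_coeff ?p) (\<Prod>z|poly ?p z = 0. [:- z, 1:])"
    using complex_poly_decompose_rsquarefree[OF rsquarefree_orth_poly[OF c' k]] by simp
  then have "degree ?p = degree (\<Prod>z|poly ?p z = 0. [:- z, 1:])"
    using p0 by (metis degree_smult_eq leading_coeff_0_iff)
  then have "degree ?p = card {z. poly ?p z = 0}"
    by (simp add: degree_prod_eq_sum_degree del: orth_poly.simps)
  ultimately show ?thesis using deg spec by simp
qed

theorem theorem7p4:
  fixes a b x :: "nat \<Rightarrow> real" and l :: nat
  assumes l_pos: "1 \<le> l"
    and x_distinct: "inj_on x {1..l}"
    and a_pos: "\<And>n. 1 \<le> n \<Longrightarrow> 0 < a n"
    and bounded: "bounded_parameters a b"
  shows "essential_spectrum (jacobi a b) = (\<lambda>i. complex_of_real (x i)) ` {1..l} \<longleftrightarrow>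
    (\<lambda>n. \<Prod>i<l. a (n + i)) \<longlonglongrightarrow> 0 \<and>
    (\<forall>k\<in>{1..l}. \<forall>M. limit_matrix a b k M \<longrightarrow>
       spectrum M \<subseteq> (\<lambda>i. complex_of_real (x i)) ` {1..l} \<and> card (spectrum M) = k) \<and>
    (\<forall>j\<in>{1..l}. \<exists>k\<in>{1..l}. \<exists>M. limit_matrix a b k M \<and>
       eigenvalue M (complex_of_real (x j)))"
    (is "?E = ?X \<longleftrightarrow> ?i \<and> ?ii \<and> ?iii")
proof -
  interpret positive_jacobi_op a b
    by standard (use a_pos bounded in auto)
  have sing: "z \<in> ?E \<longleftrightarrow> singular (jacobi a b) z" for z
    by (rule essential_spectrum_iff)
  show ?thesis
  proof
    assume E: "?E = ?X"
    have prod: ?i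
      by (rule finite_singular_imp_product_tendsto_0[OF l_pos, of x]) (use sing E in blast)
    moreover have ?ii
    proof (intro ballI allI impI conjI)
      fix k M
      assume k: "k \<in> {1..l}" and M: "limit_matrix a b k M"
      show "spectrum M \<subseteq> ?X"
        using limit_matrix_eigenvalue_singular[OF M] sing E by (auto simp: spectrum_def)
      from M obtain c d where "\<forall>m\<in>{1..<k}. c m \<noteq> 0" "M = tridiagonal k c d"
        unfolding limit_matrix_def by blast
      with k show "card (spectrum M) = k"
        using card_spectrum_tridiagonal[of k c d] by simp
    qed
    moreover have ?iii
    proof
      fix j assume "j \<in> {1..l}"
      then have "singular (jacobi a b) (complex_of_real (x j))" using sing E by blast
      then show "\<exists>k\<in>{1..l}. \<exists>M. limit_matrix a b k M \<and> eigenvalue M (complex_of_real (x j))"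
        by (rule singular_imp_limit_eigenvalue[OF prod])
    qed
    ultimately show "?i \<and> ?ii \<and> ?iii" by blast
  next
    assume conds: "?i \<and> ?ii \<and> ?iii"
    show "?E = ?X"
    proof (intro equalityI subsetI)
      \<comment> \<open>By (i), \<open>z\<close> is an eigenvalue of a limit matrix of size at most
        \<open>l\<close>, and (ii) confines such eigenvalues to the given points. The reverse
        inclusion rests on (iii).\<close>
      fix z assume "z \<in> ?E"
      then obtain k M where M: "k \<in> {1..l}" "limit_matrix a b k M" and "eigenvalue M z"
        using singular_imp_limit_eigenvalue conds sing by blast
      then have "z \<in> spectrum M" by (simp add: spectrum_def)
      moreover have "spectrum M \<subseteq> ?X" using conds M by blast
      ultimately show "z \<in> ?X" by blast
    next
      fix z assume "z \<in> ?X"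
      with conds obtain k M where "limit_matrix a b k M" "eigenvalue M z" by blast
      then show "z \<in> ?E" using limit_matrix_eigenvalue_singular sing by blast
    qed
  qed
qed

end
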